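(* There exists a Noetherian local $F$-finite domain $(R,\mathfrak m)$ of prime characteristic and an integer $i$ such that the local cohomology module $H^i_{\mathfrak m}(R)$ has no $F$-stable secondary representation (i.e. none of its secondary representations is $F$-stable).
   Context: A ring of characteristic $p>0$ is $F$-finite if its Frobenius endomorphism is finite. Let $(R,\mathfrak m)$ be a $d$-dimensional Noetherian local ring of characteristic $p>0$ and $M$ an $R$-module. $M$ is secondary if $M\ne 0$ and for every $x\in R$ the multiplication-by-$x$ map $M\to M$ is either surjective or nilpotent. A secondary representation of $M$ is a decomposition $M=\sum_{j=1}^n M_j$ where each $M_j\subseteq M$ is a secondary submodule. For $0\le i\le d$, a secondary representation $H^i_{\mathfrak m}(R)=\sum_{j=1}^n M_j$ is $F$-stable if $F(M_j)\subseteq M_j$ for every $j$, where $F$ is the natural Frobenius action on $H^i_{\mathfrak m}(R)$. *)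

theory Defs
  imports "HOL-Algebra.Module" "HOL-Algebra.Ring_Divisibility" "HOL-Computational_Algebra.Primes"
begin

section \<open>Rings\<close>

definition has_characteristic :: "('a, 'c) ring_scheme \<Rightarrow> nat \<Rightarrow> bool"
  where "has_characteristic R p \<longleftrightarrow>
    (\<forall>n::nat. [n] \<cdot>\<^bsub>R\<^esub> \<one>\<^bsub>R\<^esub> = \<zero>\<^bsub>R\<^esub> \<longleftrightarrow> p dvd n)"

definition local_ring :: "('a, 'c) ring_scheme \<Rightarrow> 'a set \<Rightarrow> bool"
  where "local_ring R \<mm> \<longleftrightarrow> cring R \<and> (\<forall>I. maximalideal I R \<longleftrightarrow> I = \<mm>)"

text \<open>The Frobenius endomorphism is finite: \<open>R\<close> is finitely generated as a module over itself
  via \<open>r \<mapsto> r\<^sup>p\<close>.\<close>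

definition F_finite :: "('a, 'c) ring_scheme \<Rightarrow> nat \<Rightarrow> bool"
  where "F_finite R p \<longleftrightarrow>
    (\<exists>A. finite A \<and> A \<subseteq> carrier R \<and>
      (\<forall>r\<in>carrier R. \<exists>c\<in>A \<rightarrow> carrier R. r = (\<Oplus>\<^bsub>R\<^esub>a\<in>A. (c a [^]\<^bsub>R\<^esub> p) \<otimes>\<^bsub>R\<^esub> a)))"


section \<open>Secondary representations\<close>

definition secondary :: "('a, 'c) ring_scheme \<Rightarrow> ('a, 'b, 'd) module_scheme \<Rightarrow> bool"
  where "secondary R M \<longleftrightarrow>
    carrier M \<noteq> {\<zero>\<^bsub>M\<^esub>} \<and>
    (\<forall>x\<in>carrier R.
       (\<lambda>v. x \<odot>\<^bsub>M\<^esub> v) ` carrier M = carrier M \<or>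
       (\<exists>k::nat. \<forall>v\<in>carrier M. ((\<lambda>v. x \<odot>\<^bsub>M\<^esub> v) ^^ k) v = \<zero>\<^bsub>M\<^esub>))"

text \<open>The summands are \<open>N 0, \<dots>, N (n - 1)\<close>. The case \<open>n = 0\<close> is allowed, so that the zero module
  has the empty secondary representation.\<close>

definition secondary_representation ::
    "('a, 'c) ring_scheme \<Rightarrow> ('a, 'b, 'd) module_scheme \<Rightarrow> nat \<Rightarrow> (nat \<Rightarrow> 'b set) \<Rightarrow> bool"
  where "secondary_representation R M n N \<longleftrightarrow>
    (\<forall>j<n. submodule (N j) R M \<and> secondary R (M\<lparr>carrier := N j\<rparr>)) \<and>
    carrier M = {(\<Oplus>\<^bsub>M\<^esub>j\<in>{..<n}. v j) | v. \<forall>j<n. v j \<in> N j}"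

definition F_stable_secondary_representation ::
    "('a, 'c) ring_scheme \<Rightarrow> ('a, 'b, 'd) module_scheme \<Rightarrow> ('b \<Rightarrow> 'b) \<Rightarrow>
     nat \<Rightarrow> (nat \<Rightarrow> 'b set) \<Rightarrow> bool"
  where "F_stable_secondary_representation R M F n N \<longleftrightarrow>
    secondary_representation R M n N \<and> (\<forall>j<n. F ` N j \<subseteq> N j)"


section \<open>Localization\<close>

text \<open>\<open>(a, s)\<close> stands for the fraction \<open>a / s\<close>; \<open>S\<close> is a multiplicative subset of a commutative
  ring \<open>R\<close>, possibly containing zero divisors.\<close>

definition frac_rel :: "('a, 'c) ring_scheme \<Rightarrow> 'a set \<Rightarrow> (('a \<times> 'a) \<times> ('a \<times> 'a)) set"
  where "frac_rel R S =
    {((a, s), (b, t)). a \<in> carrier R \<and> b \<in> carrier R \<and> s \<in> S \<and> t \<in> S \<and>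
       (\<exists>u\<in>S. u \<otimes>\<^bsub>R\<^esub> (t \<otimes>\<^bsub>R\<^esub> a) = u \<otimes>\<^bsub>R\<^esub> (s \<otimes>\<^bsub>R\<^esub> b))}"

definition fraction :: "('a, 'c) ring_scheme \<Rightarrow> 'a set \<Rightarrow> 'a \<Rightarrow> 'a \<Rightarrow> ('a \<times> 'a) set"
  where "fraction R S a s = frac_rel R S `` {(a, s)}"

text \<open>The localization of \<open>R\<close> at \<open>S\<close> as an \<open>R\<close>-algebra. Functions on fractions are given as unions
  over all representatives; all these representatives yield the same class.\<close>

definition localization ::
    "('a, 'c) ring_scheme \<Rightarrow> 'a set \<Rightarrow> ('a, ('a \<times> 'a) set) module"
  where "localization R S =
    \<lparr>carrier = (carrier R \<times> S) // frac_rel R S,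
     monoid.mult = (\<lambda>U V. \<Union>(a, s)\<in>U. \<Union>(b, t)\<in>V. fraction R S (a \<otimes>\<^bsub>R\<^esub> b) (s \<otimes>\<^bsub>R\<^esub> t)),
     one = fraction R S \<one>\<^bsub>R\<^esub> \<one>\<^bsub>R\<^esub>,
     zero = fraction R S \<zero>\<^bsub>R\<^esub> \<one>\<^bsub>R\<^esub>,
     add = (\<lambda>U V. \<Union>(a, s)\<in>U. \<Union>(b, t)\<in>V.
              fraction R S ((t \<otimes>\<^bsub>R\<^esub> a) \<oplus>\<^bsub>R\<^esub> (s \<otimes>\<^bsub>R\<^esub> b)) (s \<otimes>\<^bsub>R\<^esub> t)),
     module.smult = (\<lambda>r U. \<Union>(a, s)\<in>U. fraction R S (r \<otimes>\<^bsub>R\<^esub> a) s)\<rparr>"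

text \<open>The canonical map to the localization at \<open>T\<close> from one at a smaller multiplicative set.\<close>

definition loc_map :: "('a, 'c) ring_scheme \<Rightarrow> 'a set \<Rightarrow> ('a \<times> 'a) set \<Rightarrow> ('a \<times> 'a) set"
  where "loc_map R T U = (\<Union>(a, s)\<in>U. fraction R T a s)"

definition loc_frobenius ::
    "('a, 'c) ring_scheme \<Rightarrow> nat \<Rightarrow> 'a set \<Rightarrow> ('a \<times> 'a) set \<Rightarrow> ('a \<times> 'a) set"
  where "loc_frobenius R p S U = (\<Union>(a, s)\<in>U. fraction R S (a [^]\<^bsub>R\<^esub> p) (s [^]\<^bsub>R\<^esub> p))"


section \<open>Local cohomology via the Cech complex\<close>

text \<open>For \<open>I = {j\<^sub>1 < \<dots> < j\<^sub>i}\<close> this is the multiplicative set generated by the \<open>xs ! j\<close>, \<open>j \<in> I\<close>.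
  Localizing at it is the same as inverting the single element \<open>xs ! j\<^sub>1 \<cdots> xs ! j\<^sub>i\<close>, and these
  sets are monotone in \<open>I\<close>.\<close>

definition monomials :: "('a, 'c) ring_scheme \<Rightarrow> 'a list \<Rightarrow> nat set \<Rightarrow> 'a set"
  where "monomials R xs I = {(\<Otimes>\<^bsub>R\<^esub>j\<in>I. (xs ! j) [^]\<^bsub>R\<^esub> (e j)) | e :: nat \<Rightarrow> nat. True}"

abbreviation cech_loc ::
    "('a, 'c) ring_scheme \<Rightarrow> 'a list \<Rightarrow> nat set \<Rightarrow> ('a, ('a \<times> 'a) set) module"
  where "cech_loc R xs I \<equiv> localization R (monomials R xs I)"

definition cech_index :: "'a list \<Rightarrow> nat \<Rightarrow> nat set set"
  where "cech_index xs i = {I. I \<subseteq> {..<length xs} \<and> card I = i}"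

type_synonym 'a cochain = "nat set \<Rightarrow> ('a \<times> 'a) set"

text \<open>The direct sum of the localizations \<open>cech_loc R xs I\<close> over all \<open>I\<close> with \<open>i\<close> elements.
  In this module and in \<open>subquotient\<close> below the ring multiplication and unit carry no meaning.\<close>

definition cech_module ::
    "('a, 'c) ring_scheme \<Rightarrow> 'a list \<Rightarrow> nat \<Rightarrow> ('a, 'a cochain) module"
  where "cech_module R xs i =
    \<lparr>carrier = (\<Pi>\<^sub>E I\<in>cech_index xs i. carrier (cech_loc R xs I)),
     monoid.mult = undefined, one = undefined,
     zero = (\<lambda>I\<in>cech_index xs i. \<zero>\<^bsub>cech_loc R xs I\<^esub>),
     add = (\<lambda>c c'. \<lambda>I\<in>cech_index xs i. c I \<oplus>\<^bsub>cech_loc R xs I\<^esub> c' I),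
     module.smult = (\<lambda>r c. \<lambda>I\<in>cech_index xs i. r \<odot>\<^bsub>cech_loc R xs I\<^esub> c I)\<rparr>"

text \<open>The sign attached to removing \<open>j\<close> from \<open>J\<close> is determined by the position of \<open>j\<close> in \<open>J\<close>.\<close>

definition cech_diff ::
    "('a, 'c) ring_scheme \<Rightarrow> 'a list \<Rightarrow> nat \<Rightarrow> 'a cochain \<Rightarrow> 'a cochain"
  where "cech_diff R xs i c =
    (\<lambda>J\<in>cech_index xs (Suc i). \<Oplus>\<^bsub>cech_loc R xs J\<^esub>j\<in>J.
       ((\<ominus>\<^bsub>R\<^esub> \<one>\<^bsub>R\<^esub>) [^]\<^bsub>R\<^esub> card {k \<in> J. k < j}) \<odot>\<^bsub>cech_loc R xs J\<^esub>
       loc_map R (monomials R xs J) (c (J - {j})))"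

definition cech_frobenius ::
    "('a, 'c) ring_scheme \<Rightarrow> nat \<Rightarrow> 'a list \<Rightarrow> nat \<Rightarrow> 'a cochain \<Rightarrow> 'a cochain"
  where "cech_frobenius R p xs i c =
    (\<lambda>I\<in>cech_index xs i. loc_frobenius R p (monomials R xs I) (c I))"

definition cocycles :: "('a, 'c) ring_scheme \<Rightarrow> 'a list \<Rightarrow> nat \<Rightarrow> 'a cochain set"
  where "cocycles R xs i =
    a_kernel (cech_module R xs i) (cech_module R xs (Suc i)) (cech_diff R xs i)"

definition coboundaries :: "('a, 'c) ring_scheme \<Rightarrow> 'a list \<Rightarrow> nat \<Rightarrow> 'a cochain set"
  where "coboundaries R xs i =
    (case i of 0 \<Rightarrow> {\<zero>\<^bsub>cech_module R xs 0\<^esub>}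
     | Suc k \<Rightarrow> cech_diff R xs k ` carrier (cech_module R xs k))"

text \<open>The quotient \<open>Z / B\<close> for submodules \<open>B \<subseteq> Z\<close> of \<open>M\<close>; its elements are cosets of \<open>B\<close>.\<close>

definition subquotient ::
    "('a, 'b, 'd) module_scheme \<Rightarrow> 'b set \<Rightarrow> 'b set \<Rightarrow> ('a, 'b set) module"
  where "subquotient M Z B =
    \<lparr>carrier = (\<lambda>z. a_r_coset M B z) ` Z,
     monoid.mult = undefined, one = undefined,
     zero = B,
     add = set_add M,
     module.smult = (\<lambda>r U. \<Union>z\<in>U. a_r_coset M B (r \<odot>\<^bsub>M\<^esub> z))\<rparr>"

text \<open>If the entries of \<open>xs\<close> generate the ideal \<open>\<aa>\<close>, then this is the \<open>i\<close>-th local cohomology module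
  of \<open>R\<close> with support in \<open>\<aa>\<close>; up to an isomorphism compatible with the Frobenius action it depends
  only on \<open>\<aa>\<close>.\<close>

definition local_cohomology ::
    "('a, 'c) ring_scheme \<Rightarrow> 'a list \<Rightarrow> nat \<Rightarrow> ('a, 'a cochain set) module"
  where "local_cohomology R xs i =
    subquotient (cech_module R xs i) (cocycles R xs i) (coboundaries R xs i)"

text \<open>The natural Frobenius action, induced by the Frobenius of each localization.\<close>

definition local_cohomology_frobenius ::
    "('a, 'c) ring_scheme \<Rightarrow> nat \<Rightarrow> 'a list \<Rightarrow> nat \<Rightarrow> 'a cochain set \<Rightarrow> 'a cochain set"
  where "local_cohomology_frobenius R p xs i U =
    (\<Union>z\<in>U. a_r_coset (cech_module R xs i) (coboundaries R xs i) (cech_frobenius R p xs i z))"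

end

theory Submission
  imports Defs "HOL-Computational_Algebra.Formal_Power_Series"
    "HOL-Computational_Algebra.Polynomial_Factorial" "HOL-Library.Countable"
begin

text \<open>Let \<open>k\<close> be the field with four elements, \<open>\<omega>\<close> a generator of it, \<open>S = k[[a, b, c]]\<close>,
  \<open>D = a\<^sup>2 \<partial>\<^sub>a + b\<^sup>2 \<partial>\<^sub>b + c\<^sup>2 \<partial>\<^sub>c\<close>, and let \<open>R\<close> be the ring of all \<open>f\<close> in \<open>S\<close> with \<open>D f = 0\<close> and
  \<open>f(a, 0, 0) \<in> F\<^sub>2[[a]]\<close>. As \<open>S\<close> is a finite free module over \<open>F\<^sub>2[[a\<^sup>4, b\<^sup>4, c\<^sup>4]] \<subseteq> R\<close>, the ring
  \<open>R\<close> is Noetherian and \<open>F\<close>-finite.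

  Since \<open>S\<close> has depth three, a two-cocycle of \<open>R\<close> is \<open>z\<^sub>j\<^sub>k = u\<^sub>j - u\<^sub>k\<close> with \<open>u\<^sub>j\<close> in the localization of
  \<open>S\<close> at \<open>x\<^sub>j\<close>, and then \<open>v = D u\<^sub>j\<close> lies in \<open>S\<close> and does not depend on \<open>j\<close>. Because \<open>D S\<close> contains no
  power series with a constant term, the trace of \<open>v(0)\<close> in \<open>F\<^sub>2\<close> is an invariant of the class of \<open>z\<close>
  in \<open>H\<^sup>2\<close>. It is one for the class with \<open>u\<^sub>j = \<omega> / a\<close> near the curve \<open>b = c = 0\<close>. It vanishes on
  \<open>a\<^sup>2 H\<^sup>2\<close>, hence on every secondary submodule on which \<open>a\<^sup>2\<close> is surjective. On an \<open>F\<close>-stable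
  submodule killed by a power of \<open>a\<^sup>2\<close>, the trace \<open>w \<in> F\<^sub>2((a))\<close> of the restriction of \<open>u\<^sub>j\<close> to the curve
  can have no pole, as the orders of the poles of \<open>w, w\<^sup>2, w\<^sup>4, \<dots>\<close> are bounded; since \<open>a\<^sup>2 w'\<close> is the
  trace of \<open>v(a, 0, 0)\<close>, the invariant vanishes there, too.\<close>


section \<open>Rings of characteristic two\<close>

text \<open>The derivation is chosen so that \<open>D (1/a) = 1\<close>: a simple pole along the
  curve becomes a constant term, which no element of \<open>D S\<close> has. The kernel of
  \<open>D\<close> alone would not do as a ring: the squares \<open>u_j^2\<close> are killed by
  \<open>D\<close>, so they would be admissible cochains and Frobenius would annihilate
  \<open>H^2\<close>. The condition on the curve prevents this. Localizations of \<open>R\<close> at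
  elements that do not vanish on the curve restrict to \<open>F_2((a))\<close>, where the trace of
  \<open>F_4\<close> over \<open>F_2\<close> vanishes. So the trace of \<open>u_j\<close> on the
  curve is determined by the class up to a series without poles, and \<open>\<omega>\<close> is used
  because its trace is 1. Frobenius then kills \<open>v\<close> but doubles the pole of the trace,
  and this tension excludes stability.

  The generators of the maximal ideal form an arbitrary list. The Cech complex of \<open>S\<close>
  is therefore treated for any finite family whose ideal in \<open>S\<close> contains
  \<open>a^2\<close>, \<open>b^2\<close> and \<open>c^2\<close>.\<close>

class char_two = comm_ring_1 +
  assumes one_plus_one: "1 + 1 = 0"
begin

lemma add_self [simp]: "x + x = 0"
  by (metis distrib_left mult.right_neutral mult_zero_right one_plus_one)

lemma uminus_char_two [simp]: "- x = x"
  using add_self neg_eq_iff_add_eq_0 by blast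

lemma minus_char_two [simp]: "x - y = x + y"
  by (metis uminus_char_two diff_conv_add_uminus)

lemma two_char_two: "2 = 0"
  using one_plus_one one_add_one by metis

lemma add_self_left [simp]: "x + (x + y) = y"
  by (simp flip: add.assoc)

lemma add_eq_0_char_two: "x + y = 0 \<longleftrightarrow> x = y"
  by (metis add.left_neutral add.right_neutral add_self_left)

lemma add_swap_char_two: "a + b = c + d \<longleftrightarrow> a + c = b + d"
proof -
  have "(a + b) + (c + d) = (a + c) + (b + d)" by (simp only: ac_simps)
  then show ?thesis by (metis add_eq_0_char_two)
qed

lemma square_add_char_two: "(x + y)\<^sup>2 = x\<^sup>2 + y\<^sup>2"
proof -
  have "(x + y)\<^sup>2 = x\<^sup>2 + y\<^sup>2 + (x * y + x * y)"
    by (simp only: power2_eq_square algebra_simps)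
  then show ?thesis by simp
qed

lemma power_add_char_two: "(x + y) ^ (2 ^ m) = x ^ (2 ^ m) + y ^ (2 ^ m)"
  by (induction m arbitrary: x y) (simp_all add: power_mult square_add_char_two)

lemma power_sum_char_two: "sum f A ^ (2 ^ m) = (\<Sum>x\<in>A. f x ^ (2 ^ m))"
  by (induction A rule: infinite_finite_induct) (simp_all add: power_add_char_two power_0_left)

lemma of_nat_char_two: "of_nat n = (if even n then 0 else 1)"
  by (induction n) (auto simp: one_plus_one)

end

instance fps :: (char_two) char_two
  by standard (rule fps_ext, simp only: fps_add_nth fps_one_nth, simp add: one_plus_one del: one_add_one)

instance fract :: ("{idom, char_two}") char_two
  by standard (simp add: One_fract_def Zero_fract_def one_plus_one eq_fract)


section \<open>The field with four elements\<close>

datatype gf4 = GF0 | GF1 | GFw | GFw2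

text \<open>Countability serves the final encoding of power series as sets of natural
  numbers.\<close>

instance gf4 :: countable
  by countable_datatype

instantiation gf4 :: field
begin

definition "zero_gf4 = GF0"
definition "one_gf4 = GF1"
definition "uminus_gf4 (x :: gf4) = x"
fun plus_gf4 where
  "plus_gf4 GF0 y = y"
| "plus_gf4 GF1 y = (case y of GF0 \<Rightarrow> GF1 | GF1 \<Rightarrow> GF0 | GFw \<Rightarrow> GFw2 | GFw2 \<Rightarrow> GFw)"
| "plus_gf4 GFw y = (case y of GF0 \<Rightarrow> GFw | GF1 \<Rightarrow> GFw2 | GFw \<Rightarrow> GF0 | GFw2 \<Rightarrow> GF1)"
| "plus_gf4 GFw2 y = (case y of GF0 \<Rightarrow> GFw2 | GF1 \<Rightarrow> GFw | GFw \<Rightarrow> GF1 | GFw2 \<Rightarrow> GF0)"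
definition "minus_gf4 (x :: gf4) y = x + y"
fun times_gf4 where
  "times_gf4 GF0 y = GF0"
| "times_gf4 GF1 y = y"
| "times_gf4 GFw y = (case y of GF0 \<Rightarrow> GF0 | GF1 \<Rightarrow> GFw | GFw \<Rightarrow> GFw2 | GFw2 \<Rightarrow> GF1)"
| "times_gf4 GFw2 y = (case y of GF0 \<Rightarrow> GF0 | GF1 \<Rightarrow> GFw2 | GFw \<Rightarrow> GF1 | GFw2 \<Rightarrow> GFw)"
text \<open>Nonzero elements satisfy \<open>x^3 = 1\<close>.\<close>

definition "inverse_gf4 (x :: gf4) = x * x"
definition "divide_gf4 (x :: gf4) y = x * (y * y)"

instance
proof
  fix a b c :: gf4
  show "a * b * c = a * (b * c)" by (cases a; cases b; cases c) auto
  show "a * b = b * a" by (cases a; cases b) auto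
  show "1 * a = a" by (simp add: one_gf4_def)
  show "a + b + c = a + (b + c)" by (cases a; cases b; cases c) auto
  show "a + b = b + a" by (cases a; cases b) auto
  show "0 + a = a" by (simp add: zero_gf4_def)
  show "- a + a = 0" by (cases a) (auto simp: zero_gf4_def uminus_gf4_def)
  show "a - b = a + - b" by (simp add: minus_gf4_def uminus_gf4_def)
  show "(a + b) * c = a * c + b * c" by (cases a; cases b; cases c) auto
  show "(0::gf4) \<noteq> 1" by (simp add: zero_gf4_def one_gf4_def)
  show "inverse (0::gf4) = 0" by (simp add: zero_gf4_def inverse_gf4_def)
  show "a \<noteq> 0 \<Longrightarrow> inverse a * a = 1"
    by (cases a) (auto simp: zero_gf4_def one_gf4_def inverse_gf4_def)
  show "a div b = a * inverse b" by (simp add: divide_gf4_def inverse_gf4_def)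
qed

end

instance gf4 :: char_two
  by standard (simp add: one_gf4_def zero_gf4_def)

lemma UNIV_gf4: "UNIV = {GF0, GF1, GFw, GFw2}"
  by (auto intro: gf4.exhaust)

lemma gf4_power4: "(x::gf4) ^ 4 = x"
  by (cases x) (auto simp: numeral_eq_Suc one_gf4_def)


unbundle fps_syntax

section \<open>Coefficientwise maps of power series\<close>

definition fps_map :: "('a \<Rightarrow> 'b) \<Rightarrow> 'a fps \<Rightarrow> 'b fps"
  where "fps_map h f = Abs_fps (\<lambda>n. h (f $ n))"

lemma fps_map_nth [simp]: "fps_map h f $ n = h (f $ n)"
  by (simp add: fps_map_def)

definition ring_map :: "('a::comm_ring_1 \<Rightarrow> 'b::comm_ring_1) \<Rightarrow> bool"
  where "ring_map h \<longleftrightarrow> h 1 = 1 \<and> (\<forall>x y. h (x + y) = h x + h y) \<and> (\<forall>x y. h (x * y) = h x * h y)"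

lemma ring_mapD:
  assumes "ring_map h"
  shows "h 1 = 1" "h (x + y) = h x + h y" "h (x * y) = h x * h y" "h 0 = 0" "h (sum g A) = (\<Sum>x\<in>A. h (g x))"
    "h (x ^ n) = h x ^ n"
proof -
  show a: "h 1 = 1" "h (x + y) = h x + h y" "h (x * y) = h x * h y" for x y
    using assms by (auto simp: ring_map_def)
  have "h 0 + h 0 = h 0 + 0" by (metis a(2) add.right_neutral)
  then show 0: "h 0 = 0" by (rule add_left_imp_eq)
  show "h (sum g A) = (\<Sum>x\<in>A. h (g x))"
    by (induction A rule: infinite_finite_induct) (auto simp: a 0)
  show "h (x ^ n) = h x ^ n" by (induction n) (auto simp: a)
qed

lemma ring_map_fps_map: "ring_map h \<Longrightarrow> ring_map (fps_map h)"
  unfolding ring_map_def[of "fps_map h"]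
  by (auto simp: fps_eq_iff ring_mapD fps_mult_nth)

section \<open>Derivations and their extension to power series\<close>

definition derivation :: "('a::comm_ring_1 \<Rightarrow> 'a) \<Rightarrow> bool"
  where "derivation d \<longleftrightarrow> (\<forall>x y. d (x + y) = d x + d y) \<and> (\<forall>x y. d (x * y) = d x * y + x * d y)"

lemma derivationD:
  assumes "derivation d"
  shows "d (x + y) = d x + d y" "d (x * y) = d x * y + x * d y" "d 0 = 0" "d 1 = 0"
    "d (sum g A) = (\<Sum>x\<in>A. d (g x))"
proof -
  show a: "d (x + y) = d x + d y" "d (x * y) = d x * y + x * d y" for x y
    using assms by (auto simp: derivation_def)
  have "d 0 + d 0 = d 0 + 0" by (metis a(1) add.right_neutral)
  then show 0: "d 0 = 0" by (rule add_left_imp_eq)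
  have "d 1 + d 1 = d 1 + 0" using a(2)[of 1 1] by simp
  then show "d 1 = 0" by (rule add_left_imp_eq)
  show "d (sum g A) = (\<Sum>x\<in>A. d (g x))"
    by (induction A rule: infinite_finite_induct) (auto simp: a 0)
qed

lemma derivation_square:
  fixes d :: "'a::char_two \<Rightarrow> 'a"
  assumes "derivation d"
  shows "d (x\<^sup>2) = 0"
  by (simp add: power2_eq_square derivationD[OF assms] mult.commute)

text \<open>Adds \<open>x^2 d/dx\<close> in the new variable \<open>x\<close> to the derivation
  \<open>d\<close> of the coefficients. The factor \<open>x^2\<close> keeps constant terms out of
  the image of the new summand, but sends \<open>1/x\<close> to the constant
  \<open>-1\<close>.\<close>

definition ext_deriv :: "('a::comm_ring_1 \<Rightarrow> 'a) \<Rightarrow> 'a fps \<Rightarrow> 'a fps"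
  where "ext_deriv d f = fps_X\<^sup>2 * fps_deriv f + fps_map d f"

lemma derivation_ext_deriv:
  assumes "derivation d"
  shows "derivation (ext_deriv d)"
proof -
  have m: "fps_map d (f + g) = fps_map d f + fps_map d g" for f g
    by (simp add: fps_eq_iff derivationD[OF assms])
  have "fps_map d (f * g) = fps_map d f * g + f * fps_map d g" for f g
    by (simp add: fps_eq_iff fps_mult_nth derivationD[OF assms] sum.distrib)
  then show ?thesis
    by (simp add: derivation_def ext_deriv_def m algebra_simps)
qed

lemma ext_deriv_fps_const: "d 0 = 0 \<Longrightarrow> ext_deriv d (fps_const x) = fps_const (d x)"
  by (simp add: ext_deriv_def) (simp add: fps_eq_iff)

lemma ext_deriv_fps_X: "derivation d \<Longrightarrow> ext_deriv d fps_X = fps_X\<^sup>2"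
  by (simp add: ext_deriv_def) (simp add: fps_eq_iff fps_X_def derivationD)

lemma ext_deriv_nth_0: "ext_deriv d f $ 0 = d (f $ 0)"
  by (simp add: ext_deriv_def fps_mult_nth_0)

lemma ext_deriv_eq_0:
  fixes f :: "'a::char_two fps"
  assumes "\<And>n. odd n \<Longrightarrow> f $ n = 0" "\<And>n. d (f $ n) = 0"
  shows "ext_deriv d f = 0"
proof -
  have "fps_deriv f = 0"
    using assms by (auto simp: fps_eq_iff of_nat_char_two fps_deriv_nth simp del: of_nat_add of_nat_Suc)
  moreover have "fps_map d f = 0" using assms by (simp add: fps_eq_iff)
  ultimately show ?thesis by (simp add: ext_deriv_def)
qed


section \<open>The ring\<close>

text \<open>The outermost variable is \<open>a\<close> and the innermost one is \<open>c\<close>; the derivation \<open>D\<close> is called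
  \<open>vfield\<close>, \<open>R0\<close> is the ring \<open>R\<close>, and
  \<open>curve\<close> is the restriction to the curve \<open>b = c = 0\<close>.\<close>

type_synonym pow = "gf4 fps fps fps"

definition va :: pow where "va = fps_X"
definition vb :: pow where "vb = fps_const fps_X"
definition vc :: pow where "vc = fps_const (fps_const fps_X)"
definition scal :: "gf4 \<Rightarrow> pow" where "scal t = fps_const (fps_const (fps_const t))"

definition vfield :: "pow \<Rightarrow> pow"
  where "vfield = ext_deriv (ext_deriv (ext_deriv (\<lambda>_. 0)))"

definition ev0 :: "pow \<Rightarrow> gf4" where "ev0 f = f $ 0 $ 0 $ 0"

definition curve :: "pow \<Rightarrow> gf4 fps" where "curve = fps_map (\<lambda>h. h $ 0 $ 0)"

definition conjugate :: "gf4 fps \<Rightarrow> gf4 fps" where "conjugate = fps_map (\<lambda>x. x\<^sup>2)"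

definition R0 :: "pow set" where "R0 = {f. vfield f = 0 \<and> conjugate (curve f) = curve f}"

lemma ring_map_ev0: "ring_map ev0"
  by (simp add: ring_map_def ev0_def)

lemma ring_map_curve: "ring_map curve"
  unfolding curve_def by (intro ring_map_fps_map) (simp add: ring_map_def)

lemma ring_map_conjugate: "ring_map conjugate"
  unfolding conjugate_def
  by (intro ring_map_fps_map) (simp add: ring_map_def square_add_char_two power_mult_distrib)

lemma derivation_vfield: "derivation vfield"
  unfolding vfield_def by (intro derivation_ext_deriv) (simp add: derivation_def)

lemmas ev0_simps = ring_mapD[OF ring_map_ev0]
lemmas curve_simps = ring_mapD[OF ring_map_curve]
lemmas conjugate_simps = ring_mapD[OF ring_map_conjugate]
lemmas vfield_simps = derivationD[OF derivation_vfield]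

lemma conjugate_conjugate: "conjugate (conjugate f) = f"
  by (simp add: conjugate_def fps_eq_iff gf4_power4)

lemma curve_nth_0: "curve f $ 0 = ev0 f"
  by (simp add: curve_def ev0_def)

text \<open>The coefficients \<open>b^2\<close> and \<open>c^2\<close> of \<open>D\<close> vanish on
  the curve, so \<open>D\<close> is tangent to it and restricts to \<open>a^2 d/da\<close>.\<close>

lemma curve_vfield: "curve (vfield f) = fps_X\<^sup>2 * fps_deriv (curve f)"
proof -
  have "curve (fps_X\<^sup>2 * g) = fps_X\<^sup>2 * curve g" for g
    by (auto simp: fps_eq_iff curve_def fps_X_power_mult_nth)
  moreover have "curve (fps_deriv f) = fps_deriv (curve f)"
    by (auto simp: fps_eq_iff curve_def fps_of_nat fps_mult_nth_0 simp flip: fps_of_nat)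
  moreover have "curve (fps_map (ext_deriv (ext_deriv (\<lambda>_. 0))) f) = 0"
    by (simp add: curve_def fps_eq_iff ext_deriv_nth_0)
  ultimately show ?thesis
    unfolding vfield_def ext_deriv_def[of _ f] curve_simps(2) by simp
qed

lemma ev0_vfield: "ev0 (vfield f) = 0"
  by (simp add: ev0_def vfield_def ext_deriv_nth_0)

lemma vfield_vars: "vfield va = va\<^sup>2" "vfield vb = vb\<^sup>2" "vfield vc = vc\<^sup>2" "vfield (scal t) = 0"
proof -
  have d: "derivation (\<lambda>_::gf4. 0)" by (simp add: derivation_def)
  note d' = derivation_ext_deriv[OF d] derivation_ext_deriv[OF derivation_ext_deriv[OF d]]
  show "vfield va = va\<^sup>2" "vfield vb = vb\<^sup>2" "vfield vc = vc\<^sup>2" "vfield (scal t) = 0"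
    by (simp_all add: vfield_def va_def vb_def vc_def scal_def ext_deriv_fps_const ext_deriv_fps_X d d' derivationD
      fps_const_power)
qed

lemma curve_vars: "curve va = fps_X" "curve vb = 0" "curve vc = 0" "curve (scal t) = fps_const t"
  by (auto simp: curve_def va_def vb_def vc_def scal_def fps_eq_iff fps_X_def)

lemma ev0_vars: "ev0 va = 0" "ev0 vb = 0" "ev0 vc = 0" "ev0 (scal t) = t"
  by (auto simp: ev0_def va_def vb_def vc_def scal_def)

lemma R0_closed:
  "0 \<in> R0" "1 \<in> R0" "f \<in> R0 \<Longrightarrow> g \<in> R0 \<Longrightarrow> f + g \<in> R0" "f \<in> R0 \<Longrightarrow> g \<in> R0 \<Longrightarrow> f * g \<in> R0"
  "f \<in> R0 \<Longrightarrow> f ^ n \<in> R0"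
proof -
  show "0 \<in> R0" "1 \<in> R0" "f \<in> R0 \<Longrightarrow> g \<in> R0 \<Longrightarrow> f + g \<in> R0" and
    m: "f \<in> R0 \<Longrightarrow> g \<in> R0 \<Longrightarrow> f * g \<in> R0" for f g
    by (simp_all add: R0_def vfield_simps curve_simps conjugate_simps)
  show "f \<in> R0 \<Longrightarrow> f ^ n \<in> R0" by (induction n) (auto intro: m \<open>1 \<in> R0\<close>)
qed

lemma R0_square_vars: "va\<^sup>2 \<in> R0" "vb\<^sup>2 \<in> R0" "vc\<^sup>2 \<in> R0"
proof -
  have "conjugate fps_X = fps_X" by (simp add: conjugate_def fps_eq_iff fps_X_def)
  then show "va\<^sup>2 \<in> R0" "vb\<^sup>2 \<in> R0" "vc\<^sup>2 \<in> R0"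
    by (simp_all add: R0_def derivation_square[OF derivation_vfield] curve_simps curve_vars conjugate_simps)
qed

text \<open>The inverse \<open>g\<close> in \<open>S\<close> inherits both conditions:
  \<open>f * D g = D (f * g) = 0\<close>, and the conjugate of \<open>curve g\<close> is again an
  inverse of \<open>curve f\<close>.\<close>

lemma R0_inverse:
  assumes "f \<in> R0" "ev0 f \<noteq> 0"
  shows "\<exists>g\<in>R0. f * g = 1"
proof -
  \<comment> \<open>The coefficient rings are themselves power series rings, so the inverse is built
    level by level, starting from the inverse of the constant term in the field.\<close>
  let ?g = "fps_right_inverse f (fps_right_inverse (f $ 0) (fps_right_inverse (f $ 0 $ 0) (inverse (f $ 0 $ 0 $ 0))))"
  have "f $ 0 $ 0 * fps_right_inverse (f $ 0 $ 0) (inverse (f $ 0 $ 0 $ 0)) = 1"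
    using assms by (intro fps_right_inverse right_inverse) (simp add: ev0_def)
  then have "f $ 0 * fps_right_inverse (f $ 0) (fps_right_inverse (f $ 0 $ 0) (inverse (f $ 0 $ 0 $ 0))) = 1"
    by (rule fps_right_inverse)
  then have fg: "f * ?g = 1" by (rule fps_right_inverse)
  have "f * vfield ?g = 0"
    using arg_cong[OF fg, of vfield] assms by (simp add: vfield_simps R0_def)
  then have "vfield ?g = 0" using fg by auto
  moreover have "curve f * curve ?g = 1" using arg_cong[OF fg, of curve] by (simp add: curve_simps)
  moreover have "curve f * conjugate (curve ?g) = 1"
    using arg_cong[OF calculation(2), of conjugate] assms by (simp add: conjugate_simps R0_def)
  ultimately have "?g \<in> R0"
    by (auto simp: R0_def) (metis mult_cancel_left mult_zero_left zero_neq_one)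
  then show ?thesis using fg by blast
qed

section \<open>Noetherian modules of power series\<close>

definition subring_set :: "'a::comm_ring_1 set \<Rightarrow> bool"
  where "subring_set A \<longleftrightarrow> 1 \<in> A \<and> (\<forall>x\<in>A. \<forall>y\<in>A. x - y \<in> A \<and> x * y \<in> A)"

definition submod :: "'a::comm_ring_1 set \<Rightarrow> 'a set \<Rightarrow> bool"
  where "submod A M \<longleftrightarrow> 0 \<in> M \<and> (\<forall>x\<in>M. \<forall>y\<in>M. x + y \<in> M) \<and> (\<forall>a\<in>A. \<forall>x\<in>M. a * x \<in> M)"

definition lin_span :: "'a::comm_ring_1 set \<Rightarrow> 'a set \<Rightarrow> 'a set"
  where "lin_span A G = {\<Sum>g\<in>G. c g * g | c. \<forall>g\<in>G. c g \<in> A}"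

definition noeth :: "'a::comm_ring_1 set \<Rightarrow> 'a set \<Rightarrow> bool"
  where "noeth A N \<longleftrightarrow> (\<forall>M. submod A M \<and> M \<subseteq> N \<longrightarrow> (\<exists>G\<subseteq>M. finite G \<and> M \<subseteq> lin_span A G))"

lemma subring_setD:
  assumes "subring_set A"
  shows "1 \<in> A" "0 \<in> A" "x \<in> A \<Longrightarrow> y \<in> A \<Longrightarrow> x - y \<in> A" "x \<in> A \<Longrightarrow> y \<in> A \<Longrightarrow> x * y \<in> A"
    "x \<in> A \<Longrightarrow> - x \<in> A" "x \<in> A \<Longrightarrow> y \<in> A \<Longrightarrow> x + y \<in> A" "(\<And>i. i \<in> I \<Longrightarrow> f i \<in> A) \<Longrightarrow> sum f I \<in> A"
proof -
  show "1 \<in> A" and d: "x \<in> A \<Longrightarrow> y \<in> A \<Longrightarrow> x - y \<in> A"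
    and "x \<in> A \<Longrightarrow> y \<in> A \<Longrightarrow> x * y \<in> A" for x y
    using assms by (auto simp: subring_set_def)
  show 0: "0 \<in> A" using d[OF \<open>1 \<in> A\<close> \<open>1 \<in> A\<close>] by simp
  show u: "x \<in> A \<Longrightarrow> - x \<in> A" for x using d[OF 0] by fastforce
  show p: "x \<in> A \<Longrightarrow> y \<in> A \<Longrightarrow> x + y \<in> A" for x y using d[of x "- y"] u[of y] by simp
  show "(\<And>i. i \<in> I \<Longrightarrow> f i \<in> A) \<Longrightarrow> sum f I \<in> A"
    by (induction I rule: infinite_finite_induct) (auto intro: 0 p)
qed

lemma submodD:
  assumes "submod A M"
  shows "0 \<in> M" "x \<in> M \<Longrightarrow> y \<in> M \<Longrightarrow> x + y \<in> M" "a \<in> A \<Longrightarrow> x \<in> M \<Longrightarrow> a * x \<in> M"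
    "(\<And>i. i \<in> I \<Longrightarrow> f i \<in> M) \<Longrightarrow> sum f I \<in> M"
proof -
  show 0: "0 \<in> M" and p: "x \<in> M \<Longrightarrow> y \<in> M \<Longrightarrow> x + y \<in> M"
    and "a \<in> A \<Longrightarrow> x \<in> M \<Longrightarrow> a * x \<in> M" for x y
    using assms by (auto simp: submod_def)
  show "(\<And>i. i \<in> I \<Longrightarrow> f i \<in> M) \<Longrightarrow> sum f I \<in> M"
    by (induction I rule: infinite_finite_induct) (auto intro: 0 p)
qed

lemma submod_diff:
  assumes "subring_set A" "submod A M" "x \<in> M" "y \<in> M"
  shows "x - y \<in> M"
proof -
  have "(- 1) * y \<in> M" using assms by (intro submodD(3)[OF assms(2)] subring_setD[OF assms(1)])
  then show ?thesis using submodD(2)[OF assms(2,3)] by fastforce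
qed

text \<open>Indices with the same value of \<open>h\<close> share one generator, so their
  coefficients are added.\<close>

lemma lin_span_image:
  assumes "subring_set A" "finite I" "\<And>i. i \<in> I \<Longrightarrow> c i \<in> A"
  shows "(\<Sum>i\<in>I. c i * h i) \<in> lin_span A (h ` I)"
proof -
  have "(\<Sum>i\<in>I. c i * h i) = (\<Sum>y\<in>h ` I. \<Sum>i\<in>{i \<in> I. h i = y}. c i * h i)"
    by (rule sum.image_gen[OF assms(2)])
  also have "\<dots> = (\<Sum>y\<in>h ` I. (\<Sum>i\<in>{i \<in> I. h i = y}. c i) * y)"
    by (intro sum.cong refl) (simp add: sum_distrib_right)
  finally show ?thesis
    using assms(3) unfolding lin_span_def
    by (auto intro!: exI[of _ "\<lambda>y. \<Sum>i\<in>{i \<in> I. h i = y}. c i"] subring_setD[OF assms(1)])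
qed

lemma noeth_finite:
  assumes "subring_set A" "finite N"
  shows "noeth A N"
  unfolding noeth_def
proof (intro allI impI)
  fix M assume M: "submod A M \<and> M \<subseteq> N"
  then have fin: "finite M" using assms(2) finite_subset by blast
  have "x \<in> lin_span A M" if "x \<in> M" for x
  proof -
    have "x = (\<Sum>g\<in>M. (if g = x then 1 else 0) * g)"
      using fin that by (simp add: if_distrib[of "\<lambda>c. c * _"] cong: if_cong)
    then show ?thesis
      unfolding lin_span_def
      by (auto intro!: exI[of _ "\<lambda>g. if g = x then 1 else 0"] simp: subring_setD[OF assms(1)])
  qed
  then show "\<exists>G\<subseteq>M. finite G \<and> M \<subseteq> lin_span A G" using fin by blast
qed

text \<open>For a subring \<open>A\<close> this is \<open>A[[x^q]]\<close> inside the power series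
  over the ambient coefficient ring.\<close>

definition fps_over :: "'a::comm_ring_1 set \<Rightarrow> nat \<Rightarrow> 'a fps set"
  where "fps_over A q = {f. \<forall>n. f $ n \<in> A \<and> (\<not> q dvd n \<longrightarrow> f $ n = 0)}"

lemma subring_set_fps_over:
  assumes "subring_set A"
  shows "subring_set (fps_over A q)"
proof -
  note A = subring_setD[OF assms]
  have "f * g \<in> fps_over A q" if f: "f \<in> fps_over A q" and g: "g \<in> fps_over A q" for f g
  proof -
    have "f $ i * g $ (n - i) = 0" if "\<not> q dvd n" "i \<le> n" for n i
    proof (rule ccontr)
      assume "\<not> ?thesis"
      then have "q dvd i" "q dvd (n - i)" using f g by (auto simp: fps_over_def)
      then show False using that by (metis dvd_add le_add_diff_inverse)
    qed
    moreover have "(f * g) $ n \<in> A" for n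
      unfolding fps_mult_nth using f g by (intro A) (auto simp: fps_over_def)
    ultimately show ?thesis by (auto simp: fps_over_def fps_mult_nth)
  qed
  then show ?thesis
    unfolding subring_set_def by (auto simp: fps_over_def A)
qed

lemma fps_over_simps:
  assumes "subring_set A"
  shows "a \<in> A \<Longrightarrow> fps_const a \<in> fps_over A q" "q dvd n \<Longrightarrow> fps_X ^ n \<in> fps_over A q"
  using subring_setD[OF assms] by (auto simp: fps_over_def fps_X_power_nth)

text \<open>The union of the chain is again a submodule, and its finitely many generators already
  lie in one member of the chain.\<close>

lemma eventually_stable:
  fixes L :: "nat \<Rightarrow> 'a::comm_ring_1 set"
  assumes "subring_set A" "noeth A N" "\<And>n. submod A (L n)" "\<And>n. L n \<subseteq> N" "\<And>n. L n \<subseteq> L (Suc n)"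
  shows "\<exists>m. \<forall>n\<ge>m. L n = L m"
proof -
  have mono: "L m \<subseteq> L n" if "m \<le> n" for m n
    using assms(5) lift_Suc_mono_le[OF _ that, of L] by blast
  let ?U = "\<Union>n. L n"
  have "submod A ?U"
    unfolding submod_def
  proof (intro conjI ballI)
    show "0 \<in> ?U" using submodD(1)[OF assms(3)] by blast
    fix x assume "x \<in> ?U"
    then obtain i where i: "x \<in> L i" by blast
    show "a * x \<in> ?U" if "a \<in> A" for a using submodD(3)[OF assms(3) that i] by blast
    fix y assume "y \<in> ?U"
    then obtain j where j: "y \<in> L j" by blast
    have "x \<in> L (max i j)" "y \<in> L (max i j)"
      using i j mono[of i "max i j"] mono[of j "max i j"] by auto
    then show "x + y \<in> ?U" using submodD(2)[OF assms(3)] by blast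
  qed
  moreover have "?U \<subseteq> N" using assms(4) by blast
  ultimately have "\<exists>G\<subseteq>?U. finite G \<and> ?U \<subseteq> lin_span A G"
    using assms(2)[unfolded noeth_def, rule_format, of ?U] by simp
  then obtain G where G: "G \<subseteq> ?U" "finite G" "?U \<subseteq> lin_span A G"
    by (elim exE conjE)
  obtain m where m: "G \<subseteq> L m"
  proof -
    from G(1) obtain k where k: "\<And>g. g \<in> G \<Longrightarrow> g \<in> L (k g)" by (metis UN_E subsetD)
    have "G \<subseteq> L (Max (insert 0 (k ` G)))"
    proof
      fix g assume g: "g \<in> G"
      then have "k g \<le> Max (insert 0 (k ` G))" using G(2) by (intro Max_ge) auto
      then show "g \<in> L (Max (insert 0 (k ` G)))" using k[OF g] mono by blast
    qed
    then show thesis by (rule that)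
  qed
  have "?U \<subseteq> L m"
  proof
    fix x assume "x \<in> ?U"
    then have "x \<in> lin_span A G" using G(3) by (rule rev_subsetD)
    then obtain c where c: "\<And>g. g \<in> G \<Longrightarrow> c g \<in> A" "x = (\<Sum>g\<in>G. c g * g)"
      unfolding lin_span_def by auto
    show "x \<in> L m" unfolding c(2)
      using m c(1) by (intro submodD(3,4)[OF assms(3)]) auto
  qed
  then show ?thesis using mono by (intro exI[of _ m]) blast
qed

text \<open>Hilbert's basis theorem for power series: the modules of leading coefficients of order
  \<open>n, n + q, n + 2 q, \<dots>\<close> stabilize, and an element is expanded in the lifts of their generators by
  removing its leading coefficients one after the other.\<close>

theorem noeth_fps_over:
  assumes A: "subring_set A" and N: "noeth A N" and q: "q > 0"
  shows "noeth (fps_over A q) {f. \<forall>n. f $ n \<in> N}"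
  unfolding noeth_def
proof (intro allI impI)
  fix M assume "submod (fps_over A q) M \<and> M \<subseteq> {f. \<forall>n. f $ n \<in> N}"
  then have M: "submod (fps_over A q) M" and MN: "\<And>f n. f \<in> M \<Longrightarrow> f $ n \<in> N" by auto
  note Mc = submodD[OF M]
  note A' = subring_set_fps_over[OF A, of q] and As = fps_over_simps[OF A, where q = q]
  define low where "low n = {f \<in> M. \<forall>i<n. f $ i = 0}" for n
  define L where "L n = (\<lambda>f. f $ n) ` low n" for n
  have submod_L: "submod A (L n)" for n
    unfolding submod_def
  proof (intro conjI ballI)
    have "0 \<in> low n" by (simp add: low_def Mc)
    then show "0 \<in> L n" by (force simp: L_def)
    fix x assume "x \<in> L n"
    then obtain f where f: "f \<in> low n" "x = f $ n" by (auto simp: L_def)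
    show "a * x \<in> L n" if "a \<in> A" for a
    proof -
      have "fps_const a * f \<in> low n" using f that by (auto simp: low_def intro: Mc As)
      then show ?thesis using f unfolding L_def by (intro image_eqI[of _ _ "fps_const a * f"]) auto
    qed
    fix y assume "y \<in> L n"
    then obtain g where g: "g \<in> low n" "y = g $ n" by (auto simp: L_def)
    have "f + g \<in> low n" using f g by (auto simp: low_def intro: Mc)
    then show "x + y \<in> L n" using f g unfolding L_def by (intro image_eqI[of _ _ "f + g"]) auto
  qed
  have LN: "L n \<subseteq> N" for n using MN by (auto simp: L_def low_def)
  have shift_low: "fps_X ^ k * f \<in> low (n + k)" if "f \<in> low n" "q dvd k" for f n k
    using that by (auto simp: low_def fps_X_power_mult_nth intro: Mc As)
  have L_step: "L n \<subseteq> L (n + q)" for n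
  proof
    fix x assume "x \<in> L n"
    then obtain f where f: "f \<in> low n" "x = f $ n" by (auto simp: L_def)
    show "x \<in> L (n + q)"
      using shift_low[OF f(1) dvd_refl] f unfolding L_def
      by (intro image_eqI[of _ _ "fps_X ^ q * f"]) (auto simp: fps_X_power_mult_nth)
  qed
  have "\<exists>m. \<forall>n\<ge>m. L (r + n * q) = L (r + m * q)" for r
    using L_step[of "r + _ * q"]
    by (intro eventually_stable[OF A N] submod_L LN) (simp add: algebra_simps)
  then obtain mm where mm: "\<And>r n. n \<ge> mm r \<Longrightarrow> L (r + n * q) = L (r + mm r * q)" by metis
  \<comment> \<open>The sum bounds all thresholds \<open>mm r\<close>, and the factor
    \<open>q\<close> preserves residues. Below \<open>b\<close> the generators are lifted at order
    \<open>n\<close> itself; from \<open>b\<close> on, at the representative of \<open>n\<close>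
    modulo \<open>q\<close> in \<open>{b..<b + q}\<close>, where the module of leading coefficients
    is the same.\<close>
  define b where "b = q * (\<Sum>r<q. mm r)"
  define base where "base n = (if n < b then n else b + n mod q)" for n
  have base_b: "base n < b + q" for n using q by (auto simp: base_def)
  have base: "base n \<le> n" "q dvd n - base n" "L n = L (base n)" for n
  proof -
    consider "n < b" | "n \<ge> b" by linarith
    then have "base n \<le> n \<and> q dvd n - base n \<and> L n = L (base n)"
    proof cases
      case 2
      have 1: "n = n mod q + (n div q) * q" by simp
      have 3: "(\<Sum>r<q. mm r) \<le> n div q" using 2 q by (simp add: b_def less_eq_div_iff_mult_less_eq mult.commute)
      have 4: "mm (n mod q) \<le> (\<Sum>r<q. mm r)" using q by (intro member_le_sum) auto
      have e: "base n = n mod q + (\<Sum>r<q. mm r) * q" using 2 by (simp add: base_def b_def mult.commute)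
      have "L n = L (base n)"
        using mm[of "n mod q" "n div q"] mm[of "n mod q" "\<Sum>r<q. mm r"] 3 4 unfolding e
        by (subst 1) simp
      moreover have "n - base n = (n div q - (\<Sum>r<q. mm r)) * q"
        unfolding e diff_mult_distrib using mod_div_mult_eq[of n q] by arith
      moreover have "base n \<le> n" unfolding e using mult_le_mono1[OF 3, of q] mod_div_mult_eq[of n q] by arith
      ultimately show ?thesis by simp
    qed (simp add: base_def)
    then show "base n \<le> n" "q dvd n - base n" "L n = L (base n)" by auto
  qed
  have "\<exists>G\<subseteq>L n. finite G \<and> L n \<subseteq> lin_span A G" for n
    using N submod_L LN unfolding noeth_def by blast
  then obtain G where G: "\<And>n. G n \<subseteq> L n" "\<And>n. finite (G n)" "\<And>n. L n \<subseteq> lin_span A (G n)" by metis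
  have "\<forall>n. \<forall>g\<in>G n. \<exists>f\<in>low n. f $ n = g" using G(1) by (fastforce simp: L_def)
  then obtain l where l: "\<And>n g. g \<in> G n \<Longrightarrow> l n g \<in> low n" "\<And>n g. g \<in> G n \<Longrightarrow> l n g $ n = g" by metis
  have "\<forall>n. \<forall>h\<in>low n. \<exists>c. (\<forall>g\<in>G (base n). c g \<in> A) \<and> h $ n = (\<Sum>g\<in>G (base n). c g * g)"
  proof (intro allI ballI)
    fix n h assume "h \<in> low n"
    then have "h $ n \<in> L (base n)" unfolding base(3)[of n, symmetric] by (auto simp: L_def)
    then show "\<exists>c. (\<forall>g\<in>G (base n). c g \<in> A) \<and> h $ n = (\<Sum>g\<in>G (base n). c g * g)"
      using G(3)[of "base n"] by (auto simp: lin_span_def)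
  qed
  then obtain s where s: "\<And>n h g. h \<in> low n \<Longrightarrow> g \<in> G (base n) \<Longrightarrow> s n h g \<in> A"
      "\<And>n h. h \<in> low n \<Longrightarrow> h $ n = (\<Sum>g\<in>G (base n). s n h g * g)"
    by metis
  define P where "P = Sigma {..<b + q} G"
  define ll where "ll = (\<lambda>(n, g). l n g)"
  have fin: "finite P" using G(2) by (auto simp: P_def)
  have "f \<in> lin_span (fps_over A q) (ll ` P)" if f: "f \<in> M" for f
  proof -
    \<comment> \<open>\<open>t n h g\<close> is the monomial that moves the lift of \<open>g\<close>
      to order \<open>n\<close> with the right coefficient. \<open>F n\<close> is what remains of
      \<open>f\<close> once all coefficients of order below \<open>n\<close> have been
      removed.\<close>
    define t where "t n h g = fps_const (s n h g) * fps_X ^ (n - base n)" for n h g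
    define F where "F = rec_nat f (\<lambda>n h. h - (\<Sum>g\<in>G (base n). t n h g * l (base n) g))"
    have F_Suc: "F (Suc n) = F n - (\<Sum>g\<in>G (base n). t n (F n) g * l (base n) g)" for n
      by (simp add: F_def)
    have t_A: "t n h g \<in> fps_over A q" if "h \<in> low n" "g \<in> G (base n)" for n h g
      unfolding t_def using that by (intro subring_setD(4)[OF A'] As s base)
    have tl: "(t n h g * l (base n) g) $ i = (if i = n then s n h g * g else 0)"
      if "h \<in> low n" "g \<in> G (base n)" "i \<le> n" for n h g i
      using that l[of g "base n"] base(1)[of n]
      by (auto simp: t_def mult.assoc fps_X_power_mult_nth low_def)
    have F_low: "F n \<in> low n" for n
    proof (induction n)
      case 0
      then show ?case using f by (simp add: F_def low_def)
    next
      case (Suc n)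
      have "F (Suc n) \<in> M"
        unfolding F_Suc using Suc l(1)[of _ "base n"] t_A
        by (intro submod_diff[OF A' M] Mc) (auto simp: low_def)
      moreover have "F (Suc n) $ i = 0" if "i < Suc n" for i
        using that Suc tl[OF Suc, of _ i] s(2)[OF Suc] unfolding F_Suc
        by (cases "i = n") (simp_all add: fps_sum_nth low_def)
      ultimately show ?case by (simp add: low_def)
    qed
    \<comment> \<open>The infinitely many monomials multiplying the lift with label
      \<open>(k, g)\<close> add up to a power series: step \<open>i\<close> contributes only in
      degree \<open>i - k\<close>, so degree \<open>j\<close> comes from step \<open>k + j\<close>
      alone. \<open>Ck n\<close> is the partial sum over the first \<open>n\<close> steps.\<close>
    define C where "C = (\<lambda>(k, g). Abs_fps (\<lambda>j. if base (k + j) = k then s (k + j) (F (k + j)) g else 0))"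
    define Ck where "Ck n = (\<lambda>(k, g). \<Sum>i<n. if base i = k then t i (F i) g else 0)" for n
    have C_A: "C p \<in> fps_over A q" if "p \<in> P" for p
    proof -
      obtain k g where p: "p = (k, g)" by fastforce
      have "q dvd j" if "base (k + j) = k" for j using base(2)[of "k + j"] that by simp
      then show ?thesis
        using that s(1)[OF F_low] by (auto simp: p C_def fps_over_def P_def subring_setD[OF A])
    qed
    have expand: "f = F n + (\<Sum>p\<in>P. Ck n p * ll p)" for n
    proof (induction n)
      case 0
      then show ?case by (simp add: F_def Ck_def case_prod_unfold)
    next
      case (Suc n)
      have "(\<Sum>p\<in>P. Ck (Suc n) p * ll p) = (\<Sum>p\<in>P. Ck n p * ll p)
          + (\<Sum>(k, g)\<in>P. if base n = k then t n (F n) g * l (base n) g else 0)"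
        by (simp add: Ck_def ll_def case_prod_unfold distrib_right sum.distrib if_distrib[of "\<lambda>c. c * _"]
            cong: if_cong)
      also have "(\<Sum>(k, g)\<in>P. if base n = k then t n (F n) g * l (base n) g else 0)
          = (\<Sum>k<b + q. \<Sum>g\<in>G k. if base n = k then t n (F n) g * l (base n) g else 0)"
        unfolding P_def using G(2) by (subst sum.Sigma) auto
      also have "\<dots> = (\<Sum>k<b + q. if base n = k then \<Sum>g\<in>G (base n). t n (F n) g * l (base n) g else 0)"
        by (intro sum.cong) auto
      also have "\<dots> = (\<Sum>g\<in>G (base n). t n (F n) g * l (base n) g)"
        using base_b by simp
      finally show ?case using Suc by (simp add: F_Suc)
    qed
    have C_Ck: "C (k, g) $ j = Ck n (k, g) $ j" if "k + j < n" for n k g j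
    proof -
      have "(if base i = k then t i (F i) g else 0) $ j
          = (if i = k + j then (if base (k + j) = k then s (k + j) (F (k + j)) g else 0) else 0)" for i
        using base(1)[of i] by (auto simp: t_def fps_X_power_nth)
      then show ?thesis using that by (simp add: C_def Ck_def fps_sum_nth)
    qed
    have "f $ i = (\<Sum>p\<in>P. C p * ll p) $ i" for i
    proof -
      \<comment> \<open>The lift has order at least \<open>k\<close>, so only degrees
        \<open>j\<close> with \<open>k + j \<le> i\<close> of its coefficient matter, and there
        \<open>C\<close> agrees with the partial sum.\<close>
      have "(C p * ll p) $ i = (Ck (Suc i) p * ll p) $ i" if "p \<in> P" for p
      proof -
        obtain k g where p: "p = (k, g)" and g: "g \<in> G k" using \<open>p \<in> P\<close> by (auto simp: P_def)
        have "C (k, g) $ j * l k g $ (i - j) = Ck (Suc i) (k, g) $ j * l k g $ (i - j)" if "j \<le> i" for j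
        proof (cases "k + j < Suc i")
          case False
          then have "l k g $ (i - j) = 0" using l(1)[OF g] that by (auto simp: low_def)
          then show ?thesis by simp
        qed (simp add: C_Ck)
        then show ?thesis by (simp add: fps_mult_nth p ll_def)
      qed
      then have "(\<Sum>p\<in>P. C p * ll p) $ i = (\<Sum>p\<in>P. Ck (Suc i) p * ll p) $ i"
        by (simp add: fps_sum_nth)
      moreover have "F (Suc i) $ i = 0" using F_low[of "Suc i"] by (simp add: low_def)
      ultimately show ?thesis using expand[of "Suc i"] by (metis add.left_neutral fps_add_nth)
    qed
    then have "f = (\<Sum>p\<in>P. C p * ll p)" by (simp add: fps_eq_iff)
    then show ?thesis using lin_span_image[OF A' fin, of C ll] C_A by simp
  qed
  moreover have "ll ` P \<subseteq> M" using l(1) by (auto simp: P_def ll_def low_def)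
  ultimately show "\<exists>G\<subseteq>M. finite G \<and> M \<subseteq> lin_span (fps_over A q) G"
    using fin by blast
qed

text \<open>\<open>F\<^sub>2[[a\<^sup>q, b\<^sup>q, c\<^sup>q]]\<close>\<close>

definition F2_series :: "nat \<Rightarrow> pow set"
  where "F2_series q = fps_over (fps_over (fps_over {0, 1} q) q) q"

lemma subring_set_01: "subring_set {0, 1 :: gf4}"
  by (simp add: subring_set_def)

text \<open>The basis theorem is applied once per variable, starting from the finite set of
  coefficients. The value used below is \<open>q = 4\<close>: series in fourth powers of the
  variables are squares of elements of \<open>R0\<close>, so one finiteness statement gives both the
  Noetherian property and \<open>F\<close>-finiteness.\<close>

lemma noeth_F2_series: "q > 0 \<Longrightarrow> noeth (F2_series q) UNIV"
proof -
  assume q: "q > 0"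
  have "noeth {0, 1 :: gf4} UNIV"
    by (intro noeth_finite subring_set_01) (simp add: UNIV_gf4)
  from noeth_fps_over[OF subring_set_01 this q] have "noeth (fps_over {0, 1 :: gf4} q) UNIV" by simp
  from noeth_fps_over[OF subring_set_fps_over[OF subring_set_01] this q]
  have "noeth (fps_over (fps_over {0, 1 :: gf4} q) q) UNIV" by simp
  from noeth_fps_over[OF subring_set_fps_over[OF subring_set_fps_over[OF subring_set_01]] this q]
  show ?thesis by (simp add: F2_series_def)
qed

lemma F2_series_nth: "f \<in> F2_series q \<longleftrightarrow> (\<forall>i j k. f $ i $ j $ k \<in> {0, 1} \<and>
    (\<not> (q dvd i \<and> q dvd j \<and> q dvd k) \<longrightarrow> f $ i $ j $ k = 0))"
  unfolding F2_series_def fps_over_def by (auto simp: fps_eq_iff)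

lemma F2_series_subset_R0: "F2_series 2 \<subseteq> R0"
proof
  fix f assume f: "f \<in> F2_series 2"
  have "vfield f = 0"
    unfolding vfield_def using f by (intro ext_deriv_eq_0) (auto simp: F2_series_nth fps_eq_iff)
  moreover have "conjugate (curve f) = curve f"
  proof -
    have "f $ i $ 0 $ 0 = 0 \<or> f $ i $ 0 $ 0 = 1" for i using f by (auto simp: F2_series_nth)
    then show ?thesis by (auto simp: conjugate_def curve_def fps_eq_iff power2_eq_square)
  qed
  ultimately show "f \<in> R0" by (simp add: R0_def)
qed


section \<open>Cech cohomology of the power series ring\<close>

text \<open>For \<open>x \<noteq> 0\<close> this is membership in the localization at
  \<open>x\<close>, inside the fraction field.\<close>

definition loc_at :: "'a::idom \<Rightarrow> 'a fract \<Rightarrow> bool"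
  where "loc_at x u \<longleftrightarrow> (\<exists>n. to_fract (x ^ n) * u \<in> range to_fract)"

lemma to_fract_power: "to_fract (x ^ n) = to_fract x ^ n"
  by (induction n) simp_all

lemma range_to_fract_closed:
  "u \<in> range to_fract \<Longrightarrow> v \<in> range to_fract \<Longrightarrow> u + v \<in> range to_fract"
  "u \<in> range to_fract \<Longrightarrow> to_fract x * u \<in> range to_fract"
  by (auto simp flip: to_fract_add to_fract_mult)

lemma range_to_fract_sum:
  "(\<And>i. i \<in> A \<Longrightarrow> f i \<in> range to_fract) \<Longrightarrow> sum f A \<in> range to_fract"
  by (induction A rule: infinite_finite_induct) (auto intro: range_to_fract_closed simp flip: to_fract_0)

lemma loc_at_mono:
  assumes "to_fract (x ^ n) * u \<in> range to_fract" "n \<le> n'"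
  shows "to_fract (x ^ n') * u \<in> range to_fract"
proof -
  have "x ^ n' = x ^ (n' - n) * x ^ n" using assms(2) by (simp flip: power_add)
  then show ?thesis using range_to_fract_closed(2)[OF assms(1)] by (simp add: mult.assoc)
qed

lemma loc_at_dvd:
  assumes "loc_at x u" "x dvd y ^ n"
  shows "loc_at y u"
proof -
  obtain N where N: "to_fract (x ^ N) * u \<in> range to_fract" using assms by (auto simp: loc_at_def)
  obtain w where w: "y ^ n = x * w" using assms by (elim dvdE)
  have "y ^ (n * N) = w ^ N * x ^ N" by (simp add: power_mult w power_mult_distrib)
  then show ?thesis using range_to_fract_closed(2)[OF N, of "w ^ N"]
    unfolding loc_at_def by (metis mult.assoc to_fract_mult)
qed

lemma loc_at_times: "loc_at x u \<Longrightarrow> loc_at (x * y) u" "loc_at x u \<Longrightarrow> loc_at (y * x) u"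
  using loc_at_dvd[of x u "x * y" 1] loc_at_dvd[of x u "y * x" 1] by auto

lemma loc_at_add:
  assumes "loc_at x u" "loc_at x v"
  shows "loc_at x (u + v)"
proof -
  obtain n m where "to_fract (x ^ n) * u \<in> range to_fract" "to_fract (x ^ m) * v \<in> range to_fract"
    using assms by (auto simp: loc_at_def)
  then have "to_fract (x ^ (n + m)) * u + to_fract (x ^ (n + m)) * v \<in> range to_fract"
    by (intro range_to_fract_closed(1); elim loc_at_mono; simp)
  then show ?thesis unfolding loc_at_def by (metis distrib_left)
qed

lemma loc_at_mult: "loc_at x u \<Longrightarrow> loc_at x (to_fract y * u)"
  using range_to_fract_closed(2)[of _ y] unfolding loc_at_def by (metis mult.left_commute)

lemma loc_at_to_fract: "loc_at x (to_fract y)"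
  unfolding loc_at_def by (auto intro!: exI[of _ 0])

lemma loc_at_power: "loc_at x u \<Longrightarrow> loc_at x (u ^ n)"
proof (induction n)
  case 0
  show ?case using loc_at_to_fract[of x 1] by simp
next
  case (Suc n)
  then obtain k l where "to_fract (x ^ k) * u \<in> range to_fract" "to_fract (x ^ l) * u ^ n \<in> range to_fract"
    by (auto simp: loc_at_def)
  then obtain f g where fg: "to_fract (x ^ k) * u = to_fract f" "to_fract (x ^ l) * u ^ n = to_fract g"
    by auto
  have "to_fract (x ^ (k + l)) * u ^ Suc n = (to_fract (x ^ k) * u) * (to_fract (x ^ l) * u ^ n)"
    by (simp add: power_add algebra_simps)
  then have "to_fract (x ^ (k + l)) * u ^ Suc n = to_fract (f * g)" by (simp only: fg to_fract_mult)
  then show ?case unfolding loc_at_def by blast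
qed

text \<open>The common exponent is a power of two because raising to it is additive in
  characteristic two.\<close>

lemma uniform_exponent:
  assumes "finite A" "\<And>i. i \<in> A \<Longrightarrow> loc_at (x i) (u i)"
  shows "\<exists>m. \<forall>i\<in>A. to_fract (x i ^ (2 ^ m)) * u i \<in> range to_fract"
proof -
  obtain n where n: "\<And>i. i \<in> A \<Longrightarrow> to_fract (x i ^ n i) * u i \<in> range to_fract"
    using assms(2) unfolding loc_at_def by metis
  have "n i \<le> 2 ^ sum n A" if "i \<in> A" for i
    using order.trans[OF member_le_sum[of i A n] less_imp_le[OF less_exp]] that assms(1) by simp
  then show ?thesis using loc_at_mono n by blast
qed

definition spans :: "'i set \<Rightarrow> ('i \<Rightarrow> 'a::comm_ring_1) \<Rightarrow> 'a \<Rightarrow> bool"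
  where "spans J X r \<longleftrightarrow> (\<exists>h. r = (\<Sum>j\<in>J. h j * X j))"

text \<open>For \<open>q\<close> a power of two, \<open>r^q\<close> is a combination of the
  \<open>X j ^ q\<close>, so a power of \<open>y * r\<close> clears the denominator as soon as the
  same power of every \<open>y * X j\<close> does.\<close>

lemma spans_loc_at:
  fixes r :: "'a::{idom, char_two}"
  assumes "finite J" "spans J X r" "\<And>j. j \<in> J \<Longrightarrow> loc_at (y * X j) s"
  shows "loc_at (y * r) s"
proof -
  obtain h where h: "r = (\<Sum>j\<in>J. h j * X j)" using assms(2) by (auto simp: spans_def)
  obtain m where m: "\<And>j. j \<in> J \<Longrightarrow> to_fract ((y * X j) ^ (2 ^ m)) * s \<in> range to_fract"
    using uniform_exponent[OF assms(1), of "\<lambda>j. y * X j" "\<lambda>_. s"] assms(3) by blast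
  have "(y * r) ^ (2 ^ m) = (\<Sum>j\<in>J. h j ^ (2 ^ m) * (y * X j) ^ (2 ^ m))"
    unfolding h power_mult_distrib power_sum_char_two sum_distrib_left by (simp add: algebra_simps)
  then have "to_fract ((y * r) ^ (2 ^ m)) * s
      = (\<Sum>j\<in>J. to_fract (h j ^ (2 ^ m)) * (to_fract ((y * X j) ^ (2 ^ m)) * s))"
    by (simp only: to_fract_sum to_fract_mult sum_distrib_right mult.assoc)
  also have "\<dots> \<in> range to_fract" by (intro range_to_fract_sum range_to_fract_closed m)
  finally show ?thesis unfolding loc_at_def by blast
qed

text \<open>Compare coefficients of \<open>a^i\<close> for \<open>i < m\<close>: there
  \<open>vb ^ n\<close> multiplies by a power of the inner variable, a nonzerodivisor.\<close>

lemma va_vb_regular: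
  assumes "va ^ m * f = vb ^ n * g"
  shows "\<exists>h. g = va ^ m * h"
proof
  have "fps_X ^ n * g $ i = 0" if "i < m" for i
    using arg_cong[OF assms, of "\<lambda>f. f $ i"] that
    by (simp add: va_def vb_def fps_X_power_mult_nth)
  then have "g $ i = 0" if "i < m" for i using that by fastforce
  then show "g = va ^ m * fps_shift m g"
    by (auto simp: fps_eq_iff va_def fps_X_power_mult_nth)
qed

text \<open>The right-hand side has no terms \<open>a^i b^j\<close> with \<open>i, j < m\<close>,
  and \<open>c^m\<close> is a nonzerodivisor on coefficients, so \<open>f\<close> has none either.
  Its terms are then sorted by whether \<open>i \<ge> m\<close>.\<close>

lemma vc_regular:
  assumes "vc ^ m * f = va ^ m * g + vb ^ m * h"
  shows "\<exists>p q. f = va ^ m * p + vb ^ m * q"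
proof (intro exI)
  have z: "f $ i $ j = 0" if "i < m" "j < m" for i j
  proof -
    have "fps_X ^ m * f $ i $ j = 0"
      using arg_cong[OF assms, of "\<lambda>f. f $ i $ j"] that
      by (simp add: va_def vb_def vc_def fps_X_power_mult_nth)
    then show ?thesis by simp
  qed
  show "f = va ^ m * fps_shift m f + vb ^ m * Abs_fps (\<lambda>i. if i < m then fps_shift m (f $ i) else 0)"
  proof (rule fps_ext)
    fix i
    show "f $ i = (va ^ m * fps_shift m f + vb ^ m * Abs_fps (\<lambda>i. if i < m then fps_shift m (f $ i) else 0)) $ i"
      by (auto simp: va_def vb_def fps_X_power_mult_nth z fps_eq_iff)
  qed
qed

lemma to_fract_vars: "to_fract va \<noteq> 0" "to_fract vb \<noteq> 0" "to_fract vc \<noteq> 0"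
  "va \<noteq> 0" "vb \<noteq> 0" "vc \<noteq> 0"
  by (auto simp: va_def vb_def vc_def to_fract_eq_0_iff)

text \<open>Extension across \<open>a = b = 0\<close>, the depth two property:
  \<open>x^N u = f / a^N = g / b^N\<close> forces \<open>a^N\<close> to divide
  \<open>f\<close>.\<close>

lemma loc_at_va_vb:
  assumes "loc_at (va * x) u" "loc_at (vb * x) u"
  shows "loc_at x u"
proof -
  obtain n k where "to_fract ((va * x) ^ n) * u \<in> range to_fract" "to_fract ((vb * x) ^ k) * u \<in> range to_fract"
    using assms by (auto simp: loc_at_def)
  then have "to_fract ((va * x) ^ (n + k)) * u \<in> range to_fract" "to_fract ((vb * x) ^ (n + k)) * u \<in> range to_fract"
    by (elim loc_at_mono; simp)+
  then obtain f g where f: "to_fract ((va * x) ^ (n + k)) * u = to_fract f"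
    and g: "to_fract ((vb * x) ^ (n + k)) * u = to_fract g" by (auto simp del: to_fract_mult)
  define N where "N = n + k"
  have "to_fract (vb ^ N * f) = to_fract (va ^ N * g)"
    unfolding to_fract_mult f[symmetric] g[symmetric] by (simp add: N_def power_mult_distrib)
  then obtain h where "f = va ^ N * h" using va_vb_regular[of N g N f] by (auto simp del: to_fract_mult)
  then have "to_fract va ^ N * (to_fract (x ^ N) * u) = to_fract va ^ N * to_fract h"
    using f by (simp add: power_mult_distrib to_fract_power N_def mult.assoc)
  then have "to_fract (x ^ N) * u = to_fract h" by (simp add: to_fract_vars)
  then show ?thesis unfolding loc_at_def by blast
qed

text \<open>A fraction defined wherever some \<open>X j\<close> is nonzero is defined for
  \<open>a \<noteq> 0\<close> and for \<open>b \<noteq> 0\<close>, hence everywhere by the extension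
  property.\<close>

lemma range_to_fractI:
  assumes "finite J" "spans J X (va\<^sup>2)" "spans J X (vb\<^sup>2)" "\<And>j. j \<in> J \<Longrightarrow> loc_at (X j) s"
  shows "s \<in> range to_fract"
proof -
  have "loc_at (1 * va\<^sup>2) s" "loc_at (1 * vb\<^sup>2) s"
    using assms(4) by (intro spans_loc_at[OF assms(1,2)] spans_loc_at[OF assms(1,3)]; simp)+
  then have "loc_at (va * 1) s" "loc_at (vb * 1) s"
    by (auto intro: loc_at_dvd[of "va\<^sup>2" s va 2] loc_at_dvd[of "vb\<^sup>2" s vb 2])
  then have "loc_at 1 s" by (rule loc_at_va_vb)
  then show ?thesis by (auto simp: loc_at_def)
qed

text \<open>The explicit contraction of the Cech complex on the affine set \<open>r \<noteq> 0\<close>. The theorem below glues the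
  solutions for \<open>r = a\<^sup>2, b\<^sup>2, c\<^sup>2\<close>; the difference \<open>ab\<close> of the first two splits into fractions with
  denominators \<open>a\<^sup>n\<close> and \<open>b\<^sup>n\<close> because \<open>c\<close> is regular modulo \<open>(a\<^sup>n, b\<^sup>n)\<close>.\<close>

lemma cech_exact_affine:
  fixes X :: "'i \<Rightarrow> 'a::{idom, char_two}"
  assumes fin: "finite J" and r: "spans J X r" "r \<noteq> 0"
    and z: "\<And>j k. j \<in> J \<Longrightarrow> k \<in> J \<Longrightarrow> loc_at (X j * X k) (z j k)"
    and cocycle: "\<And>j k l. j \<in> J \<Longrightarrow> k \<in> J \<Longrightarrow> l \<in> J \<Longrightarrow> z j k + z l k = z j l"
  shows "\<exists>u. (\<forall>j\<in>J. loc_at (r * X j) (u j)) \<and> (\<forall>j\<in>J. \<forall>k\<in>J. z j k = u j + u k)"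
proof -
  obtain h where h: "r = (\<Sum>j\<in>J. h j * X j)" using r by (auto simp: spans_def)
  obtain m where "\<forall>p\<in>J \<times> J. to_fract ((X (fst p) * X (snd p)) ^ (2 ^ m)) * z (fst p) (snd p) \<in> range to_fract"
    using uniform_exponent[of "J \<times> J" "\<lambda>p. X (fst p) * X (snd p)" "\<lambda>p. z (fst p) (snd p)"] z fin by auto
  then have m: "to_fract ((X j * X k) ^ (2 ^ m)) * z j k \<in> range to_fract" if "j \<in> J" "k \<in> J" for j k
    using that by force
  define q :: nat where "q = 2 ^ m"
  have rq: "r ^ q = (\<Sum>j\<in>J. h j ^ q * X j ^ q)"
    unfolding h q_def power_sum_char_two power_mult_distrib ..
  \<comment> \<open>Contraction with the partition of unity
    \<open>1 = \<Sum>k. h_k^q X_k^q / r^q\<close>; the factor \<open>X_k^q\<close> absorbs the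
    denominator of \<open>z j k\<close> at \<open>X k\<close>.\<close>
  define u where "u j = (\<Sum>k\<in>J. to_fract (h k ^ q * X k ^ q) * z j k) / to_fract (r ^ q)" for j
  have r0: "to_fract (r ^ q) \<noteq> 0" using r by (simp add: to_fract_eq_0_iff)
  have "loc_at (r * X j) (u j)" if j: "j \<in> J" for j
  proof -
    have "to_fract ((r * X j) ^ q) * u j = to_fract (X j ^ q) * (to_fract (r ^ q) * u j)"
      by (simp add: power_mult_distrib)
    also have "to_fract (r ^ q) * u j = (\<Sum>k\<in>J. to_fract (h k ^ q * X k ^ q) * z j k)"
      using r0 by (simp add: u_def)
    also have "to_fract (X j ^ q) * \<dots> = (\<Sum>k\<in>J. to_fract (h k ^ q) * (to_fract ((X j * X k) ^ q) * z j k))"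
      by (simp add: sum_distrib_left power_mult_distrib algebra_simps)
    also have "\<dots> \<in> range to_fract"
      unfolding q_def by (intro range_to_fract_sum range_to_fract_closed m j)
    finally show ?thesis unfolding loc_at_def by blast
  qed
  moreover have "z j l = u j + u l" if "j \<in> J" "l \<in> J" for j l
  proof -
    have "u j + u l = (\<Sum>k\<in>J. to_fract (h k ^ q * X k ^ q) * (z j k + z l k)) / to_fract (r ^ q)"
      by (simp add: u_def add_divide_distrib sum.distrib distrib_left)
    also have "(\<Sum>k\<in>J. to_fract (h k ^ q * X k ^ q) * (z j k + z l k)) = to_fract (r ^ q) * z j l"
      using that cocycle by (simp add: rq to_fract_sum sum_distrib_right)
    finally show ?thesis using r(2) by simp
  qed
  ultimately show ?thesis by blast
qed

theorem cech_exact: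
  fixes X :: "'i \<Rightarrow> pow"
  assumes fin: "finite J" and sp: "spans J X (va\<^sup>2)" "spans J X (vb\<^sup>2)" "spans J X (vc\<^sup>2)"
    and z: "\<And>j k. j \<in> J \<Longrightarrow> k \<in> J \<Longrightarrow> loc_at (X j * X k) (z j k)"
    and cocycle: "\<And>j k l. j \<in> J \<Longrightarrow> k \<in> J \<Longrightarrow> l \<in> J \<Longrightarrow> z j k + z l k = z j l"
  shows "\<exists>u. (\<forall>j\<in>J. loc_at (X j) (u j)) \<and> (\<forall>j\<in>J. \<forall>k\<in>J. z j k = u j + u k)"
proof (cases "J = {}")
  case False
  then obtain i where i: "i \<in> J" by blast
  have aff: "\<exists>u. (\<forall>j\<in>J. loc_at (x * X j) (u j)) \<and> (\<forall>j\<in>J. \<forall>k\<in>J. z j k = u j + u k)"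
    if x: "spans J X (x\<^sup>2)" "x \<noteq> 0" for x
  proof -
    obtain u where u: "\<forall>j\<in>J. loc_at (x\<^sup>2 * X j) (u j)" "\<forall>j\<in>J. \<forall>k\<in>J. z j k = u j + u k"
      using cech_exact_affine[of J X "x\<^sup>2" z] x fin z cocycle by auto
    have "loc_at (x * X j) (u j)" if "j \<in> J" for j
      using u(1) that by (auto intro: loc_at_dvd[where n = 2] simp: power2_eq_square)
    then show ?thesis using u(2) by blast
  qed
  obtain ua where ua: "\<And>j. j \<in> J \<Longrightarrow> loc_at (va * X j) (ua j)"
      "\<And>j k. j \<in> J \<Longrightarrow> k \<in> J \<Longrightarrow> z j k = ua j + ua k"
    using aff[OF sp(1) to_fract_vars(4)] by blast
  obtain ub where ub: "\<And>j. j \<in> J \<Longrightarrow> loc_at (vb * X j) (ub j)"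
      "\<And>j k. j \<in> J \<Longrightarrow> k \<in> J \<Longrightarrow> z j k = ub j + ub k"
    using aff[OF sp(2) to_fract_vars(5)] by blast
  obtain uc where uc: "\<And>j. j \<in> J \<Longrightarrow> loc_at (vc * X j) (uc j)"
      "\<And>j k. j \<in> J \<Longrightarrow> k \<in> J \<Longrightarrow> z j k = uc j + uc k"
    using aff[OF sp(3) to_fract_vars(6)] by blast
  \<comment> \<open>Two solutions for the same cocycle differ by a fraction independent of the
    index. It is defined on \<open>x y X_j \<noteq> 0\<close> for all \<open>j\<close>, hence on
    \<open>x y \<noteq> 0\<close>, because \<open>x^2\<close> is in the ideal of the
    \<open>X j\<close>.\<close>
  have transition: "loc_at (x * y) (f i + g i)"
    if x: "spans J X (x\<^sup>2)"
      and f: "\<And>j. j \<in> J \<Longrightarrow> loc_at (x * X j) (f j)" "\<And>j k. j \<in> J \<Longrightarrow> k \<in> J \<Longrightarrow> z j k = f j + f k"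
      and g: "\<And>j. j \<in> J \<Longrightarrow> loc_at (y * X j) (g j)" "\<And>j k. j \<in> J \<Longrightarrow> k \<in> J \<Longrightarrow> z j k = g j + g k"
    for x y and f g :: "'i \<Rightarrow> pow fract"
  proof -
    have "loc_at (x * y * X j) (f i + g i)" if "j \<in> J" for j
    proof -
      have "f i + g i = f j + g j"
        using f(2)[OF i that] g(2)[OF i that] add_swap_char_two by metis
      moreover have "loc_at (x * y * X j) (f j)"
        using loc_at_times(2)[OF f(1)[OF that], of y] by (simp add: algebra_simps)
      moreover have "loc_at (x * y * X j) (g j)"
        using loc_at_times(2)[OF g(1)[OF that], of x] by (simp add: algebra_simps)
      ultimately show ?thesis by (simp add: loc_at_add)
    qed
    then have "loc_at (x * y * x\<^sup>2) (f i + g i)" by (rule spans_loc_at[OF fin x])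
    then show ?thesis
      by (rule loc_at_dvd[where n = 3]) (simp add: power2_eq_square power3_eq_cube)
  qed
  define ab ac bc where "ab = ua i + ub i" and "ac = ua i + uc i" and "bc = ub i + uc i"
  have "loc_at (va * vb) ab" "loc_at (va * vc) ac" "loc_at (vb * vc) bc"
    unfolding ab_def ac_def bc_def using sp ua ub uc by (auto intro!: transition)
  then obtain n1 n2 n3 where "to_fract ((va * vb) ^ n1) * ab \<in> range to_fract"
      "to_fract ((va * vc) ^ n2) * ac \<in> range to_fract" "to_fract ((vb * vc) ^ n3) * bc \<in> range to_fract"
    unfolding loc_at_def by blast
  then have "to_fract ((va * vb) ^ (n1 + n2 + n3)) * ab \<in> range to_fract"
      "to_fract ((va * vc) ^ (n1 + n2 + n3)) * ac \<in> range to_fract"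
      "to_fract ((vb * vc) ^ (n1 + n2 + n3)) * bc \<in> range to_fract"
    by (elim loc_at_mono; simp)+
  moreover define n where "n = n1 + n2 + n3"
  ultimately obtain f g h where n: "to_fract ((va * vb) ^ n) * ab = to_fract f"
      "to_fract ((va * vc) ^ n) * ac = to_fract g" "to_fract ((vb * vc) ^ n) * bc = to_fract h"
    by (auto simp del: to_fract_mult)
  have abc: "ab = ac + bc" unfolding ab_def ac_def bc_def by (simp add: add.left_commute add.assoc)
  have "to_fract (vc ^ n * f) = to_fract (va ^ n * h + vb ^ n * g)"
    unfolding to_fract_mult to_fract_add n[symmetric] abc by (simp add: power_mult_distrib algebra_simps)
  then have "vc ^ n * f = va ^ n * h + vb ^ n * g" by (simp only: to_fract_eq_iff)
  then obtain p q where pq: "f = va ^ n * p + vb ^ n * q" using vc_regular by blast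
  \<comment> \<open>Dividing \<open>f\<close> by \<open>(a b)^n\<close> gives
    \<open>ab = q / a^n + p / b^n\<close>, so the corrected solutions \<open>ua + sa\<close> and
    \<open>ub + sb\<close> coincide.\<close>
  define sa sb where "sa = to_fract q / to_fract (va ^ n)" and "sb = to_fract p / to_fract (vb ^ n)"
  have nz: "to_fract (va ^ n) \<noteq> 0" "to_fract (vb ^ n) \<noteq> 0" using to_fract_vars by (simp_all add: to_fract_power)
  have "to_fract (va ^ n) * to_fract (vb ^ n) * ab = to_fract (va ^ n) * to_fract (vb ^ n) * (sa + sb)"
    using n(1) to_fract_vars by (simp add: pq sa_def sb_def power_mult_distrib algebra_simps)
  then have ab_sum: "ab = sa + sb" using to_fract_vars by simp
  have "to_fract (va ^ n) * sa = to_fract q" "to_fract (vb ^ n) * sb = to_fract p"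
    using to_fract_vars by (simp_all add: sa_def sb_def)
  then have "to_fract (va ^ n) * sa \<in> range to_fract" "to_fract (vb ^ n) * sb \<in> range to_fract"
    by (simp_all only: rangeI)
  then have sa: "loc_at va sa" and sb: "loc_at vb sb"
    unfolding loc_at_def by - (rule exI, assumption)+
  have eq: "ua j + sa = ub j + sb" if "j \<in> J" for j
  proof -
    have "ua i + ua j = ub i + ub j" using ua(2)[OF i that] ub(2)[OF i that] by simp
    then have "ua i + ub i = ua j + ub j" by (rule add_swap_char_two[THEN iffD1])
    then have "ua j + ub j = sa + sb" using ab_sum by (simp only: ab_def)
    then show ?thesis by (rule add_swap_char_two[THEN iffD1])
  qed
  \<comment> \<open>The common corrected solution has a denominator in \<open>a X_j\<close> and one
    in \<open>b X_j\<close>; by depth two one in \<open>X_j\<close> is enough.\<close>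
  have "loc_at (X j) (ua j + sa)" if j: "j \<in> J" for j
  proof (rule loc_at_va_vb)
    show "loc_at (va * X j) (ua j + sa)" by (intro loc_at_add ua(1)[OF j] loc_at_times(1)[OF sa])
    show "loc_at (vb * X j) (ua j + sa)"
      unfolding eq[OF j] by (intro loc_at_add ub(1)[OF j] loc_at_times(1)[OF sb])
  qed
  moreover have "z j k = (ua j + sa) + (ua k + sa)" if "j \<in> J" "k \<in> J" for j k
    using ua(2)[OF that] by (simp add: add.left_commute add.assoc)
  ultimately show ?thesis by (intro exI[of _ "\<lambda>j. ua j + sa"]) simp
qed simp


section \<open>The invariant of a two-cocycle\<close>

text \<open>Every fraction has a denominator killed by \<^const>\<open>vfield\<close>, for instance a square.\<close>

definition vfield_fract :: "pow fract \<Rightarrow> pow fract"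
  where "vfield_fract x = (THE y. \<exists>g s. s \<noteq> 0 \<and> vfield s = 0 \<and> x = Fract g s \<and> y = Fract (vfield g) s)"

lemma vfield_fract_Fract:
  assumes "s \<noteq> 0" "vfield s = 0"
  shows "vfield_fract (Fract g s) = Fract (vfield g) s"
  unfolding vfield_fract_def
proof (rule the_equality)
  show "\<exists>h t. t \<noteq> 0 \<and> vfield t = 0 \<and> Fract g s = Fract h t \<and> Fract (vfield g) s = Fract (vfield h) t"
    using assms by blast
  fix y assume "\<exists>h t. t \<noteq> 0 \<and> vfield t = 0 \<and> Fract g s = Fract h t \<and> y = Fract (vfield h) t"
  then obtain h t where t: "t \<noteq> 0" "vfield t = 0" "g * t = h * s" "y = Fract (vfield h) t"
    using assms by (auto simp: eq_fract)
  have "vfield g * t = vfield h * s"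
    using arg_cong[OF t(3), of vfield] assms(2) t(2) by (simp add: vfield_simps)
  then show "y = Fract (vfield g) s" using assms t by (simp add: eq_fract)
qed

lemma Fract_constant_denominators:
  obtains g s where "x = Fract g s" "s \<noteq> 0" "vfield s = 0"
proof -
  obtain g s where x: "x = Fract g s" "s \<noteq> 0" by (cases x rule: Fract_cases) auto
  have "x = Fract (g * s) (s\<^sup>2)" using x by (simp add: eq_fract power2_eq_square)
  then show thesis using x derivation_square[OF derivation_vfield] by (intro that[of "g * s" "s\<^sup>2"]) auto
qed

lemma vfield_fract_add: "vfield_fract (x + y) = vfield_fract x + vfield_fract y"
proof -
  obtain g s where x: "x = Fract g s" "s \<noteq> 0" "vfield s = 0" by (rule Fract_constant_denominators)
  obtain h t where y: "y = Fract h t" "t \<noteq> 0" "vfield t = 0" by (rule Fract_constant_denominators)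
  show ?thesis using x y by (simp add: vfield_fract_Fract vfield_simps)
qed

lemma vfield_fract_mult_constant: "vfield r = 0 \<Longrightarrow> vfield_fract (to_fract r * x) = to_fract r * vfield_fract x"
proof -
  assume "vfield r = 0"
  moreover obtain g s where x: "x = Fract g s" "s \<noteq> 0" "vfield s = 0" by (rule Fract_constant_denominators)
  ultimately show ?thesis by (simp add: vfield_fract_Fract vfield_simps to_fract_def)
qed

lemma vfield_fract_to_fract: "vfield_fract (to_fract g) = to_fract (vfield g)"
  by (simp add: to_fract_def vfield_fract_Fract vfield_simps)

text \<open>Membership in the localization of \<^const>\<open>R0\<close> at \<open>x\<close>, provided that \<open>x\<close> is not zero.\<close>

definition rloc :: "pow \<Rightarrow> pow fract \<Rightarrow> bool"
  where "rloc x y \<longleftrightarrow> (\<exists>n. \<exists>r\<in>R0. to_fract (x ^ n) * y = to_fract r)"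

lemma rloc_loc_at: "rloc x y \<Longrightarrow> loc_at x y"
  by (auto simp: rloc_def loc_at_def)

lemma rloc_vfield_fract:
  assumes "rloc x y" "x \<in> R0" "x \<noteq> 0"
  shows "vfield_fract y = 0"
proof -
  obtain n r where r: "r \<in> R0" "to_fract (x ^ n) * y = to_fract r" using assms by (auto simp: rloc_def)
  have "vfield (x ^ n) = 0" using R0_closed(5)[OF assms(2)] by (simp add: R0_def)
  then have "to_fract (x ^ n) * vfield_fract y = 0"
    using arg_cong[OF r(2), of vfield_fract] r(1) by (simp add: vfield_fract_mult_constant vfield_fract_to_fract R0_def del: to_fract_mult)
  then show ?thesis using assms(3) by simp
qed

lemma loc_at_vfield_fract:
  assumes "loc_at x u" "x \<in> R0"
  shows "loc_at x (vfield_fract u)"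
proof -
  obtain n g where g: "to_fract (x ^ n) * u = to_fract g" using assms by (auto simp: loc_at_def)
  have "vfield (x ^ n) = 0" using R0_closed(5)[OF assms(2)] by (simp add: R0_def)
  then have "to_fract (x ^ n) * vfield_fract u = to_fract (vfield g)"
    using arg_cong[OF g, of vfield_fract] by (simp add: vfield_fract_mult_constant vfield_fract_to_fract)
  then show ?thesis unfolding loc_at_def by blast
qed

text \<open>The trace of \<open>F_4\<close> over \<open>F_2\<close>, applied to coefficients. It is
  linear over \<open>F_2[[a]]\<close> and zero on it, so it erases what comes from
  \<open>R0\<close>.\<close>

definition trace :: "gf4 fps \<Rightarrow> gf4 fps" where "trace f = f + conjugate f"

lemma trace_simps:
  "trace (f + g) = trace f + trace g" "conjugate c = c \<Longrightarrow> trace (f * c) = trace f * c"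
  "conjugate c = c \<Longrightarrow> trace (c * f) = c * trace f"
  "conjugate c = c \<Longrightarrow> trace c = 0" "trace (f ^ (2 ^ m)) = trace f ^ (2 ^ m)"
  "trace (fps_deriv f) = fps_deriv (trace f)" "trace f $ n = f $ n + (f $ n)\<^sup>2"
  "conjugate (trace f) = trace f"
proof -
  show "trace (fps_deriv f) = fps_deriv (trace f)"
    by (auto simp: trace_def conjugate_def fps_eq_iff of_nat_char_two fps_deriv_nth simp del: of_nat_add of_nat_Suc)
qed (simp_all add: trace_def conjugate_simps conjugate_conjugate algebra_simps power_add_char_two, simp_all add: conjugate_def)

definition tr0 :: "pow \<Rightarrow> gf4" where "tr0 v = ev0 v + (ev0 v)\<^sup>2"

lemma tr0_add: "tr0 (v + w) = tr0 v + tr0 w"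
  by (simp add: tr0_def ev0_simps square_add_char_two algebra_simps)

lemma trace_curve_nth_0: "trace (curve v) $ 0 = tr0 v"
  by (simp add: trace_simps curve_nth_0 tr0_def)

text \<open>Comparing orders gives \<open>2^m ord g \<le> k + 2^m ord f\<close> for every
  \<open>m\<close>; already \<open>m = k\<close> decides, since \<open>k < 2^k\<close>.\<close>

lemma dvd_of_powers:
  fixes f g :: "'a::field fps"
  assumes "g \<noteq> 0" "\<And>m. g ^ (2 ^ m) dvd fps_X ^ k * f ^ (2 ^ m)"
  shows "g dvd f"
proof (cases "f = 0")
  case False
  have "2 ^ m * subdegree g \<le> k + 2 ^ m * subdegree f" for m
  proof -
    obtain t where t: "fps_X ^ k * f ^ (2 ^ m) = g ^ (2 ^ m) * t" using assms(2)[of m] by (elim dvdE)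
    then have "t \<noteq> 0" using False by auto
    then show ?thesis
      using arg_cong[OF t, of subdegree] False assms(1) by (simp add: subdegree_power)
  qed
  from this[of k] have "2 ^ k * subdegree g \<le> k + 2 ^ k * subdegree f" .
  also have "\<dots> < 2 ^ k * Suc (subdegree f)" using less_exp[of k] by simp
  finally have "subdegree g < Suc (subdegree f)" by (simp only: mult_less_cancel1)
  then have "subdegree g \<le> subdegree f" by simp
  then show ?thesis using False assms(1) by (simp add: fps_dvd_iff)
qed simp

text \<open>What the argument uses of a generating family of the maximal ideal. Squares of the
  variables appear because the variables themselves are not killed by \<open>D\<close>.\<close>

locale cech_data =
  fixes J :: "'i set" and X :: "'i \<Rightarrow> pow"
  assumes finite_J: "finite J" and X_R0: "\<And>j. j \<in> J \<Longrightarrow> X j \<in> R0" and X_nz: "\<And>j. j \<in> J \<Longrightarrow> X j \<noteq> 0"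
    and sp: "spans J X (va\<^sup>2)" "spans J X (vb\<^sup>2)" "spans J X (vc\<^sup>2)"
begin

lemma global: "(\<And>j. j \<in> J \<Longrightarrow> loc_at (X j) s) \<Longrightarrow> s \<in> range to_fract"
  using range_to_fractI[OF finite_J sp(1,2)] .

lemma global_family:
  assumes "\<And>j. j \<in> J \<Longrightarrow> loc_at (X j) (s j)" "\<And>j k. j \<in> J \<Longrightarrow> k \<in> J \<Longrightarrow> s j = s k"
  shows "\<exists>t. \<forall>j\<in>J. s j = to_fract t"
proof (cases "J = {}")
  case False
  then obtain i where i: "i \<in> J" by blast
  have "s i \<in> range to_fract"
    by (rule global) (use assms i in metis)
  then show ?thesis using assms(2)[OF i] by (metis imageE)
qed simp

text \<open>Otherwise \<open>a^2\<close> would vanish on the curve. Fractions over powers of this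
  \<open>X i\<close> can be restricted to the curve.\<close>

lemma curve_nz: "\<exists>i\<in>J. curve (X i) \<noteq> 0"
proof (rule ccontr)
  assume "\<not> ?thesis"
  moreover obtain h where "va\<^sup>2 = (\<Sum>j\<in>J. h j * X j)" using sp(1) by (auto simp: spans_def)
  then have "fps_X\<^sup>2 = (\<Sum>j\<in>J. curve (h j) * curve (X j))"
    by (metis (no_types, lifting) curve_simps(3,5,6) curve_vars(1) sum.cong)
  ultimately show False by simp
qed

text \<open>A relation, because \<open>u\<close> and \<open>v\<close> are chosen. Another
  \<open>u\<close> differs by a common element of \<open>S\<close>, which changes \<open>v\<close>
  by an element of \<open>D S\<close> and leaves \<open>tr0 v\<close> as it is.\<close>

definition invariant :: "('i \<Rightarrow> 'i \<Rightarrow> pow fract) \<Rightarrow> gf4 \<Rightarrow> bool"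
  where "invariant z t \<longleftrightarrow> (\<exists>u v. (\<forall>j\<in>J. loc_at (X j) (u j)) \<and> (\<forall>j\<in>J. \<forall>k\<in>J. z j k = u j + u k) \<and>
    (\<forall>j\<in>J. vfield_fract (u j) = to_fract v) \<and> t = tr0 v)"

lemma invariant_exists:
  assumes z: "\<And>j k. j \<in> J \<Longrightarrow> k \<in> J \<Longrightarrow> rloc (X j * X k) (z j k)"
    and cocycle: "\<And>j k l. j \<in> J \<Longrightarrow> k \<in> J \<Longrightarrow> l \<in> J \<Longrightarrow> z j k + z l k = z j l"
  shows "\<exists>t. invariant z t"
proof -
  obtain u where u: "\<forall>j\<in>J. loc_at (X j) (u j)" "\<forall>j\<in>J. \<forall>k\<in>J. z j k = u j + u k"
    using cech_exact[OF finite_J sp, of z] rloc_loc_at[OF z] cocycle by blast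
  have "vfield_fract (u j) = vfield_fract (u k)" if "j \<in> J" "k \<in> J" for j k
  proof -
    have "vfield_fract (z j k) = 0" using that by (intro rloc_vfield_fract[OF z] R0_closed X_R0) (auto simp: X_nz)
    then show ?thesis using u(2) that by (simp add: vfield_fract_add add_eq_0_char_two)
  qed
  moreover have "loc_at (X j) (vfield_fract (u j))" if "j \<in> J" for j
    using u(1) that X_R0 by (auto intro: loc_at_vfield_fract)
  ultimately have "\<exists>v. \<forall>j\<in>J. vfield_fract (u j) = to_fract v" by (intro global_family)
  then obtain v where "\<forall>j\<in>J. vfield_fract (u j) = to_fract v" by blast
  then show ?thesis unfolding invariant_def using u by blast
qed

text \<open>Several facts in one: taking \<open>z' = 0\<close> and \<open>y = 0\<close> gives
  uniqueness of the invariant, and a general \<open>y\<close> gives independence of coboundaries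
  over \<open>R0\<close>.\<close>

lemma invariant_add:
  assumes z: "invariant z t" "invariant z' t'" "invariant z'' t''"
    and y: "\<And>j. j \<in> J \<Longrightarrow> rloc (X j) (y j)"
    and sum: "\<And>j k. j \<in> J \<Longrightarrow> k \<in> J \<Longrightarrow> z'' j k = z j k + z' j k + (y j + y k)"
  shows "t'' = t + t'"
proof -
  obtain u v where u: "\<forall>j\<in>J. loc_at (X j) (u j)" "\<forall>j\<in>J. \<forall>k\<in>J. z j k = u j + u k"
    "\<forall>j\<in>J. vfield_fract (u j) = to_fract v" "t = tr0 v" using z unfolding invariant_def by blast
  obtain u' v' where u': "\<forall>j\<in>J. loc_at (X j) (u' j)" "\<forall>j\<in>J. \<forall>k\<in>J. z' j k = u' j + u' k"
    "\<forall>j\<in>J. vfield_fract (u' j) = to_fract v'" "t' = tr0 v'" using z unfolding invariant_def by blast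
  obtain u'' v'' where u'': "\<forall>j\<in>J. loc_at (X j) (u'' j)" "\<forall>j\<in>J. \<forall>k\<in>J. z'' j k = u'' j + u'' k"
    "\<forall>j\<in>J. vfield_fract (u'' j) = to_fract v''" "t'' = tr0 v''" using z unfolding invariant_def by blast
  \<comment> \<open>\<open>s\<close> measures how far the three choices of solutions are from being
    additive. It is global, and \<open>D\<close> of a global element has no constant term.\<close>
  define s where "s j = u'' j + (u j + u' j + y j)" for j
  have "s j = s k" if "j \<in> J" "k \<in> J" for j k
  proof -
    have "u'' j + u'' k = (u j + u' j + y j) + (u k + u' k + y k)"
      using sum[OF that] u(2) u'(2) u''(2) that by (simp add: ac_simps)
    then show ?thesis unfolding s_def by (rule add_swap_char_two[THEN iffD1])
  qed
  moreover have "loc_at (X j) (s j)" if "j \<in> J" for j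
    unfolding s_def using u u' u'' that rloc_loc_at[OF y[OF that]] by (intro loc_at_add) auto
  ultimately have "\<exists>g. \<forall>j\<in>J. s j = to_fract g" by (intro global_family)
  then obtain g where g: "\<forall>j\<in>J. s j = to_fract g" by blast
  obtain i where i: "i \<in> J" using curve_nz by blast
  have "vfield_fract (y i) = 0" using i y X_R0 X_nz by (blast intro: rloc_vfield_fract)
  then have "vfield_fract (s i) = to_fract (v'' + (v + v'))"
    using u(3) u'(3) u''(3) i by (simp add: s_def vfield_fract_add)
  moreover have "vfield_fract (s i) = to_fract (vfield g)" using g i by (simp add: vfield_fract_to_fract)
  ultimately have "v'' + (v + v') = vfield g" by (simp only: to_fract_eq_iff)
  then have "tr0 v'' + (tr0 v + tr0 v') = 0"
    unfolding tr0_add[symmetric] by (simp add: tr0_def ev0_vfield)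
  then show ?thesis using u(4) u'(4) u''(4) by (simp add: add_eq_0_char_two)
qed

lemma invariant_0: "invariant (\<lambda>_ _. 0) 0"
  unfolding invariant_def
proof (intro exI conjI)
  show "\<forall>j\<in>J. loc_at (X j) ((\<lambda>_. 0) j)" using loc_at_to_fract[of "X _" 0] by simp
  show "\<forall>j\<in>J. vfield_fract ((\<lambda>_. 0) j) = to_fract 0" using vfield_fract_to_fract[of 0] by (simp add: vfield_simps)
qed (auto simp: tr0_def ev0_simps)

text \<open>\<open>D\<close> is linear over squares, so \<open>v\<close> becomes
  \<open>a^2 v\<close> and loses its constant term.\<close>

lemma invariant_times_va:
  assumes "invariant z t"
  shows "invariant (\<lambda>j k. to_fract (va\<^sup>2) * z j k) 0"
proof -
  obtain u v where u: "\<forall>j\<in>J. loc_at (X j) (u j)" "\<forall>j\<in>J. \<forall>k\<in>J. z j k = u j + u k"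
    "\<forall>j\<in>J. vfield_fract (u j) = to_fract v" using assms unfolding invariant_def by blast
  show ?thesis unfolding invariant_def
  proof (intro exI conjI ballI)
    fix j assume j: "j \<in> J"
    show "loc_at (X j) (to_fract (va\<^sup>2) * u j)" using u j by (intro loc_at_mult) auto
    show "vfield_fract (to_fract (va\<^sup>2) * u j) = to_fract (va\<^sup>2 * v)"
      using u(3) j vfield_fract_mult_constant[OF derivation_square[OF derivation_vfield]] by simp
    fix k assume k: "k \<in> J"
    show "to_fract (va\<^sup>2) * z j k = to_fract (va\<^sup>2) * u j + to_fract (va\<^sup>2) * u k"
      using u(2) j k by (simp add: distrib_left)
  qed (simp add: tr0_def ev0_simps ev0_vars)
qed

text \<open>On the curve \<open>b = c = 0\<close>, the trace of \<open>u\<close> is an element of \<open>F\<^sub>2((a))\<close>. If multiplying its iterated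
  Frobenius powers by a fixed power of \<open>a\<close> clears all their poles, then it has no pole itself,
  whence its derivative, multiplied by \<open>a\<^sup>2\<close>, has no constant term.\<close>

lemma invariant_bounded_poles:
  assumes z: "invariant z t"
    and y: "\<And>m j. j \<in> J \<Longrightarrow> rloc (X j) (y m j)"
    and eq: "\<And>m j k. j \<in> J \<Longrightarrow> k \<in> J \<Longrightarrow> to_fract (va ^ (2 * n)) * z j k ^ (2 ^ m) = y m j + y m k"
  shows "t = 0"
proof -
  obtain u v where u: "\<forall>j\<in>J. loc_at (X j) (u j)" "\<forall>j\<in>J. \<forall>k\<in>J. z j k = u j + u k"
    "\<forall>j\<in>J. vfield_fract (u j) = to_fract v" "t = tr0 v" using z unfolding invariant_def by blast
  obtain i where i: "i \<in> J" "curve (X i) \<noteq> 0" using curve_nz by blast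
  define x where "x = X i"
  define xi where "xi = curve x"
  have x: "x \<in> R0" "x \<noteq> 0" "xi \<noteq> 0" "vfield x = 0" "conjugate xi = xi"
    using i X_R0[of i] X_nz[of i] by (auto simp: x_def xi_def R0_def)
  have conj_xi: "conjugate (xi ^ k) = xi ^ k" for k using x by (simp add: conjugate_simps)
  have conj_X: "conjugate fps_X = fps_X" by (simp add: conjugate_def fps_eq_iff fps_X_def)
  obtain N g where g: "to_fract (x ^ N) * u i = to_fract g" using u(1) i by (auto simp: loc_at_def x_def)
  \<comment> \<open>The denominator \<open>xi^N\<close> is fixed by conjugation, so
    \<open>eta / xi^N\<close> is the trace of \<open>u i\<close> on the curve, and absence of poles
    means \<open>xi^N dvd eta\<close>.\<close>
  define eta where "eta = trace (curve g)"
  have "(xi ^ N) ^ (2 ^ m) dvd fps_X ^ (2 * n) * eta ^ (2 ^ m)" for m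
  proof -
    define q :: nat where "q = 2 ^ m"
    \<comment> \<open>Adding \<open>y m j\<close> makes \<open>a^(2 n) u_j^q\<close> independent of
      \<open>j\<close>, hence an element \<open>c\<close> of \<open>S\<close>. On the curve the
      trace removes \<open>y m\<close> again.\<close>
    define s where "s j = to_fract (va ^ (2 * n)) * u j ^ q + y m j" for j
    have "s j = s k" if "j \<in> J" "k \<in> J" for j k
    proof -
      have "to_fract (va ^ (2 * n)) * u j ^ q + to_fract (va ^ (2 * n)) * u k ^ q = y m j + y m k"
        using eq[OF that, of m] u(2) that by (simp add: power_add_char_two q_def distrib_left)
      then show ?thesis unfolding s_def by (rule add_swap_char_two[THEN iffD1])
    qed
    moreover have "loc_at (X j) (s j)" if "j \<in> J" for j
      unfolding s_def using u(1) that rloc_loc_at[OF y[OF that]]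
      by (intro loc_at_add loc_at_mult loc_at_power) auto
    ultimately have "\<exists>c. \<forall>j\<in>J. s j = to_fract c" by (intro global_family)
    then obtain c where c: "\<forall>j\<in>J. s j = to_fract c" by blast
    obtain M r where r: "r \<in> R0" "to_fract (x ^ M) * y m i = to_fract r"
      using y[OF i(1), of m] by (auto simp: rloc_def x_def)
    have "to_fract (x ^ (N * q) * x ^ M * c) = to_fract (x ^ (N * q)) * to_fract (x ^ M) * s i"
      using c i by simp
    also have "\<dots> = to_fract (va ^ (2 * n)) * to_fract (x ^ M) * (to_fract (x ^ N) * u i) ^ q
        + to_fract (x ^ (N * q)) * (to_fract (x ^ M) * y m i)"
      by (simp add: s_def power_mult power_mult_distrib to_fract_power distrib_left ac_simps)
    also have "\<dots> = to_fract (va ^ (2 * n) * x ^ M * g ^ q + x ^ (N * q) * r)"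
      unfolding g r by (simp add: to_fract_power)
    finally have "x ^ (N * q) * x ^ M * c = va ^ (2 * n) * x ^ M * g ^ q + x ^ (N * q) * r"
      by (simp only: to_fract_eq_iff)
    from arg_cong[OF this, of "\<lambda>f. trace (curve f)"]
    have "trace (xi ^ (N * q) * xi ^ M * curve c)
        = trace (fps_X ^ (2 * n) * xi ^ M * curve g ^ q) + trace (xi ^ (N * q) * curve r)"
      by (simp add: curve_simps trace_simps xi_def curve_vars)
    moreover have "trace (xi ^ (N * q) * xi ^ M * curve c) = xi ^ (N * q) * xi ^ M * trace (curve c)"
      by (intro trace_simps) (simp add: conjugate_simps x)
    moreover have "trace (fps_X ^ (2 * n) * xi ^ M * curve g ^ q)
        = fps_X ^ (2 * n) * xi ^ M * trace (curve g ^ q)"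
      by (intro trace_simps) (simp add: conjugate_simps x conj_X)
    moreover have "trace (curve g ^ q) = eta ^ q" by (simp add: trace_simps q_def eta_def)
    moreover have "trace (xi ^ (N * q) * curve r) = 0"
      using r(1) by (intro trace_simps) (simp add: conjugate_simps x R0_def)
    ultimately have "xi ^ M * (fps_X ^ (2 * n) * eta ^ q) = xi ^ M * ((xi ^ N) ^ q * trace (curve c))"
      by (simp add: power_mult ac_simps)
    then have "fps_X ^ (2 * n) * eta ^ q = (xi ^ N) ^ q * trace (curve c)" using x(3) by simp
    then show ?thesis by (simp add: q_def)
  qed
  then have "xi ^ N dvd eta" by (rule dvd_of_powers[rotated]) (simp add: x)
  then obtain w where w: "eta = xi ^ N * w" by (elim dvdE)
  have xN: "vfield (x ^ N) = 0" using R0_closed(5)[OF x(1)] by (simp add: R0_def)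
  have "to_fract (vfield g) = to_fract (x ^ N * v)"
    using arg_cong[OF g, of vfield_fract] u(3) i xN by (simp add: vfield_fract_mult_constant vfield_fract_to_fract)
  then have "vfield g = x ^ N * v" by (simp only: to_fract_eq_iff)
  then have "trace (fps_X\<^sup>2 * fps_deriv (curve g)) = trace (xi ^ N * curve v)"
    by (metis curve_vfield curve_simps(3,6) xi_def)
  moreover have "trace (fps_X\<^sup>2 * fps_deriv (curve g)) = fps_X\<^sup>2 * fps_deriv eta"
    unfolding eta_def trace_simps(6)[symmetric] by (intro trace_simps) (simp add: conjugate_simps conj_X)
  moreover have "trace (xi ^ N * curve v) = xi ^ N * trace (curve v)"
    by (intro trace_simps conj_xi)
  \<comment> \<open>Restricting \<open>D (x^N) = 0\<close> to the curve: the derivative of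
    \<open>eta = xi^N w\<close> is \<open>xi^N w'\<close>, so \<open>xi^N\<close> cancels.\<close>
  moreover have "fps_deriv (xi ^ N) = 0"
    using curve_vfield[of "x ^ N"] xN by (simp add: curve_simps xi_def)
  ultimately have "xi ^ N * (fps_X\<^sup>2 * fps_deriv w) = xi ^ N * trace (curve v)"
    by (simp add: w ac_simps)
  then have "trace (curve v) = fps_X\<^sup>2 * fps_deriv w" using x(3) by simp
  then have "trace (curve v) $ 0 = 0" by (simp add: fps_mult_nth_0)
  then show ?thesis by (simp add: trace_curve_nth_0 u(4))
qed

text \<open>If \<open>x = a p + b q + c r\<close> then \<open>\<omega> (a p\<^sup>2 + b q\<^sup>2 + c r\<^sup>2) / x\<^sup>2\<close> is mapped to \<open>\<omega>\<close> by the
  derivation and restricts to \<open>\<omega> / a\<close> on the curve.\<close>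

lemma invariant_nontrivial:
  assumes "\<And>j. j \<in> J \<Longrightarrow> ev0 (X j) = 0"
  shows "\<exists>z. invariant z 1 \<and> (\<forall>j\<in>J. \<forall>k\<in>J. rloc (X j * X k) (z j k)) \<and>
    (\<forall>j\<in>J. \<forall>k\<in>J. \<forall>l\<in>J. z j k + z l k = z j l)"
proof -
  have dec: "\<exists>p q r. f = va * p + vb * q + vc * r" if "ev0 f = 0" for f
  proof (intro exI)
    show "f = va * fps_shift 1 f + vb * fps_const (fps_shift 1 (f $ 0)) + vc * fps_const (fps_const (fps_shift 1 (f $ 0 $ 0)))"
      (is "f = ?g")
    proof (rule fps_ext, rule fps_ext, rule fps_ext)
      fix i j k
      show "f $ i $ j $ k = ?g $ i $ j $ k"
        using that by (cases i; cases j; cases k) (auto simp: va_def vb_def vc_def ev0_def fps_shift_def)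
    qed
  qed
  obtain p q r where x: "\<And>j. j \<in> J \<Longrightarrow> X j = va * p j + vb * q j + vc * r j"
    using dec[OF assms] by metis
  define g where "g j = scal GFw * (va * (p j)\<^sup>2 + vb * (q j)\<^sup>2 + vc * (r j)\<^sup>2)" for j
  define u where "u j = to_fract (g j) / to_fract ((X j)\<^sup>2)" for j
  have X2: "(X j)\<^sup>2 = va\<^sup>2 * (p j)\<^sup>2 + vb\<^sup>2 * (q j)\<^sup>2 + vc\<^sup>2 * (r j)\<^sup>2" if "j \<in> J" for j
    by (simp add: x[OF that] square_add_char_two power_mult_distrib)
  have vfield_g: "vfield (g j) = scal GFw * (X j)\<^sup>2" if "j \<in> J" for j
    unfolding X2[OF that] by (simp add: g_def vfield_simps derivation_square[OF derivation_vfield] vfield_vars)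
  have u: "to_fract ((X j)\<^sup>2) * u j = to_fract (g j)" if "j \<in> J" for j
    using X_nz[OF that] by (simp add: u_def)
  have Xc: "vfield ((X j)\<^sup>2) = 0" for j by (rule derivation_square[OF derivation_vfield])
  have vfield_fract_u: "vfield_fract (u j) = to_fract (scal GFw)" if "j \<in> J" for j
  proof -
    have "to_fract ((X j)\<^sup>2) * vfield_fract (u j) = to_fract ((X j)\<^sup>2) * to_fract (scal GFw)"
      using arg_cong[OF u[OF that], of vfield_fract] unfolding vfield_fract_mult_constant[OF Xc] vfield_fract_to_fract vfield_g[OF that]
      by (simp add: mult.commute)
    then show ?thesis using X_nz[OF that] by simp
  qed
  \<comment> \<open>On the curve \<open>x = a p\<close>, so \<open>g = \<omega> a p^2\<close> and
    \<open>a g = \<omega> x^2\<close>.\<close>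
  have curve_g: "fps_X * curve (g j) = fps_const GFw * (curve (X j))\<^sup>2" if "j \<in> J" for j
    unfolding x[OF that] g_def
    by (simp add: curve_simps curve_vars) (simp add: power2_eq_square ac_simps)
  have rl: "rloc (X j * X k) (u j + u k)" if j: "j \<in> J" and k: "k \<in> J" for j k
  proof -
    \<comment> \<open>Neither \<open>D u_j\<close> nor the restriction of \<open>u_j\<close> to the
      curve depends on \<open>j\<close>. The numerator \<open>f\<close> of the difference is
      therefore killed by \<open>D\<close> and zero on the curve.\<close>
    define f where "f = (X k)\<^sup>2 * g j + (X j)\<^sup>2 * g k"
    have "vfield f = 0"
      by (simp add: f_def vfield_simps Xc vfield_g j k) (simp add: ac_simps two_char_two)
    moreover have "curve f = 0"
    proof -
      have "fps_X * curve f = (curve (X k))\<^sup>2 * (fps_X * curve (g j)) + (curve (X j))\<^sup>2 * (fps_X * curve (g k))"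
        by (simp add: f_def curve_simps algebra_simps)
      also have "\<dots> = 0" unfolding curve_g[OF j] curve_g[OF k] by (simp add: ac_simps)
      finally show ?thesis by simp
    qed
    ultimately have "f \<in> R0" by (simp add: R0_def conjugate_simps)
    moreover have "to_fract ((X j * X k) ^ 2) * (u j + u k) = to_fract f"
    proof -
      have "to_fract ((X j * X k) ^ 2) * (u j + u k)
          = to_fract ((X k)\<^sup>2) * (to_fract ((X j)\<^sup>2) * u j) + to_fract ((X j)\<^sup>2) * (to_fract ((X k)\<^sup>2) * u k)"
        by (simp add: power_mult_distrib algebra_simps)
      then show ?thesis unfolding u[OF j] u[OF k] by (simp add: f_def)
    qed
    ultimately show ?thesis unfolding rloc_def by blast
  qed
  \<comment> \<open>The value is the trace \<open>\<omega> + \<omega>^2 = 1\<close>.\<close>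
  have "invariant (\<lambda>j k. u j + u k) 1"
    unfolding invariant_def
  proof (intro exI conjI ballI)
    fix j assume j: "j \<in> J"
    show "loc_at (X j) (u j)" unfolding loc_at_def using u[OF j] by blast
    show "vfield_fract (u j) = to_fract (scal GFw)" by (rule vfield_fract_u[OF j])
  qed (simp_all add: tr0_def ev0_vars power2_eq_square one_gf4_def)
  moreover have "(u j + u k) + (u l + u k) = u j + u l" for j k l
    by (simp add: ac_simps)
  ultimately show ?thesis using rl by (intro exI[of _ "\<lambda>j k. u j + u k"]) blast
qed

end


section \<open>Abelian groups embedded in powers of a field\<close>

text \<open>Group laws for classes of fractions and for cochains are pulled back along the additive
  injection \<open>\<Phi>\<close>, which avoids computing with representatives.\<close>

locale embedded_group =
  fixes G (structure) and \<Phi> :: "'b \<Rightarrow> 'i \<Rightarrow> 'k::ab_group_add"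
  assumes add_closed: "x \<in> carrier G \<Longrightarrow> y \<in> carrier G \<Longrightarrow> x \<oplus> y \<in> carrier G"
    and zero: "\<zero> \<in> carrier G"
    and \<Phi>_add: "x \<in> carrier G \<Longrightarrow> y \<in> carrier G \<Longrightarrow> \<Phi> (x \<oplus> y) i = \<Phi> x i + \<Phi> y i"
    and \<Phi>_zero: "\<Phi> \<zero> i = 0"
    and neg: "x \<in> carrier G \<Longrightarrow> \<exists>y\<in>carrier G. \<forall>i. \<Phi> y i = - \<Phi> x i"
    and eqI: "x \<in> carrier G \<Longrightarrow> y \<in> carrier G \<Longrightarrow> (\<And>i. \<Phi> x i = \<Phi> y i) \<Longrightarrow> x = y"
begin

lemma abelian_group: "abelian_group G"
proof (rule abelian_groupI)
  fix x y z assume x: "x \<in> carrier G" and y: "y \<in> carrier G"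
  show "x \<oplus> y = y \<oplus> x" by (rule eqI) (simp_all add: add_closed \<Phi>_add x y add.commute)
  show "\<zero> \<oplus> x = x" by (rule eqI) (simp_all add: add_closed \<Phi>_add \<Phi>_zero x zero)
  obtain w where "w \<in> carrier G" "\<forall>i. \<Phi> w i = - \<Phi> x i" using neg[OF x] by blast
  then show "\<exists>y\<in>carrier G. y \<oplus> x = \<zero>"
    by (intro bexI[of _ w] eqI) (simp_all add: add_closed \<Phi>_add \<Phi>_zero x zero)
  assume z: "z \<in> carrier G"
  show "(x \<oplus> y) \<oplus> z = x \<oplus> (y \<oplus> z)"
    by (rule eqI) (simp_all add: add_closed \<Phi>_add x y z add.assoc)
qed (simp_all add: add_closed zero)

lemma \<Phi>_finsum:
  assumes "f \<in> A \<rightarrow> carrier G"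
  shows "\<Phi> (finsum G f A) i = (\<Sum>j\<in>A. \<Phi> (f j) i)"
proof -
  interpret abelian_group G by (rule abelian_group)
  show ?thesis using assms
  proof (induction A rule: infinite_finite_induct)
    case (insert a A)
    then show ?case
      by (subst finsum_insert) (auto simp: \<Phi>_add finsum_closed)
  qed (simp_all add: \<Phi>_zero finsum_infinite)
qed

end


section \<open>Localizations of a domain inside a field\<close>

lemma UN_constant:
  assumes "p \<in> U" "\<And>q. q \<in> U \<Longrightarrow> f q = c"
  shows "(\<Union>q\<in>U. f q) = c"
  using assms by auto

locale field_embedding = cring R for R (structure) +
  fixes \<kappa> :: "'a \<Rightarrow> 'k::field"
  assumes \<kappa>_one: "\<kappa> \<one> = 1"
    and \<kappa>_add: "x \<in> carrier R \<Longrightarrow> y \<in> carrier R \<Longrightarrow> \<kappa> (x \<oplus> y) = \<kappa> x + \<kappa> y"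
    and \<kappa>_mult: "x \<in> carrier R \<Longrightarrow> y \<in> carrier R \<Longrightarrow> \<kappa> (x \<otimes> y) = \<kappa> x * \<kappa> y"
    and \<kappa>_inj: "inj_on \<kappa> (carrier R)"
begin

lemma \<kappa>_zero: "\<kappa> \<zero> = 0"
  by (rule add_left_imp_eq[of "\<kappa> \<zero>"]) (simp flip: \<kappa>_add)

lemma \<kappa>_eq_0: "x \<in> carrier R \<Longrightarrow> \<kappa> x = 0 \<longleftrightarrow> x = \<zero>"
  using inj_on_eq_iff[OF \<kappa>_inj, of x \<zero>] by (simp add: \<kappa>_zero)

lemma \<kappa>_uminus: "x \<in> carrier R \<Longrightarrow> \<kappa> (\<ominus> x) = - \<kappa> x"
  using \<kappa>_add[of "\<ominus> x" x] by (simp add: l_neg \<kappa>_zero eq_neg_iff_add_eq_0)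

lemma \<kappa>_pow: "x \<in> carrier R \<Longrightarrow> \<kappa> (x [^] (n::nat)) = \<kappa> x ^ n"
  by (induction n) (simp_all add: \<kappa>_one \<kappa>_mult)

lemma \<kappa>_finprod: "f \<in> A \<rightarrow> carrier R \<Longrightarrow> \<kappa> (finprod R f A) = (\<Prod>j\<in>A. \<kappa> (f j))"
proof (induction A rule: infinite_finite_induct)
  case (insert a A)
  then show ?case by (subst finprod_insert) (auto simp: \<kappa>_mult)
qed (simp_all add: \<kappa>_one)

definition mult_set :: "'a set \<Rightarrow> bool"
  where "mult_set S \<longleftrightarrow> S \<subseteq> carrier R \<and> \<one> \<in> S \<and> (\<forall>x\<in>S. \<forall>y\<in>S. x \<otimes> y \<in> S)"

lemma mult_setD:
  assumes "mult_set S"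
  shows "x \<in> S \<Longrightarrow> x \<in> carrier R" "\<one> \<in> S" "x \<in> S \<Longrightarrow> y \<in> S \<Longrightarrow> x \<otimes> y \<in> S"
    "x \<in> S \<Longrightarrow> x [^] (n::nat) \<in> S"
proof -
  show "x \<in> S \<Longrightarrow> x \<in> carrier R" "\<one> \<in> S" and m: "x \<in> S \<Longrightarrow> y \<in> S \<Longrightarrow> x \<otimes> y \<in> S" for x y
    using assms by (auto simp: mult_set_def)
  then show "x \<in> S \<Longrightarrow> x [^] n \<in> S" by (induction n) (auto intro: m)
qed

text \<open>If \<open>S\<close> contains zero then the localization is the zero ring.\<close>

definition val :: "'a set \<Rightarrow> 'a \<times> 'a \<Rightarrow> 'k"
  where "val S = (\<lambda>(a, s). if \<zero> \<in> S then 0 else \<kappa> a / \<kappa> s)"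

definition cval :: "'a set \<Rightarrow> ('a \<times> 'a) set \<Rightarrow> 'k"
  where "cval S U = val S (SOME p. p \<in> U)"

abbreviation L :: "'a set \<Rightarrow> ('a, ('a \<times> 'a) set) module"
  where "L S \<equiv> localization R S"

text \<open>Denominators are cancelled in the field. If \<open>S\<close> contains zero, the
  multiplier \<open>u = \<zero>\<close> identifies all fractions, which agrees with their common
  value 0.\<close>

lemma frac_rel_iff:
  assumes S: "mult_set S"
  shows "((a, s), (b, t)) \<in> frac_rel R S \<longleftrightarrow>
    a \<in> carrier R \<and> b \<in> carrier R \<and> s \<in> S \<and> t \<in> S \<and> val S (a, s) = val S (b, t)"
proof -
  note [simp] = mult_setD(1)[OF S]
  have "(\<exists>u\<in>S. u \<otimes> (t \<otimes> a) = u \<otimes> (s \<otimes> b)) \<longleftrightarrow> val S (a, s) = val S (b, t)"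
    if m: "a \<in> carrier R" "b \<in> carrier R" "s \<in> S" "t \<in> S"
  proof (cases "\<zero> \<in> S")
    case True
    then show ?thesis using m by (auto simp: val_def intro!: bexI[of _ \<zero>])
  next
    case False
    then have nz: "\<kappa> u \<noteq> 0" if "u \<in> S" for u using that by (auto simp: \<kappa>_eq_0)
    have "u \<otimes> (t \<otimes> a) = u \<otimes> (s \<otimes> b) \<longleftrightarrow> val S (a, s) = val S (b, t)" if "u \<in> S" for u
    proof -
      have "u \<otimes> (t \<otimes> a) = u \<otimes> (s \<otimes> b) \<longleftrightarrow> \<kappa> (u \<otimes> (t \<otimes> a)) = \<kappa> (u \<otimes> (s \<otimes> b))"
        using that m by (intro inj_on_eq_iff[OF \<kappa>_inj, symmetric]) auto
      also have "\<dots> \<longleftrightarrow> \<kappa> t * \<kappa> a = \<kappa> s * \<kappa> b" using that m nz by (simp add: \<kappa>_mult)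
      also have "\<dots> \<longleftrightarrow> val S (a, s) = val S (b, t)"
        using False m nz by (auto simp: val_def field_simps)
      finally show ?thesis .
    qed
    then show ?thesis using mult_setD(2)[OF S] by blast
  qed
  then show ?thesis unfolding frac_rel_def by auto
qed

lemma fraction_iff:
  assumes "mult_set S" "a \<in> carrier R" "s \<in> S"
  shows "p \<in> fraction R S a s \<longleftrightarrow> fst p \<in> carrier R \<and> snd p \<in> S \<and> val S p = val S (a, s)"
  using assms by (cases p) (auto simp: fraction_def frac_rel_iff)

lemma fraction_cong:
  assumes "mult_set S" "a \<in> carrier R" "s \<in> S" "b \<in> carrier R" "t \<in> S" "val S (a, s) = val S (b, t)"
  shows "fraction R S a s = fraction R S b t"
  using assms by (auto simp: fraction_iff)

lemma cval_fraction:
  assumes "mult_set S" "a \<in> carrier R" "s \<in> S"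
  shows "cval S (fraction R S a s) = val S (a, s)"
proof -
  have "(a, s) \<in> fraction R S a s" using assms by (simp add: fraction_iff)
  then have "(SOME p. p \<in> fraction R S a s) \<in> fraction R S a s" by (rule someI)
  then show ?thesis using assms by (simp add: fraction_iff cval_def)
qed

lemma carrier_localization:
  "carrier (L S) = {fraction R S a s | a s. a \<in> carrier R \<and> s \<in> S}"
  by (auto simp: localization_def quotient_def fraction_def)

lemma fraction_closed: "a \<in> carrier R \<Longrightarrow> s \<in> S \<Longrightarrow> fraction R S a s \<in> carrier (L S)"
  by (auto simp: carrier_localization)

lemma localization_cases:
  assumes "U \<in> carrier (L S)"
  obtains a s where "a \<in> carrier R" "s \<in> S" "U = fraction R S a s"
  using assms by (auto simp: carrier_localization)

lemma fraction_UN: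
  assumes "mult_set S" "a \<in> carrier R" "s \<in> S"
    and "\<And>b t. b \<in> carrier R \<Longrightarrow> t \<in> S \<Longrightarrow> val S (b, t) = val S (a, s) \<Longrightarrow> f b t = c"
  shows "(\<Union>(b, t)\<in>fraction R S a s. f b t) = c"
  using assms by (intro UN_constant[of "(a, s)"]) (auto simp: fraction_iff)

lemma val_add:
  assumes S: "mult_set S" and "a \<in> carrier R" "s \<in> S" "b \<in> carrier R" "t \<in> S"
  shows "val S (t \<otimes> a \<oplus> s \<otimes> b, s \<otimes> t) = val S (a, s) + val S (b, t)"
proof (cases "\<zero> \<in> S")
  case False
  then have "\<kappa> s \<noteq> 0" "\<kappa> t \<noteq> 0" using assms mult_setD[OF S] by (auto simp: \<kappa>_eq_0)
  then show ?thesis using False assms mult_setD(1)[OF S]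
    by (simp add: val_def \<kappa>_add \<kappa>_mult add_divide_distrib)
qed (simp add: val_def)

lemma add_fraction:
  assumes S: "mult_set S" and m: "a \<in> carrier R" "s \<in> S" "b \<in> carrier R" "t \<in> S"
  shows "fraction R S a s \<oplus>\<^bsub>L S\<^esub> fraction R S b t = fraction R S (t \<otimes> a \<oplus> s \<otimes> b) (s \<otimes> t)"
proof -
  have "(\<Union>(a', s')\<in>fraction R S a s. \<Union>(b', t')\<in>fraction R S b t. fraction R S (t' \<otimes> a' \<oplus> s' \<otimes> b') (s' \<otimes> t'))
      = fraction R S (t \<otimes> a \<oplus> s \<otimes> b) (s \<otimes> t)"
    using m mult_setD[OF S] by (intro fraction_UN[OF S] fraction_cong[OF S]) (auto simp: val_add[OF S])
  then show ?thesis by (simp add: localization_def)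
qed

lemma smult_fraction:
  assumes S: "mult_set S" and m: "a \<in> carrier R" "s \<in> S" "r \<in> carrier R"
  shows "r \<odot>\<^bsub>L S\<^esub> fraction R S a s = fraction R S (r \<otimes> a) s"
proof -
  have "val S (r \<otimes> b, t) = \<kappa> r * val S (b, t)" if "b \<in> carrier R" for b t
    using that m by (simp add: val_def \<kappa>_mult)
  then have "(\<Union>(a', s')\<in>fraction R S a s. fraction R S (r \<otimes> a') s') = fraction R S (r \<otimes> a) s"
    using m mult_setD[OF S] by (intro fraction_UN[OF S] fraction_cong[OF S]) auto
  then show ?thesis by (simp add: localization_def)
qed

lemma localization_simps:
  assumes S: "mult_set S"
  shows loc_add_closed: "U \<in> carrier (L S) \<Longrightarrow> V \<in> carrier (L S) \<Longrightarrow> U \<oplus>\<^bsub>L S\<^esub> V \<in> carrier (L S)"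
    and cval_add: "U \<in> carrier (L S) \<Longrightarrow> V \<in> carrier (L S) \<Longrightarrow> cval S (U \<oplus>\<^bsub>L S\<^esub> V) = cval S U + cval S V"
    and loc_zero: "\<zero>\<^bsub>L S\<^esub> \<in> carrier (L S)"
    and cval_zero: "cval S \<zero>\<^bsub>L S\<^esub> = 0"
    and loc_smult_closed: "r \<in> carrier R \<Longrightarrow> U \<in> carrier (L S) \<Longrightarrow> r \<odot>\<^bsub>L S\<^esub> U \<in> carrier (L S)"
    and cval_smult: "r \<in> carrier R \<Longrightarrow> U \<in> carrier (L S) \<Longrightarrow> cval S (r \<odot>\<^bsub>L S\<^esub> U) = \<kappa> r * cval S U"
    and cval_inj: "U \<in> carrier (L S) \<Longrightarrow> V \<in> carrier (L S) \<Longrightarrow> cval S U = cval S V \<Longrightarrow> U = V"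
    and loc_neg: "U \<in> carrier (L S) \<Longrightarrow> \<exists>V\<in>carrier (L S). cval S V = - cval S U"
proof -
  note [simp] = mult_setD[OF S] cval_fraction[OF S] fraction_closed
  show "U \<in> carrier (L S) \<Longrightarrow> V \<in> carrier (L S) \<Longrightarrow> U \<oplus>\<^bsub>L S\<^esub> V \<in> carrier (L S)"
    "U \<in> carrier (L S) \<Longrightarrow> V \<in> carrier (L S) \<Longrightarrow> cval S (U \<oplus>\<^bsub>L S\<^esub> V) = cval S U + cval S V"
    by (auto elim!: localization_cases simp: add_fraction[OF S] val_add[OF S])
  have z: "\<zero>\<^bsub>L S\<^esub> = fraction R S \<zero> \<one>" by (simp add: localization_def)
  show "\<zero>\<^bsub>L S\<^esub> \<in> carrier (L S)" "cval S \<zero>\<^bsub>L S\<^esub> = 0"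
    unfolding z by (simp_all, simp add: val_def \<kappa>_zero)
  show "r \<in> carrier R \<Longrightarrow> U \<in> carrier (L S) \<Longrightarrow> r \<odot>\<^bsub>L S\<^esub> U \<in> carrier (L S)"
    "r \<in> carrier R \<Longrightarrow> U \<in> carrier (L S) \<Longrightarrow> cval S (r \<odot>\<^bsub>L S\<^esub> U) = \<kappa> r * cval S U"
    by (auto elim!: localization_cases simp: smult_fraction[OF S]) (simp add: val_def \<kappa>_mult)
  show "U \<in> carrier (L S) \<Longrightarrow> V \<in> carrier (L S) \<Longrightarrow> cval S U = cval S V \<Longrightarrow> U = V"
    by (auto elim!: localization_cases simp: fraction_iff[OF S])
  show "U \<in> carrier (L S) \<Longrightarrow> \<exists>V\<in>carrier (L S). cval S V = - cval S U"
  proof (elim localization_cases)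
    fix a s assume "a \<in> carrier R" "s \<in> S" "U = fraction R S a s"
    then show ?thesis
      by (intro bexI[of _ "fraction R S (\<ominus> a) s"]) (auto simp: val_def \<kappa>_uminus)
  qed
qed

lemma localization_group:
  assumes "mult_set S"
  shows "embedded_group (L S) (\<lambda>U (_::unit). cval S U)"
proof
  show "\<exists>y\<in>carrier (L S). \<forall>i. cval S y = - cval S x" if "x \<in> carrier (L S)" for x
    using loc_neg[OF assms that] by blast
qed (use cval_inj[OF assms] in \<open>auto simp: localization_simps[OF assms]\<close>)

lemma cval_range:
  assumes S: "mult_set S"
  shows "\<zero> \<in> S \<Longrightarrow> U \<in> carrier (L S) \<Longrightarrow> cval S U = 0"
    "\<zero> \<notin> S \<Longrightarrow> U \<in> carrier (L S) \<Longrightarrow> \<exists>a\<in>carrier R. \<exists>s\<in>S. cval S U = \<kappa> a / \<kappa> s"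
    "\<zero> \<notin> S \<Longrightarrow> a \<in> carrier R \<Longrightarrow> s \<in> S \<Longrightarrow> \<exists>U\<in>carrier (L S). cval S U = \<kappa> a / \<kappa> s"
proof -
  show "\<zero> \<in> S \<Longrightarrow> U \<in> carrier (L S) \<Longrightarrow> cval S U = 0"
    "\<zero> \<notin> S \<Longrightarrow> U \<in> carrier (L S) \<Longrightarrow> \<exists>a\<in>carrier R. \<exists>s\<in>S. cval S U = \<kappa> a / \<kappa> s"
    by (auto elim!: localization_cases simp: cval_fraction[OF S] val_def) blast
  show "\<zero> \<notin> S \<Longrightarrow> a \<in> carrier R \<Longrightarrow> s \<in> S \<Longrightarrow> \<exists>U\<in>carrier (L S). cval S U = \<kappa> a / \<kappa> s"
    by (intro bexI[of _ "fraction R S a s"]) (simp_all add: cval_fraction[OF S] val_def fraction_closed)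
qed

lemma loc_map_simps:
  assumes S: "mult_set S" and T: "mult_set T" and ST: "S \<subseteq> T" and U: "U \<in> carrier (L S)"
  shows "loc_map R T U \<in> carrier (L T)" "cval T (loc_map R T U) = (if \<zero> \<in> T then 0 else cval S U)"
proof -
  obtain a s where as: "a \<in> carrier R" "s \<in> S" "U = fraction R S a s"
    using U by (rule localization_cases)
  have v: "val T (b, t) = (if \<zero> \<in> T then 0 else val S (b, t))" for b t
    using ST by (auto simp: val_def)
  have "loc_map R T U = fraction R T a s"
    unfolding loc_map_def as(3)
    by (intro fraction_UN[OF S] fraction_cong[OF T]) (use as ST v in auto)
  then show "loc_map R T U \<in> carrier (L T)" "cval T (loc_map R T U) = (if \<zero> \<in> T then 0 else cval S U)"
    using as ST by (auto simp: fraction_closed cval_fraction[OF T] cval_fraction[OF S] v)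
qed

lemma loc_frobenius_simps:
  assumes S: "mult_set S" and p: "p > 0" and U: "U \<in> carrier (L S)"
  shows "loc_frobenius R p S U \<in> carrier (L S)" "cval S (loc_frobenius R p S U) = cval S U ^ p"
proof -
  obtain a s where as: "a \<in> carrier R" "s \<in> S" "U = fraction R S a s"
    using U by (rule localization_cases)
  have v: "val S (b [^] p, t [^] p) = val S (b, t) ^ p" if "b \<in> carrier R" "t \<in> S" for b t
    using that p mult_setD(1)[OF S] by (auto simp: val_def \<kappa>_pow power_divide zero_power)
  have "loc_frobenius R p S U = fraction R S (a [^] p) (s [^] p)"
    unfolding loc_frobenius_def as(3)
    by (intro fraction_UN[OF S] fraction_cong[OF S]) (use as mult_setD[OF S] v in auto)
  then show "loc_frobenius R p S U \<in> carrier (L S)" "cval S (loc_frobenius R p S U) = cval S U ^ p"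
    using as by (auto simp: fraction_closed cval_fraction[OF S] v mult_setD[OF S])
qed

end


section \<open>Local cohomology in characteristic two\<close>

locale cech_embedding = field_embedding R \<kappa> for R (structure) and \<kappa> :: "'a \<Rightarrow> 'k::{field, char_two}" +
  fixes xs :: "'a list"
  assumes xs: "set xs \<subseteq> carrier R"
begin

abbreviation "Mon \<equiv> monomials R xs"
abbreviation "C \<equiv> cech_module R xs"
abbreviation "idx \<equiv> cech_index xs"

lemma xs_nth: "j < length xs \<Longrightarrow> xs ! j \<in> carrier R"
  using xs by auto

lemma idxD: "I \<in> idx i \<Longrightarrow> I \<subseteq> {..<length xs}" "I \<in> idx i \<Longrightarrow> finite I" "I \<in> idx i \<Longrightarrow> card I = i"
  using finite_subset by (auto simp: cech_index_def)

lemma \<kappa>_monomial: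
  assumes "I \<subseteq> {..<length xs}"
  shows "(\<Otimes>j\<in>I. (xs ! j) [^] (e j :: nat)) \<in> carrier R"
    "\<kappa> (\<Otimes>j\<in>I. (xs ! j) [^] (e j :: nat)) = (\<Prod>j\<in>I. \<kappa> (xs ! j) ^ e j)"
proof -
  have "(\<lambda>j. (xs ! j) [^] e j) \<in> I \<rightarrow> carrier R" using assms xs_nth by auto
  then show "(\<Otimes>j\<in>I. (xs ! j) [^] e j) \<in> carrier R"
    "\<kappa> (\<Otimes>j\<in>I. (xs ! j) [^] e j) = (\<Prod>j\<in>I. \<kappa> (xs ! j) ^ e j)"
    using assms xs_nth by (auto simp: finprod_closed \<kappa>_finprod \<kappa>_pow intro!: prod.cong)
qed

lemma Mon_iff:
  assumes "I \<subseteq> {..<length xs}"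
  shows "s \<in> Mon I \<longleftrightarrow> s \<in> carrier R \<and> (\<exists>e. \<kappa> s = (\<Prod>j\<in>I. \<kappa> (xs ! j) ^ e j))"
proof
  assume "s \<in> Mon I"
  then show "s \<in> carrier R \<and> (\<exists>e. \<kappa> s = (\<Prod>j\<in>I. \<kappa> (xs ! j) ^ e j))"
    using \<kappa>_monomial[OF assms] unfolding monomials_def by blast
next
  assume "s \<in> carrier R \<and> (\<exists>e. \<kappa> s = (\<Prod>j\<in>I. \<kappa> (xs ! j) ^ e j))"
  then obtain e where "s \<in> carrier R" "\<kappa> s = (\<Prod>j\<in>I. \<kappa> (xs ! j) ^ e j)" by blast
  then have "s = (\<Otimes>j\<in>I. (xs ! j) [^] e j)"
    using \<kappa>_monomial[OF assms, of e] inj_onD[OF \<kappa>_inj] by simp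
  then show "s \<in> Mon I" unfolding monomials_def by blast
qed

lemma Mon_exists: "I \<subseteq> {..<length xs} \<Longrightarrow> \<exists>s\<in>Mon I. \<kappa> s = (\<Prod>j\<in>I. \<kappa> (xs ! j) ^ e j)"
  using \<kappa>_monomial[of I e] unfolding monomials_def by blast

lemma mult_set_Mon:
  assumes "I \<subseteq> {..<length xs}"
  shows "mult_set (Mon I)"
proof -
  have "x \<otimes> y \<in> Mon I" if x: "x \<in> Mon I" and y: "y \<in> Mon I" for x y
  proof -
    obtain e where e: "x \<in> carrier R" "\<kappa> x = (\<Prod>j\<in>I. \<kappa> (xs ! j) ^ e j)"
      using x unfolding Mon_iff[OF assms] by blast
    obtain f where f: "y \<in> carrier R" "\<kappa> y = (\<Prod>j\<in>I. \<kappa> (xs ! j) ^ f j)"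
      using y unfolding Mon_iff[OF assms] by blast
    have "\<kappa> (x \<otimes> y) = (\<Prod>j\<in>I. \<kappa> (xs ! j) ^ (e j + f j))"
      by (simp add: \<kappa>_mult e f power_add prod.distrib)
    then show ?thesis using e f unfolding Mon_iff[OF assms]
      by (intro conjI m_closed exI[of _ "\<lambda>j. e j + f j"])
  qed
  moreover have "\<one> \<in> Mon I" unfolding Mon_iff[OF assms]
    by (auto simp: \<kappa>_one intro!: exI[of _ "\<lambda>_. 0"])
  ultimately show ?thesis unfolding mult_set_def using Mon_iff[OF assms] by blast
qed

lemma zero_in_Mon:
  assumes "I \<subseteq> {..<length xs}"
  shows "\<zero> \<in> Mon I \<longleftrightarrow> (\<exists>j\<in>I. xs ! j = \<zero>)"
proof -
  have fin: "finite I" using assms finite_subset by blast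
  have nz: "\<kappa> (xs ! j) = 0 \<longleftrightarrow> xs ! j = \<zero>" if "j \<in> I" for j
    using that assms xs_nth by (intro \<kappa>_eq_0) auto
  show ?thesis
  proof
    assume "\<zero> \<in> Mon I"
    then obtain e where "(\<Prod>j\<in>I. \<kappa> (xs ! j) ^ e j) = 0"
      unfolding Mon_iff[OF assms] \<kappa>_zero by force
    then show "\<exists>j\<in>I. xs ! j = \<zero>" using nz fin by auto
  next
    assume "\<exists>j\<in>I. xs ! j = \<zero>"
    then have "(\<Prod>j\<in>I. \<kappa> (xs ! j) ^ (\<lambda>_. 1) j) = 0" using nz fin by (intro prod_zero) auto
    then show "\<zero> \<in> Mon I" unfolding Mon_iff[OF assms] \<kappa>_zero by (intro conjI zero_closed exI) (rule sym)
  qed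
qed

lemma Mon_mono:
  assumes "I \<subseteq> J" "J \<subseteq> {..<length xs}"
  shows "Mon I \<subseteq> Mon J"
proof
  have I: "I \<subseteq> {..<length xs}" using assms by blast
  have fin: "finite J" using assms finite_subset by blast
  fix s assume "s \<in> Mon I"
  then obtain e where e: "s \<in> carrier R" "\<kappa> s = (\<Prod>j\<in>I. \<kappa> (xs ! j) ^ e j)"
    unfolding Mon_iff[OF I] by blast
  have "\<kappa> s = (\<Prod>j\<in>J. \<kappa> (xs ! j) ^ (if j \<in> I then e j else 0))"
    unfolding e using assms fin by (intro prod.mono_neutral_cong_left) auto
  then show "s \<in> Mon J" using e(1) unfolding Mon_iff[OF assms(2)] by (intro conjI exI) auto
qed

section \<open>Cochains as families of field elements\<close>

definition \<Phi> :: "nat \<Rightarrow> 'a cochain \<Rightarrow> nat set \<Rightarrow> 'k"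
  where "\<Phi> i c I = (if I \<in> idx i then cval (Mon I) (c I) else 0)"

lemma loc:
  assumes "I \<in> idx i"
  shows "mult_set (Mon I)"
  by (rule mult_set_Mon[OF idxD(1)[OF assms]])

lemma C_simps:
  "carrier (C i) = (\<Pi>\<^sub>E I\<in>idx i. carrier (L (Mon I)))"
  "\<zero>\<^bsub>C i\<^esub> = (\<lambda>I\<in>idx i. \<zero>\<^bsub>L (Mon I)\<^esub>)"
  "c \<oplus>\<^bsub>C i\<^esub> c' = (\<lambda>I\<in>idx i. c I \<oplus>\<^bsub>L (Mon I)\<^esub> c' I)"
  "r \<odot>\<^bsub>C i\<^esub> c = (\<lambda>I\<in>idx i. r \<odot>\<^bsub>L (Mon I)\<^esub> c I)"
  by (simp_all add: cech_module_def)

lemma C_nth: "c \<in> carrier (C i) \<Longrightarrow> I \<in> idx i \<Longrightarrow> c I \<in> carrier (L (Mon I))"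
  by (auto simp: C_simps)

lemma \<Phi>_eqI:
  assumes "c \<in> carrier (C i)" "c' \<in> carrier (C i)" "\<And>I. I \<in> idx i \<Longrightarrow> \<Phi> i c I = \<Phi> i c' I"
  shows "c = c'"
proof (rule PiE_ext)
  show "c \<in> (\<Pi>\<^sub>E I\<in>idx i. carrier (L (Mon I)))" "c' \<in> (\<Pi>\<^sub>E I\<in>idx i. carrier (L (Mon I)))"
    using assms by (simp_all add: C_simps)
  then show "c I = c' I" if "I \<in> idx i" for I
    using assms(3)[OF that] that by (intro cval_inj[OF loc[OF that]]) (auto simp: \<Phi>_def)
qed

lemma \<Phi>_smult:
  assumes "r \<in> carrier R" "c \<in> carrier (C i)"
  shows "r \<odot>\<^bsub>C i\<^esub> c \<in> carrier (C i)" "\<Phi> i (r \<odot>\<^bsub>C i\<^esub> c) I = \<kappa> r * \<Phi> i c I"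
  using assms(1) C_nth[OF assms(2)] by (auto simp: C_simps \<Phi>_def loc_smult_closed[OF loc[where i = i]] cval_smult[OF loc[where i = i]])

lemma embedded_group_C: "embedded_group (C i) (\<Phi> i)"
proof
  fix x y assume x: "x \<in> carrier (C i)" and y: "y \<in> carrier (C i)"
  show "x \<oplus>\<^bsub>C i\<^esub> y \<in> carrier (C i)" and "\<Phi> i (x \<oplus>\<^bsub>C i\<^esub> y) I = \<Phi> i x I + \<Phi> i y I" for I
    using C_nth[OF x] C_nth[OF y] by (auto simp: C_simps \<Phi>_def loc_add_closed[OF loc[where i = i]] cval_add[OF loc[where i = i]])
  show "x = y" if "\<And>I. \<Phi> i x I = \<Phi> i y I" using \<Phi>_eqI x y that by blast
  show "\<exists>w\<in>carrier (C i). \<forall>I. \<Phi> i w I = - \<Phi> i x I" using x by auto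
qed (auto simp: C_simps \<Phi>_def loc_zero[OF loc[where i = i]] cval_zero[OF loc[where i = i]])

sublocale CG: embedded_group "C i" "\<Phi> i" for i
  by (rule embedded_group_C)

sublocale CA: abelian_group "C i" for i
  by (rule CG.abelian_group)

lemma C_add_self: "x \<in> carrier (C i) \<Longrightarrow> x \<oplus>\<^bsub>C i\<^esub> x = \<zero>\<^bsub>C i\<^esub>"
  by (rule CG.eqI[where i = i]) (simp_all add: CG.\<Phi>_add CG.\<Phi>_zero)

lemma C_uminus: "x \<in> carrier (C i) \<Longrightarrow> \<ominus>\<^bsub>C i\<^esub> x = x"
  by (simp add: C_add_self CA.minus_equality)

abbreviation "\<delta> \<equiv> cech_diff R xs"

text \<open>The signs of the Cech differential have value 1 in characteristic two. When
  \<open>Mon J\<close> contains zero, the target is the zero ring and the sum is lost.\<close>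

lemma diff_simps:
  assumes c: "c \<in> carrier (C i)"
  shows "\<delta> i c \<in> carrier (C (Suc i))"
    "\<Phi> (Suc i) (\<delta> i c) J = (if J \<in> idx (Suc i) \<and> \<zero> \<notin> Mon J then \<Sum>j\<in>J. \<Phi> i c (J - {j}) else 0)"
proof -
  have 1: "(\<Oplus>\<^bsub>L (Mon J)\<^esub>j\<in>J. ((\<ominus> \<one>) [^] card {k \<in> J. k < j}) \<odot>\<^bsub>L (Mon J)\<^esub> loc_map R (Mon J) (c (J - {j})))
      \<in> carrier (L (Mon J)) \<and>
    cval (Mon J) (\<Oplus>\<^bsub>L (Mon J)\<^esub>j\<in>J. ((\<ominus> \<one>) [^] card {k \<in> J. k < j}) \<odot>\<^bsub>L (Mon J)\<^esub> loc_map R (Mon J) (c (J - {j})))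
      = (if \<zero> \<in> Mon J then 0 else \<Sum>j\<in>J. \<Phi> i c (J - {j}))" (is "finsum _ ?f _ \<in> _ \<and> _")
    if J: "J \<in> idx (Suc i)" for J
  proof -
    interpret E: embedded_group "L (Mon J)" "\<lambda>U (_::unit). cval (Mon J) U"
      by (rule localization_group[OF loc[OF J]])
    interpret A: abelian_group "L (Mon J)" by (rule E.abelian_group)
    have I: "J - {j} \<in> idx i" if "j \<in> J" for j
      using J that by (auto simp: cech_index_def card_Diff_singleton_if)
    have cI: "c (J - {j}) \<in> carrier (L (Mon (J - {j})))" if "j \<in> J" for j
      using c I[OF that] by (auto simp: C_simps)
    have "Mon (J - {j}) \<subseteq> Mon J" for j using idxD(1)[OF J] by (intro Mon_mono) auto
    note m = loc_map_simps[OF loc[OF I] loc[OF J] this cI]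
    have s: "(\<ominus> \<one>) [^] (k::nat) \<in> carrier R" "\<kappa> ((\<ominus> \<one>) [^] (k::nat)) = 1" for k
      by (simp_all add: \<kappa>_pow \<kappa>_uminus \<kappa>_one)
    have f: "?f j \<in> carrier (L (Mon J))" "cval (Mon J) (?f j) = (if \<zero> \<in> Mon J then 0 else \<Phi> i c (J - {j}))"
      if "j \<in> J" for j
      using that by (simp_all add: loc_smult_closed[OF loc[OF J]] cval_smult[OF loc[OF J]] m s \<Phi>_def I)
    have "finsum (L (Mon J)) ?f J \<in> carrier (L (Mon J))" using f by (intro A.finsum_closed) auto
    moreover have "cval (Mon J) (finsum (L (Mon J)) ?f J) = (\<Sum>j\<in>J. cval (Mon J) (?f j))"
      using f by (intro E.\<Phi>_finsum) auto
    ultimately show ?thesis using f by simp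
  qed
  show "\<delta> i c \<in> carrier (C (Suc i))" using 1 by (auto simp: cech_diff_def C_simps)
  show "\<Phi> (Suc i) (\<delta> i c) J = (if J \<in> idx (Suc i) \<and> \<zero> \<notin> Mon J then \<Sum>j\<in>J. \<Phi> i c (J - {j}) else 0)"
    using 1[of J] by (auto simp: cech_diff_def \<Phi>_def)
qed

abbreviation "Fr \<equiv> cech_frobenius R 2 xs"

lemma frobenius_simps:
  assumes "c \<in> carrier (C i)"
  shows "Fr i c \<in> carrier (C i)" "\<Phi> i (Fr i c) I = (\<Phi> i c I)\<^sup>2"
  using C_nth[OF assms]
  by (auto simp: C_simps \<Phi>_def cech_frobenius_def loc_frobenius_simps[OF loc[where i = i]])

lemma diff_hom:
  assumes c: "c \<in> carrier (C i)"
  shows "c' \<in> carrier (C i) \<Longrightarrow> \<delta> i (c \<oplus>\<^bsub>C i\<^esub> c') = \<delta> i c \<oplus>\<^bsub>C (Suc i)\<^esub> \<delta> i c'"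
    "r \<in> carrier R \<Longrightarrow> \<delta> i (r \<odot>\<^bsub>C i\<^esub> c) = r \<odot>\<^bsub>C (Suc i)\<^esub> \<delta> i c"
    "\<delta> i (Fr i c) = Fr (Suc i) (\<delta> i c)"
proof -
  show "\<delta> i (c \<oplus>\<^bsub>C i\<^esub> c') = \<delta> i c \<oplus>\<^bsub>C (Suc i)\<^esub> \<delta> i c'" if "c' \<in> carrier (C i)"
    using c that by (intro CG.eqI[where i = "Suc i"]) (simp_all add: diff_simps CG.\<Phi>_add sum.distrib)
  show "\<delta> i (r \<odot>\<^bsub>C i\<^esub> c) = r \<odot>\<^bsub>C (Suc i)\<^esub> \<delta> i c" if "r \<in> carrier R"
    using c that by (intro CG.eqI[where i = "Suc i"]) (simp_all add: diff_simps \<Phi>_smult sum_distrib_left)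
  show "\<delta> i (Fr i c) = Fr (Suc i) (\<delta> i c)"
    using c
    by (intro CG.eqI[where i = "Suc i"]) (simp_all add: diff_simps frobenius_simps power_sum_char_two[where m = 1, simplified])
qed

lemma diff_zero: "\<delta> i \<zero>\<^bsub>C i\<^esub> = \<zero>\<^bsub>C (Suc i)\<^esub>"
  by (intro CG.eqI[where i = "Suc i"]) (simp_all add: diff_simps CG.\<Phi>_zero)

section \<open>Cocycles, coboundaries and cohomology classes\<close>

abbreviation "Z \<equiv> cocycles R xs"

lemma Z_iff: "z \<in> Z i \<longleftrightarrow> z \<in> carrier (C i) \<and> \<delta> i z = \<zero>\<^bsub>C (Suc i)\<^esub>"
  by (simp add: cocycles_def a_kernel_def kernel_def)

lemma Z_closed:
  "\<zero>\<^bsub>C i\<^esub> \<in> Z i"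
  "z \<in> Z i \<Longrightarrow> w \<in> Z i \<Longrightarrow> z \<oplus>\<^bsub>C i\<^esub> w \<in> Z i"
  "z \<in> Z i \<Longrightarrow> r \<in> carrier R \<Longrightarrow> r \<odot>\<^bsub>C i\<^esub> z \<in> Z i"
  "z \<in> Z i \<Longrightarrow> Fr i z \<in> Z i"
proof -
  have "r \<odot>\<^bsub>C i\<^esub> \<zero>\<^bsub>C i\<^esub> = \<zero>\<^bsub>C i\<^esub>" if "r \<in> carrier R" for r i
    using that by (intro CG.eqI[where i = i]) (simp_all add: \<Phi>_smult CG.\<Phi>_zero)
  moreover have "Fr i \<zero>\<^bsub>C i\<^esub> = \<zero>\<^bsub>C i\<^esub>" for i
    by (intro CG.eqI[where i = i]) (simp_all add: frobenius_simps CG.\<Phi>_zero)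
  ultimately show "\<zero>\<^bsub>C i\<^esub> \<in> Z i"
    "z \<in> Z i \<Longrightarrow> w \<in> Z i \<Longrightarrow> z \<oplus>\<^bsub>C i\<^esub> w \<in> Z i"
    "z \<in> Z i \<Longrightarrow> r \<in> carrier R \<Longrightarrow> r \<odot>\<^bsub>C i\<^esub> z \<in> Z i"
    "z \<in> Z i \<Longrightarrow> Fr i z \<in> Z i"
    by (simp_all add: Z_iff diff_hom diff_zero \<Phi>_smult frobenius_simps)
qed

lemma Z_finsum: "(\<And>j. j \<in> A \<Longrightarrow> z j \<in> Z i) \<Longrightarrow> finsum (C i) z A \<in> Z i"
proof (induction A rule: infinite_finite_induct)
  case (insert a A)
  then have "finsum (C i) z (insert a A) = z a \<oplus>\<^bsub>C i\<^esub> finsum (C i) z A"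
    by (intro CA.finsum_insert) (auto simp: Z_iff)
  then show ?case using insert by (simp add: Z_closed)
qed (simp_all add: Z_closed CA.finsum_infinite)

abbreviation "B \<equiv> coboundaries R xs"

lemma B_Suc: "B (Suc i) = \<delta> i ` carrier (C i)"
  by (simp add: coboundaries_def)

lemma B_subgroup: "abelian_subgroup (B (Suc i)) (C (Suc i))"
proof (intro abelian_subgroupI3 additive_subgroup.intro subgroup.intro CA.abelian_group_axioms)
  show "B (Suc i) \<subseteq> carrier (add_monoid (C (Suc i)))" by (auto simp: B_Suc diff_simps)
  show "\<one>\<^bsub>add_monoid (C (Suc i))\<^esub> \<in> B (Suc i)"
    unfolding B_Suc using imageI[OF CA.zero_closed[of i], of "\<delta> i"] by (simp add: diff_zero)
  fix x y assume "x \<in> B (Suc i)" "y \<in> B (Suc i)"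
  then show "x \<otimes>\<^bsub>add_monoid (C (Suc i))\<^esub> y \<in> B (Suc i)"
    unfolding B_Suc by (auto simp flip: diff_hom)
next
  fix x assume x: "x \<in> B (Suc i)"
  then have "\<ominus>\<^bsub>C (Suc i)\<^esub> x = x" by (intro C_uminus) (auto simp: B_Suc diff_simps)
  then show "inv\<^bsub>add_monoid (C (Suc i))\<^esub> x \<in> B (Suc i)" using x by (simp add: a_inv_def)
qed

lemma B_carrier: "b \<in> B (Suc i) \<Longrightarrow> b \<in> carrier (C (Suc i))"
  by (auto simp: B_Suc diff_simps)

lemma B_closed:
  "b \<in> B (Suc i) \<Longrightarrow> r \<in> carrier R \<Longrightarrow> r \<odot>\<^bsub>C (Suc i)\<^esub> b \<in> B (Suc i)"
  "b \<in> B (Suc i) \<Longrightarrow> Fr (Suc i) b \<in> B (Suc i)"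
  unfolding B_Suc using \<Phi>_smult(1) frobenius_simps(1) by (auto simp flip: diff_hom)

abbreviation coset :: "nat \<Rightarrow> 'a cochain \<Rightarrow> 'a cochain set"
  where "coset i z \<equiv> a_r_coset (C i) (B i) z"

abbreviation "H \<equiv> local_cohomology R xs"

lemma coset_iff: "w \<in> coset i z \<longleftrightarrow> (\<exists>b\<in>B i. w = b \<oplus>\<^bsub>C i\<^esub> z)"
  by (auto simp: a_r_coset_def')

lemma coset_eqI:
  assumes "w \<in> coset (Suc i) z" "z \<in> carrier (C (Suc i))"
  shows "coset (Suc i) w = coset (Suc i) z"
  using abelian_subgroup.a_repr_independence'[OF B_subgroup assms] by simp

lemma coset_eqD:
  assumes "coset (Suc i) w = coset (Suc i) z" "w \<in> carrier (C (Suc i))"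
  shows "\<exists>y\<in>carrier (C i). w = \<delta> i y \<oplus>\<^bsub>C (Suc i)\<^esub> z"
proof -
  have "w \<in> coset (Suc i) w" by (rule abelian_subgroup.a_rcos_self[OF B_subgroup assms(2)])
  then obtain b where "b \<in> B (Suc i)" "w = b \<oplus>\<^bsub>C (Suc i)\<^esub> z"
    using assms(1) by (auto simp only: coset_iff)
  then show ?thesis by (auto simp: B_Suc)
qed

lemma H_carrier: "carrier (H i) = coset i ` Z i"
  by (simp add: local_cohomology_def subquotient_def)

lemma H_zero: "\<zero>\<^bsub>H (Suc i)\<^esub> = coset (Suc i) \<zero>\<^bsub>C (Suc i)\<^esub>"
proof -
  have "\<zero>\<^bsub>C (Suc i)\<^esub> \<in> B (Suc i)"
    using B_subgroup additive_subgroup.zero_closed abelian_subgroup.axioms(1) by blast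
  then have "coset (Suc i) \<zero>\<^bsub>C (Suc i)\<^esub> = B (Suc i)"
    by (rule abelian_subgroup.a_rcos_const[OF B_subgroup])
  then show ?thesis by (simp add: local_cohomology_def subquotient_def)
qed

lemma H_add:
  assumes "z \<in> carrier (C (Suc i))" "w \<in> carrier (C (Suc i))"
  shows "coset (Suc i) z \<oplus>\<^bsub>H (Suc i)\<^esub> coset (Suc i) w = coset (Suc i) (z \<oplus>\<^bsub>C (Suc i)\<^esub> w)"
  using abelian_subgroup.a_rcos_sum[OF B_subgroup assms]
  by (simp add: local_cohomology_def subquotient_def)

text \<open>Evaluates an operation given as a union over all representatives, once it is known to
  respect cosets.\<close>

lemma coset_UN:
  assumes z: "z \<in> carrier (C (Suc i))"
    and f: "\<And>b. b \<in> B (Suc i) \<Longrightarrow> f (b \<oplus>\<^bsub>C (Suc i)\<^esub> z) \<in> coset (Suc i) (f z)" "f z \<in> carrier (C (Suc i))"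
  shows "(\<Union>w\<in>coset (Suc i) z. coset (Suc i) (f w)) = coset (Suc i) (f z)"
proof (rule UN_constant)
  show "z \<in> coset (Suc i) z" by (rule abelian_subgroup.a_rcos_self[OF B_subgroup z])
  fix w assume "w \<in> coset (Suc i) z"
  then show "coset (Suc i) (f w) = coset (Suc i) (f z)"
    using f by (auto simp: coset_iff intro!: coset_eqI)
qed

lemma H_smult:
  assumes z: "z \<in> carrier (C (Suc i))" and r: "r \<in> carrier R"
  shows "r \<odot>\<^bsub>H (Suc i)\<^esub> coset (Suc i) z = coset (Suc i) (r \<odot>\<^bsub>C (Suc i)\<^esub> z)"
proof -
  have "r \<odot>\<^bsub>C (Suc i)\<^esub> (b \<oplus>\<^bsub>C (Suc i)\<^esub> z) = r \<odot>\<^bsub>C (Suc i)\<^esub> b \<oplus>\<^bsub>C (Suc i)\<^esub> r \<odot>\<^bsub>C (Suc i)\<^esub> z"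
    if "b \<in> B (Suc i)" for b
    using z r B_carrier[OF that] by (intro CG.eqI[where i = "Suc i"]) (simp_all add: \<Phi>_smult CG.\<Phi>_add distrib_left)
  then have "(\<Union>w\<in>coset (Suc i) z. coset (Suc i) (r \<odot>\<^bsub>C (Suc i)\<^esub> w)) = coset (Suc i) (r \<odot>\<^bsub>C (Suc i)\<^esub> z)"
    using z r B_closed by (intro coset_UN) (auto simp: coset_iff \<Phi>_smult)
  then show ?thesis by (simp add: local_cohomology_def subquotient_def)
qed

abbreviation "FrH \<equiv> local_cohomology_frobenius R 2 xs"

lemma H_frobenius:
  assumes z: "z \<in> carrier (C (Suc i))"
  shows "FrH (Suc i) (coset (Suc i) z) = coset (Suc i) (Fr (Suc i) z)"
proof -
  have "Fr (Suc i) (b \<oplus>\<^bsub>C (Suc i)\<^esub> z) = Fr (Suc i) b \<oplus>\<^bsub>C (Suc i)\<^esub> Fr (Suc i) z"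
    if "b \<in> B (Suc i)" for b
    using z B_carrier[OF that]
    by (intro CG.eqI[where i = "Suc i"]) (simp_all add: frobenius_simps CG.\<Phi>_add square_add_char_two)
  then have "(\<Union>w\<in>coset (Suc i) z. coset (Suc i) (Fr (Suc i) w)) = coset (Suc i) (Fr (Suc i) z)"
    using z B_closed by (intro coset_UN) (auto simp: coset_iff frobenius_simps)
  then show ?thesis by (simp add: local_cohomology_frobenius_def)
qed

lemma H_cases:
  assumes "x \<in> carrier (H i)"
  obtains z where "z \<in> Z i" "z \<in> carrier (C i)" "x = coset i z"
  using assms by (auto simp: H_carrier Z_iff)

lemma H_abelian_monoid: "abelian_monoid (H (Suc i))"
proof (rule abelian_monoidI)
  have closed: "coset (Suc i) z \<in> carrier (H (Suc i))" if "z \<in> Z (Suc i)" for z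
    using that by (simp add: H_carrier)
  show "\<zero>\<^bsub>H (Suc i)\<^esub> \<in> carrier (H (Suc i))" unfolding H_zero by (intro closed Z_closed)
  fix x y assume "x \<in> carrier (H (Suc i))" "y \<in> carrier (H (Suc i))"
  then obtain z w where z: "z \<in> Z (Suc i)" "z \<in> carrier (C (Suc i))" "x = coset (Suc i) z"
    and w: "w \<in> Z (Suc i)" "w \<in> carrier (C (Suc i))" "y = coset (Suc i) w"
    by (metis H_cases)
  show "x \<oplus>\<^bsub>H (Suc i)\<^esub> y \<in> carrier (H (Suc i))"
    using z w by (simp only: H_add) (intro closed Z_closed)
  show "\<zero>\<^bsub>H (Suc i)\<^esub> \<oplus>\<^bsub>H (Suc i)\<^esub> x = x"
    unfolding H_zero z(3) using z(2) by (subst H_add) simp_all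
  show "x \<oplus>\<^bsub>H (Suc i)\<^esub> y = y \<oplus>\<^bsub>H (Suc i)\<^esub> x"
    unfolding z(3) w(3) using z w by (simp only: H_add CA.a_comm)
  fix u assume "u \<in> carrier (H (Suc i))"
  then obtain t where t: "t \<in> carrier (C (Suc i))" "u = coset (Suc i) t" by (metis H_cases)
  show "(x \<oplus>\<^bsub>H (Suc i)\<^esub> y) \<oplus>\<^bsub>H (Suc i)\<^esub> u = x \<oplus>\<^bsub>H (Suc i)\<^esub> (y \<oplus>\<^bsub>H (Suc i)\<^esub> u)"
    unfolding z(3) w(3) t(2) using z w t by (simp only: H_add CA.a_closed CA.a_assoc)
qed

lemma H_finsum:
  assumes "\<And>j. j \<in> A \<Longrightarrow> z j \<in> Z (Suc i)" "\<And>j. j \<in> A \<Longrightarrow> v j = coset (Suc i) (z j)"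
  shows "finsum (H (Suc i)) v A = coset (Suc i) (finsum (C (Suc i)) z A)"
proof -
  interpret HM: abelian_monoid "H (Suc i)" by (rule H_abelian_monoid)
  show ?thesis using assms
  proof (induction A rule: infinite_finite_induct)
    case (insert a A)
    have zA: "finsum (C (Suc i)) z A \<in> carrier (C (Suc i))" using insert by (auto simp: Z_iff)
    have "finsum (H (Suc i)) v (insert a A) = v a \<oplus>\<^bsub>H (Suc i)\<^esub> finsum (H (Suc i)) v A"
      using insert by (intro HM.finsum_insert) (auto simp: H_carrier)
    also have "\<dots> = coset (Suc i) (z a \<oplus>\<^bsub>C (Suc i)\<^esub> finsum (C (Suc i)) z A)"
      using insert zA by (simp add: H_add Z_iff)
    also have "z a \<oplus>\<^bsub>C (Suc i)\<^esub> finsum (C (Suc i)) z A = finsum (C (Suc i)) z (insert a A)"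
      using insert by (intro CA.finsum_insert[symmetric]) (auto simp: Z_iff)
    finally show ?case .
  qed (simp_all add: H_zero HM.finsum_infinite CA.finsum_infinite)
qed

end


section \<open>Ring-theoretic properties\<close>

text \<open>Split off the constant term, \<open>f = f_0 + x g\<close>; then
  \<open>f^2 = f_0^2 + x^2 g^2\<close>.\<close>

lemma fps_square_nth:
  fixes f :: "'a::char_two fps"
  shows "(f\<^sup>2) $ n = (if even n then (f $ (n div 2))\<^sup>2 else 0)"
proof (induction n arbitrary: f rule: less_induct)
  case (less n)
  have "f = fps_const (f $ 0) + fps_X * fps_shift 1 f" (is "_ = _ + fps_X * ?g")
    by (simp add: fps_eq_iff)
  then have "f\<^sup>2 = fps_const ((f $ 0)\<^sup>2) + fps_X\<^sup>2 * ?g\<^sup>2"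
    by (metis square_add_char_two power_mult_distrib fps_const_power)
  then have sq: "(f\<^sup>2) $ n = (if n = 0 then (f $ 0)\<^sup>2 else 0) + (if n < 2 then 0 else (?g\<^sup>2) $ (n - 2))"
    by (simp add: fps_X_power_mult_nth)
  show ?case
  proof (cases "n < 2")
    case True
    then consider "n = 0" | "n = 1" by linarith
    then show ?thesis using sq by cases auto
  next
    case False
    then have "(n - 2) div 2 + 1 = n div 2" by presburger
    then show ?thesis using sq False less[of "n - 2" ?g] by simp
  qed
qed

text \<open>Halve all exponents; coefficients in \<open>F_2\<close> are their own squares.\<close>

lemma F2_series_square:
  assumes "f \<in> F2_series 4"
  shows "\<exists>h\<in>F2_series 2. f = h\<^sup>2"
proof
  let ?h = "Abs_fps (\<lambda>i. Abs_fps (\<lambda>j. Abs_fps (\<lambda>k. f $ (2 * i) $ (2 * j) $ (2 * k)))) :: pow"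
  have f: "f $ i $ j $ k \<in> {0, 1}" "\<not> (4 dvd i \<and> 4 dvd j \<and> 4 dvd k) \<Longrightarrow> f $ i $ j $ k = 0" for i j k
    using assms unfolding F2_series_nth by blast+
  have "4 dvd 2 * i \<longleftrightarrow> even i" for i :: nat by presburger
  then show "?h \<in> F2_series 2" unfolding F2_series_nth using f by auto
  have sq: "x\<^sup>2 = x" if "x \<in> {0, 1}" for x :: gf4 using that by auto
  have "(?h\<^sup>2) $ i $ j $ k = f $ i $ j $ k" for i j k
  proof (cases "even i \<and> even j \<and> even k")
    case False
    moreover from this have "f $ i $ j $ k = 0" by (intro f(2)) presburger
    ultimately show ?thesis by (auto simp: fps_square_nth)
  next
    case True
    then show ?thesis using sq[OF f(1)] by (simp add: fps_square_nth)
  qed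
  then show "f = ?h\<^sup>2" by (simp add: fps_eq_iff)
qed

lemma F2_series_mono: "F2_series 4 \<subseteq> F2_series 2"
  unfolding F2_series_nth subset_iff by (metis (no_types, lifting) dvd_trans even_numeral numeral_Bit0_eq_double dvd_triv_left)

text \<open>An isomorphic copy of \<open>R0\<close> over an arbitrary element type; the copy used in
  the end consists of sets of natural numbers.\<close>

locale R0_model = cring R for R (structure) +
  fixes \<rho> :: "'a \<Rightarrow> pow"
  assumes \<rho>_one: "\<rho> \<one> = 1"
    and \<rho>_add: "x \<in> carrier R \<Longrightarrow> y \<in> carrier R \<Longrightarrow> \<rho> (x \<oplus> y) = \<rho> x + \<rho> y"
    and \<rho>_mult: "x \<in> carrier R \<Longrightarrow> y \<in> carrier R \<Longrightarrow> \<rho> (x \<otimes> y) = \<rho> x * \<rho> y"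
    and \<rho>_inj: "inj_on \<rho> (carrier R)"
    and \<rho>_image: "\<rho> ` carrier R = R0"
begin

lemma \<rho>_zero: "\<rho> \<zero> = 0"
  using \<rho>_add[of \<zero> \<zero>] by simp

lemma \<rho>_R0: "x \<in> carrier R \<Longrightarrow> \<rho> x \<in> R0"
  using \<rho>_image by blast

lemma \<rho>_eq: "x \<in> carrier R \<Longrightarrow> y \<in> carrier R \<Longrightarrow> \<rho> x = \<rho> y \<longleftrightarrow> x = y"
  by (rule inj_on_eq_iff[OF \<rho>_inj])

lemma \<rho>_surj: "f \<in> R0 \<Longrightarrow> \<exists>x\<in>carrier R. \<rho> x = f"
  using \<rho>_image by (metis imageE)

lemma \<rho>_uminus: "x \<in> carrier R \<Longrightarrow> \<rho> (\<ominus> x) = \<rho> x"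
  using \<rho>_add[of "\<ominus> x" x] by (simp add: l_neg \<rho>_zero add_eq_0_char_two)

lemma \<rho>_pow: "x \<in> carrier R \<Longrightarrow> \<rho> (x [^] (n::nat)) = \<rho> x ^ n"
  by (induction n) (simp_all add: \<rho>_one \<rho>_mult)

lemma \<rho>_finsum: "f \<in> A \<rightarrow> carrier R \<Longrightarrow> \<rho> (finsum R f A) = (\<Sum>j\<in>A. \<rho> (f j))"
proof (induction A rule: infinite_finite_induct)
  case (insert a A)
  then show ?case by (subst finsum_insert) (auto simp: \<rho>_add)
qed (simp_all add: \<rho>_zero finsum_infinite)

section \<open>Domain, Noetherian, \<open>F\<close>-finite and local\<close>

lemma is_domain: "domain R"
proof (intro domain.intro domain_axioms.intro is_cring)
  show "\<one> \<noteq> \<zero>" using \<rho>_one \<rho>_zero by (metis zero_neq_one)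
  fix a b assume ab: "a \<otimes> b = \<zero>" "a \<in> carrier R" "b \<in> carrier R"
  then have "\<rho> a * \<rho> b = 0" by (metis \<rho>_mult \<rho>_zero)
  then show "a = \<zero> \<or> b = \<zero>" using ab \<rho>_eq[of _ \<zero>] by (auto simp: \<rho>_zero)
qed

lemma ideal_submod:
  assumes "ideal I R"
  shows "submod R0 (\<rho> ` I)"
proof -
  interpret ideal I R by fact
  have "\<rho> x + \<rho> y \<in> \<rho> ` I" if "x \<in> I" "y \<in> I" for x y
    using that by (intro image_eqI[of _ _ "x \<oplus> y"]) (auto simp: \<rho>_add a_closed)
  moreover have "r * \<rho> x \<in> \<rho> ` I" if x: "x \<in> I" and r: "r \<in> R0" for x r
  proof -
    obtain a where "a \<in> carrier R" "\<rho> a = r" using \<rho>_surj[OF r] by blast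
    then show ?thesis using x
      by (intro image_eqI[of _ _ "a \<otimes> x"]) (auto simp: \<rho>_mult I_l_closed)
  qed
  moreover have "0 \<in> \<rho> ` I" using additive_subgroup.zero_closed[OF is_additive_subgroup] \<rho>_zero
    by (metis image_eqI)
  ultimately show ?thesis unfolding submod_def by blast
qed

lemma F2_series_4_R0: "F2_series 4 \<subseteq> R0"
  using F2_series_mono F2_series_subset_R0 by blast

lemma is_noetherian: "noetherian_ring R"
proof (intro noetherian_ring.intro noetherian_ring_axioms.intro ring_axioms)
  fix I assume I: "ideal I R"
  have IR: "I \<subseteq> carrier R" using ideal.Icarr[OF I] by blast
  have "submod (F2_series 4) (\<rho> ` I)"
    using ideal_submod[OF I] F2_series_4_R0 unfolding submod_def by blast
  then have "\<exists>G\<subseteq>\<rho> ` I. finite G \<and> \<rho> ` I \<subseteq> lin_span (F2_series 4) G"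
    using noeth_F2_series[of 4] unfolding noeth_def by simp
  then obtain G where G: "G \<subseteq> \<rho> ` I" "finite G" "\<rho> ` I \<subseteq> lin_span (F2_series 4) G" by blast
  obtain A where A: "A \<subseteq> I" "finite A" "\<rho> ` A = G"
    using finite_subset_image[OF G(2,1)] by blast
  have "Idl A \<subseteq> I" by (rule genideal_minimal[OF I A(1)])
  moreover have "I \<subseteq> Idl A"
  proof
    fix x assume x: "x \<in> I"
    have id: "ideal (Idl A) R" using A IR by (intro genideal_ideal) auto
    have "A \<subseteq> Idl A" using A IR by (intro genideal_self) auto
    then have "G \<subseteq> \<rho> ` (Idl A)" using A(3) by blast
    moreover have "\<rho> x \<in> lin_span (F2_series 4) G" using x G(3) by blast
    then obtain c where c: "\<And>g. g \<in> G \<Longrightarrow> c g \<in> F2_series 4" "\<rho> x = (\<Sum>g\<in>G. c g * g)"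
      by (auto simp: lin_span_def)
    ultimately have "\<rho> x \<in> \<rho> ` (Idl A)"
      unfolding c(2) using F2_series_4_R0 c(1) by (intro submodD[OF ideal_submod[OF id]]) auto
    then obtain y where "y \<in> Idl A" "\<rho> x = \<rho> y" by blast
    then show "x \<in> Idl A" using x IR ideal.Icarr[OF id] \<rho>_eq by blast
  qed
  ultimately show "\<exists>A\<subseteq>carrier R. finite A \<and> I = Idl A" using A IR by blast
qed

text \<open>Module generators over \<open>F2_series 4\<close> work, since each coefficient there is
  the square of an element of \<open>R0\<close>.\<close>

lemma is_F_finite: "F_finite R 2"
proof -
  have "submod (F2_series 4) R0"
    using F2_series_4_R0 R0_closed unfolding submod_def by blast
  then have "\<exists>G\<subseteq>R0. finite G \<and> R0 \<subseteq> lin_span (F2_series 4) G"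
    using noeth_F2_series[of 4] unfolding noeth_def by simp
  then obtain G where G: "G \<subseteq> \<rho> ` carrier R" "finite G" "R0 \<subseteq> lin_span (F2_series 4) G"
    unfolding \<rho>_image by blast
  obtain A where A: "A \<subseteq> carrier R" "finite A" "\<rho> ` A = G"
    using finite_subset_image[OF G(2,1)] by blast
  have "\<exists>c\<in>A \<rightarrow> carrier R. r = (\<Oplus>a\<in>A. (c a [^] (2::nat)) \<otimes> a)" if r: "r \<in> carrier R" for r
  proof -
    have "\<rho> r \<in> lin_span (F2_series 4) G" using G(3) \<rho>_R0[OF r] by blast
    then obtain c where c: "\<And>g. g \<in> G \<Longrightarrow> c g \<in> F2_series 4" "\<rho> r = (\<Sum>g\<in>G. c g * g)"
      by (auto simp: lin_span_def)
    have "\<exists>b\<in>carrier R. c (\<rho> a) = (\<rho> b)\<^sup>2" if "a \<in> A" for a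
    proof -
      obtain h where "h \<in> F2_series 2" "c (\<rho> a) = h\<^sup>2" using F2_series_square c(1) A(3) \<open>a \<in> A\<close> by blast
      then show ?thesis using F2_series_subset_R0 \<rho>_surj by blast
    qed
    then obtain b where b: "\<And>a. a \<in> A \<Longrightarrow> b a \<in> carrier R" "\<And>a. a \<in> A \<Longrightarrow> c (\<rho> a) = (\<rho> (b a))\<^sup>2"
      by metis
    have inj: "inj_on \<rho> A" using \<rho>_inj A(1) by (rule inj_on_subset)
    have f: "(\<lambda>a. (b a [^] (2::nat)) \<otimes> a) \<in> A \<rightarrow> carrier R" using b A by auto
    have "\<rho> (\<Oplus>a\<in>A. (b a [^] (2::nat)) \<otimes> a) = (\<Sum>a\<in>A. \<rho> ((b a [^] (2::nat)) \<otimes> a))"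
      by (rule \<rho>_finsum[OF f])
    also have "\<dots> = (\<Sum>a\<in>A. c (\<rho> a) * \<rho> a)"
      using b A(1) by (intro sum.cong) (auto simp: \<rho>_mult \<rho>_pow subset_iff)
    also have "\<dots> = \<rho> r" unfolding c(2) A(3)[symmetric] by (simp add: sum.reindex[OF inj])
    finally have "r = (\<Oplus>a\<in>A. (b a [^] (2::nat)) \<otimes> a)"
      using r finsum_closed[OF f] \<rho>_eq by metis
    then show ?thesis using b(1) by blast
  qed
  then show ?thesis unfolding F_finite_def using A by blast
qed

lemma is_char_2: "has_characteristic R 2"
proof -
  have n: "[n] \<cdot> \<one> \<in> carrier R \<and> \<rho> ([n] \<cdot> \<one>) = of_nat n" for n :: nat
  proof (induction n)
    case 0
    then show ?case by (simp add: \<rho>_zero)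
  next
    case (Suc n)
    then show ?case by (simp add: \<rho>_add \<rho>_one add.nat_pow_Suc)
  qed
  have "[n] \<cdot> \<one> = \<zero> \<longleftrightarrow> 2 dvd n" for n :: nat
    using n[of n] \<rho>_eq[of "[n] \<cdot> \<one>" \<zero>] by (auto simp: \<rho>_zero of_nat_char_two split: if_splits)
  then show ?thesis unfolding has_characteristic_def by blast
qed

definition max_ideal :: "'a set" where "max_ideal = {x \<in> carrier R. ev0 (\<rho> x) = 0}"

lemma max_ideal_is_ideal: "ideal max_ideal R"
proof (intro idealI ring_axioms subgroup.intro)
  fix x assume "x \<in> max_ideal"
  then show "inv\<^bsub>add_monoid R\<^esub> x \<in> max_ideal"
    by (auto simp: max_ideal_def \<rho>_uminus simp flip: a_inv_def)
qed (auto simp: max_ideal_def \<rho>_add \<rho>_mult \<rho>_zero ev0_simps)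

lemma proper_ideal:
  assumes I: "ideal I R" and "I \<noteq> carrier R"
  shows "I \<subseteq> max_ideal"
proof
  fix x assume x: "x \<in> I"
  have xR: "x \<in> carrier R" using ideal.Icarr[OF I x] .
  show "x \<in> max_ideal"
  proof (rule ccontr)
    assume "x \<notin> max_ideal"
    then obtain g where g: "g \<in> R0" "\<rho> x * g = 1"
      using R0_inverse[OF \<rho>_R0[OF xR]] xR by (auto simp: max_ideal_def)
    obtain y where y: "y \<in> carrier R" "\<rho> y = g" using \<rho>_surj[OF g(1)] by blast
    have "x \<otimes> y = \<one>" using g y xR \<rho>_eq[of "x \<otimes> y" \<one>] by (simp add: \<rho>_mult \<rho>_one)
    then have "\<one> \<in> I" using ideal.I_r_closed[OF I x y(1)] by simp
    then show False using ideal.one_imp_carrier[OF I] assms(2) by blast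
  qed
qed

lemma max_ideal_proper: "max_ideal \<noteq> carrier R"
proof -
  have "\<one> \<notin> max_ideal" by (simp add: max_ideal_def \<rho>_one ev0_simps)
  then show ?thesis by auto
qed

lemma is_local: "local_ring R max_ideal"
  unfolding local_ring_def
proof (intro conjI allI iffI is_cring)
  fix I assume I: "maximalideal I R"
  then have "I \<subseteq> max_ideal" using proper_ideal maximalideal.I_notcarr maximalideal.axioms(1) by metis
  then show "I = max_ideal"
    using maximalideal.I_maximal[OF I max_ideal_is_ideal] max_ideal_proper ideal.Icarr[OF max_ideal_is_ideal] by blast
next
  fix I assume "I = max_ideal"
  then show "maximalideal I R"
    using max_ideal_is_ideal max_ideal_proper proper_ideal
    by (auto intro!: maximalideal.intro maximalideal_axioms.intro)
qed

end


section \<open>The second local cohomology module\<close>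

lemma spans_closed:
  "spans J X 0" "spans J X r \<Longrightarrow> spans J X s \<Longrightarrow> spans J X (r + s)" "spans J X r \<Longrightarrow> spans J X (t * r)"
proof -
  show "spans J X 0" unfolding spans_def by (intro exI[of _ "\<lambda>_. 0"]) simp
  assume r: "spans J X r"
  then obtain h where h: "r = (\<Sum>j\<in>J. h j * X j)" unfolding spans_def by blast
  show "spans J X (t * r)" unfolding spans_def
    by (intro exI[of _ "\<lambda>j. t * h j"]) (simp add: h sum_distrib_left ac_simps)
  assume "spans J X s"
  then obtain k where k: "s = (\<Sum>j\<in>J. k j * X j)" unfolding spans_def by blast
  show "spans J X (r + s)" unfolding spans_def
    by (intro exI[of _ "\<lambda>j. h j + k j"]) (simp add: h k distrib_right sum.distrib)
qed

lemma spans_member: "finite J \<Longrightarrow> j \<in> J \<Longrightarrow> spans J X (X j)"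
  unfolding spans_def
  by (intro exI[of _ "\<lambda>i. if i = j then 1 else 0"]) (simp add: if_distrib[of "\<lambda>c. c * _"] cong: if_cong)

locale R0_model_cech = R0_model R \<rho> for R (structure) and \<rho> +
  fixes xs
  assumes xs_carrier: "set xs \<subseteq> carrier R" and xs_generate: "genideal R (set xs) = max_ideal"
begin

sublocale cech_embedding R "\<lambda>x. to_fract (\<rho> x)" xs
  by unfold_locales
    (use xs_carrier \<rho>_eq in \<open>auto simp: \<rho>_one \<rho>_add \<rho>_mult inj_on_def\<close>)

text \<open>A generating list may contain zeros. Index sets meeting such an entry have the zero ring
  as localization and carry no information.\<close>

definition J :: "nat set" where "J = {j. j < length xs \<and> xs ! j \<noteq> \<zero>}"

definition X :: "nat \<Rightarrow> pow" where "X j = \<rho> (xs ! j)"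

lemma J_simps: "j \<in> J \<Longrightarrow> j < length xs" "j \<in> J \<Longrightarrow> xs ! j \<in> carrier R" "finite J"
  "j \<in> J \<Longrightarrow> X j \<noteq> 0" "j \<in> J \<Longrightarrow> X j \<in> R0"
  using xs_nth \<rho>_eq[of "xs ! j" \<zero>] \<rho>_R0 by (auto simp: J_def X_def \<rho>_zero)

text \<open>The elements of \<open>R\<close> lying in the ideal of \<open>S\<close> generated by the
  \<open>X j\<close> form an ideal of \<open>R\<close> that contains the generators.\<close>

lemma spans_max_ideal:
  assumes "f \<in> R0" "ev0 f = 0"
  shows "spans J X f"
proof -
  let ?I = "{r \<in> carrier R. spans J X (\<rho> r)}"
  have "ideal ?I R"
  proof (intro idealI ring_axioms subgroup.intro)
    fix x assume "x \<in> ?I"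
    then show "inv\<^bsub>add_monoid R\<^esub> x \<in> ?I"
      by (auto simp: \<rho>_uminus simp flip: a_inv_def)
  next
    fix a x assume "a \<in> ?I" "x \<in> carrier R"
    then show "x \<otimes> a \<in> ?I" "a \<otimes> x \<in> ?I"
      by (auto simp: \<rho>_mult spans_closed mult.commute[of "\<rho> a"])
  qed (auto simp: \<rho>_add \<rho>_zero spans_closed)
  moreover have "set xs \<subseteq> ?I"
  proof
    fix x assume "x \<in> set xs"
    then obtain j where j: "j < length xs" "x = xs ! j" by (metis in_set_conv_nth)
    have "spans J X (\<rho> x)"
    proof (cases "j \<in> J")
      case True
      then show ?thesis using spans_member[OF J_simps(3), of j X] by (simp add: j X_def)
    next
      case False
      then show ?thesis using j by (simp add: J_def \<rho>_zero spans_closed)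
    qed
    then show "x \<in> ?I" using j xs_nth by simp
  qed
  ultimately have "max_ideal \<subseteq> ?I" using genideal_minimal xs_generate by metis
  moreover obtain r where "r \<in> carrier R" "\<rho> r = f" using \<rho>_surj[OF assms(1)] by blast
  ultimately show ?thesis using assms(2) by (auto simp: max_ideal_def)
qed

sublocale cech_data J X
  by unfold_locales (auto simp: J_simps ev0_simps ev0_vars R0_square_vars intro!: spans_max_ideal)

lemma X_ev0: "j \<in> J \<Longrightarrow> ev0 (X j) = 0"
proof -
  assume "j \<in> J"
  then have "xs ! j \<in> max_ideal"
    using genideal_self[OF xs_carrier] J_simps(1)[of j] unfolding xs_generate by (auto dest: nth_mem)
  then show ?thesis by (simp add: max_ideal_def X_def)
qed

lemma Mon_nz: "I \<subseteq> J \<Longrightarrow> \<zero> \<notin> Mon I"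
  by (subst zero_in_Mon) (auto simp: J_def)

lemma pair_idx: "j \<in> J \<Longrightarrow> k \<in> J \<Longrightarrow> j \<noteq> k \<Longrightarrow> {j, k} \<in> idx (Suc (Suc 0))"
  by (auto simp: cech_index_def J_simps)

lemma triple_idx:
  "j \<in> J \<Longrightarrow> k \<in> J \<Longrightarrow> l \<in> J \<Longrightarrow> distinct [j, k, l] \<Longrightarrow> {j, k, l} \<in> idx (Suc (Suc (Suc 0)))"
  by (auto simp: cech_index_def J_simps)

lemma \<kappa>_Mon:
  assumes "I \<subseteq> J" "s \<in> Mon I"
  shows "\<exists>n. \<exists>r\<in>R0. to_fract ((\<Prod>j\<in>I. X j) ^ n) = to_fract (r * \<rho> s)"
proof -
  have I: "I \<subseteq> {..<length xs}" using assms J_simps by blast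
  obtain e where e: "s \<in> carrier R" "to_fract (\<rho> s) = (\<Prod>j\<in>I. to_fract (\<rho> (xs ! j)) ^ e j)"
    using assms(2) unfolding Mon_iff[OF I] by blast
  have fin: "finite I" using I finite_subset by blast
  have "to_fract (\<rho> s) = to_fract (\<Prod>j\<in>I. X j ^ e j)"
    unfolding e X_def using fin by induction (simp_all add: to_fract_power)
  then have s: "\<rho> s = (\<Prod>j\<in>I. X j ^ e j)" by simp
  \<comment> \<open>This bounds every exponent, so the monomial divides the \<open>n\<close>-th
    power of the product.\<close>
  define n where "n = sum e I"
  have "(\<Prod>j\<in>I. X j) ^ n = (\<Prod>j\<in>I. X j ^ (n - e j) * X j ^ e j)"
    unfolding prod_power_distrib
    using member_le_sum[of _ I e] fin by (intro prod.cong) (auto simp: n_def simp flip: power_add)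
  then have "(\<Prod>j\<in>I. X j) ^ n = (\<Prod>j\<in>I. X j ^ (n - e j)) * \<rho> s" by (simp add: s prod.distrib)
  moreover have "(\<Prod>j\<in>I. X j ^ (n - e j)) \<in> R0"
    using fin assms(1) by induction (auto intro: R0_closed J_simps)
  ultimately show ?thesis by metis
qed

lemma rloc_\<Phi>:
  assumes c: "c \<in> carrier (C i)" and I: "I \<in> idx i" "I \<subseteq> J"
  shows "rloc (\<Prod>j\<in>I. X j) (\<Phi> i c I)"
proof -
  obtain a s where as: "a \<in> carrier R" "s \<in> Mon I" "\<Phi> i c I = to_fract (\<rho> a) / to_fract (\<rho> s)"
    using cval_range(2)[OF loc[OF I(1)] Mon_nz[OF I(2)] C_nth[OF c I(1)]] I by (auto simp: \<Phi>_def)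
  have s: "s \<in> carrier R" "s \<noteq> \<zero>"
    using as(2) mult_setD(1)[OF loc[OF I(1)]] Mon_nz[OF I(2)] by auto
  obtain n r where r: "r \<in> R0" "to_fract ((\<Prod>j\<in>I. X j) ^ n) = to_fract (r * \<rho> s)"
    using \<kappa>_Mon[OF I(2) as(2)] by blast
  have "\<rho> s \<noteq> 0" using s \<rho>_eq[of s \<zero>] by (simp add: \<rho>_zero)
  then have "to_fract ((\<Prod>j\<in>I. X j) ^ n) * \<Phi> i c I = to_fract (r * \<rho> a)"
    unfolding r as(3) by simp
  moreover have "r * \<rho> a \<in> R0" using r \<rho>_R0[OF as(1)] by (intro R0_closed)
  ultimately show ?thesis unfolding rloc_def by blast
qed

text \<open>The converse passage, from field elements back to classes of fractions, needed to
  realize the nontrivial family by a cochain.\<close>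

lemma rloc_cochain:
  assumes I: "I \<in> idx i" "I \<subseteq> J" and z: "rloc (\<Prod>j\<in>I. X j) z"
  shows "\<exists>U\<in>carrier (L (Mon I)). cval (Mon I) U = z"
proof -
  obtain n r where r: "r \<in> R0" "to_fract ((\<Prod>j\<in>I. X j) ^ n) * z = to_fract r"
    using z by (auto simp: rloc_def)
  obtain a where a: "a \<in> carrier R" "\<rho> a = r" using \<rho>_surj[OF r(1)] by blast
  obtain s where s: "s \<in> Mon I" "to_fract (\<rho> s) = (\<Prod>j\<in>I. to_fract (\<rho> (xs ! j)) ^ n)"
    using Mon_exists[OF idxD(1)[OF I(1)], of "\<lambda>_. n"] by blast
  have "to_fract ((\<Prod>j\<in>I. X j) ^ n) = (\<Prod>j\<in>I. to_fract (\<rho> (xs ! j)) ^ n)"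
    using idxD(2)[OF I(1)] by induction (simp_all add: X_def power_mult_distrib to_fract_power)
  then have "to_fract (\<rho> s) * z = to_fract (\<rho> a)" using r a s by simp
  moreover have "to_fract (\<rho> s) \<noteq> 0"
    using s(1) Mon_nz[OF I(2)] mult_setD(1)[OF loc[OF I(1)]] \<kappa>_eq_0 by metis
  ultimately have "z = to_fract (\<rho> a) / to_fract (\<rho> s)" by (simp add: field_simps)
  then show ?thesis using cval_range(3)[OF loc[OF I(1)] Mon_nz[OF I(2)] a(1) s(1)] by simp
qed

text \<open>In characteristic two an alternating cochain is a symmetric family with zero diagonal,
  so no ordering of the two indices enters.\<close>

definition zz :: "'a cochain \<Rightarrow> nat \<Rightarrow> nat \<Rightarrow> pow fract"
  where "zz z j k = (if j = k then 0 else \<Phi> (Suc (Suc 0)) z {j, k})"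

lemma zz_rloc:
  assumes "z \<in> carrier (C (Suc (Suc 0)))" "j \<in> J" "k \<in> J"
  shows "rloc (X j * X k) (zz z j k)"
proof (cases "j = k")
  case True
  then show ?thesis by (auto simp: zz_def rloc_def intro: R0_closed exI[of _ 0] bexI[of _ 0])
next
  case False
  then show ?thesis
    using rloc_\<Phi>[OF assms(1) pair_idx[OF assms(2,3) False]] assms(2,3) by (simp add: zz_def)
qed

lemma diff_triple:
  assumes "z \<in> carrier (C (Suc (Suc 0)))" "j \<in> J" "k \<in> J" "l \<in> J" "distinct [j, k, l]"
  shows "\<Phi> (Suc (Suc (Suc 0))) (\<delta> (Suc (Suc 0)) z) {j, k, l} = zz z k l + zz z j l + zz z j k"
proof -
  have "{j, k, l} - {j} = {k, l}" "{j, k, l} - {k} = {j, l}" "{j, k, l} - {l} = {j, k}"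
    using assms(5) by auto
  then show ?thesis
    using assms diff_simps(2)[OF assms(1), of "{j, k, l}"] triple_idx[OF assms(2-5)] Mon_nz[of "{j, k, l}"]
    by (simp add: zz_def add.assoc)
qed

lemma zz_cocycle:
  assumes z: "z \<in> Z (Suc (Suc 0))" and "j \<in> J" "k \<in> J" "l \<in> J"
  shows "zz z j k + zz z l k = zz z j l"
proof (cases "distinct [j, k, l]")
  case True
  have "zz z k l + zz z j l + zz z j k = 0"
    using z diff_triple[OF _ assms(2-4) True, of z] by (simp add: Z_iff CG.\<Phi>_zero)
  moreover have "zz z k l = zz z l k" by (simp add: zz_def insert_commute)
  ultimately have "(zz z j k + zz z l k) + zz z j l = 0" by (simp add: ac_simps)
  then show ?thesis by (simp only: add_eq_0_char_two)
next
  case False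
  then show ?thesis by (auto simp: zz_def insert_commute)
qed

lemma zz_diff:
  assumes y: "y \<in> carrier (C (Suc 0))" and "j \<in> J" "k \<in> J"
  shows "zz (\<delta> (Suc 0) y) j k = \<Phi> (Suc 0) y {j} + \<Phi> (Suc 0) y {k}"
proof (cases "j = k")
  case False
  then have "{j, k} - {j} = {k}" "{j, k} - {k} = {j}" by auto
  then show ?thesis
    using False assms diff_simps(2)[OF y, of "{j, k}"] pair_idx[of j k] Mon_nz[of "{j, k}"]
    by (simp add: zz_def add.commute)
qed (simp add: zz_def)

lemma rloc_one_cochain:
  assumes "y \<in> carrier (C (Suc 0))" "j \<in> J"
  shows "rloc (X j) (\<Phi> (Suc 0) y {j})"
  using rloc_\<Phi>[OF assms(1), of "{j}"] assms(2) by (simp add: cech_index_def J_simps)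

section \<open>The invariant on cocycles over \<open>R\<close>\<close>

abbreviation has_invariant :: "'a cochain \<Rightarrow> gf4 \<Rightarrow> bool"
  where "has_invariant z \<equiv> invariant (zz z)"

lemma has_invariant_exists: "z \<in> Z (Suc (Suc 0)) \<Longrightarrow> \<exists>t. has_invariant z t"
  by (intro invariant_exists zz_rloc zz_cocycle) (auto simp: Z_iff)

lemma has_invariant_add:
  assumes inv: "has_invariant z t" "has_invariant w s" "has_invariant v r"
    and m: "z \<in> Z (Suc (Suc 0))" "w \<in> Z (Suc (Suc 0))" "y \<in> carrier (C (Suc 0))"
    and v: "v = \<delta> (Suc 0) y \<oplus>\<^bsub>C (Suc (Suc 0))\<^esub> (z \<oplus>\<^bsub>C (Suc (Suc 0))\<^esub> w)"
  shows "r = t + s"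
proof (rule invariant_add[OF inv rloc_one_cochain[OF m(3)]])
  fix j k assume jk: "j \<in> J" "k \<in> J"
  have "zz v j k = zz (\<delta> (Suc 0) y) j k + (zz z j k + zz w j k)"
    unfolding v zz_def using m by (simp add: CG.\<Phi>_add Z_iff diff_simps)
  then show "zz v j k = zz z j k + zz w j k + (\<Phi> (Suc 0) y {j} + \<Phi> (Suc 0) y {k})"
    by (simp add: zz_diff[OF m(3) jk] ac_simps)
qed

lemma has_invariant_zero: "has_invariant \<zero>\<^bsub>C (Suc (Suc 0))\<^esub> 0"
proof -
  have "zz \<zero>\<^bsub>C (Suc (Suc 0))\<^esub> = (\<lambda>_ _. 0)" by (auto simp: zz_def CG.\<Phi>_zero fun_eq_iff)
  then show ?thesis using invariant_0 by simp
qed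

text \<open>Additivity up to coboundaries, applied with the zero cocycle, gives independence of the
  representative.\<close>

lemma has_invariant_cong:
  assumes inv: "has_invariant z t" "has_invariant v r"
    and m: "z \<in> Z (Suc (Suc 0))" "y \<in> carrier (C (Suc 0))" "v = \<delta> (Suc 0) y \<oplus>\<^bsub>C (Suc (Suc 0))\<^esub> z"
  shows "r = t"
  using has_invariant_add[OF inv(1) has_invariant_zero inv(2) m(1) Z_closed(1) m(2)] m
  by (simp add: Z_iff)

lemma has_invariant_finsum:
  assumes "\<And>j. j \<in> A \<Longrightarrow> z j \<in> Z (Suc (Suc 0))" "\<And>j. j \<in> A \<Longrightarrow> has_invariant (z j) 0"
  shows "has_invariant (finsum (C (Suc (Suc 0))) z A) 0"
  using assms
proof (induction A rule: infinite_finite_induct)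
  case (insert a A)
  have zA: "finsum (C (Suc (Suc 0))) z A \<in> Z (Suc (Suc 0))" "finsum (C (Suc (Suc 0))) z (insert a A) \<in> Z (Suc (Suc 0))"
    using insert by (auto intro!: Z_finsum)
  have e: "finsum (C (Suc (Suc 0))) z (insert a A) = z a \<oplus>\<^bsub>C (Suc (Suc 0))\<^esub> finsum (C (Suc (Suc 0))) z A"
    using insert by (intro CA.finsum_insert) (auto simp: Z_iff)
  obtain r where r: "has_invariant (finsum (C (Suc (Suc 0))) z (insert a A)) r"
    using has_invariant_exists[OF zA(2)] by blast
  have "r = 0 + 0"
    using insert zA e r
    by (intro has_invariant_add[of "z a" 0 "finsum (C (Suc (Suc 0))) z A" 0 _ r "\<zero>\<^bsub>C (Suc 0)\<^esub>"])
      (auto simp: diff_zero Z_iff)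
  then show ?case using r by simp
qed (simp_all add: has_invariant_zero CA.finsum_infinite)

lemma zz_smult:
  assumes "z \<in> carrier (C (Suc (Suc 0)))" "r \<in> carrier R"
  shows "zz (r \<odot>\<^bsub>C (Suc (Suc 0))\<^esub> z) j k = to_fract (\<rho> r) * zz z j k"
  using assms by (simp add: zz_def \<Phi>_smult)

lemma zz_frobenius:
  "z \<in> carrier (C (Suc (Suc 0))) \<Longrightarrow> zz (Fr (Suc (Suc 0)) z) j k = (zz z j k)\<^sup>2"
  by (simp add: zz_def frobenius_simps)

lemma zz_iterated:
  assumes z: "z \<in> Z (Suc (Suc 0))" and r: "r \<in> carrier R"
  shows "((\<lambda>w. r \<odot>\<^bsub>C (Suc (Suc 0))\<^esub> w) ^^ n) z \<in> Z (Suc (Suc 0))"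
    "zz (((\<lambda>w. r \<odot>\<^bsub>C (Suc (Suc 0))\<^esub> w) ^^ n) z) j k = to_fract (\<rho> r ^ n) * zz z j k"
    "((\<lambda>U. r \<odot>\<^bsub>H (Suc (Suc 0))\<^esub> U) ^^ n) (coset (Suc (Suc 0)) z)
      = coset (Suc (Suc 0)) (((\<lambda>w. r \<odot>\<^bsub>C (Suc (Suc 0))\<^esub> w) ^^ n) z)"
    "(Fr (Suc (Suc 0)) ^^ n) z \<in> Z (Suc (Suc 0))"
    "zz ((Fr (Suc (Suc 0)) ^^ n) z) j k = zz z j k ^ (2 ^ n)"
    "(FrH (Suc (Suc 0)) ^^ n) (coset (Suc (Suc 0)) z) = coset (Suc (Suc 0)) ((Fr (Suc (Suc 0)) ^^ n) z)"
proof -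
  show 1: "((\<lambda>w. r \<odot>\<^bsub>C (Suc (Suc 0))\<^esub> w) ^^ n) z \<in> Z (Suc (Suc 0))" for n
    using z r by (induction n) (simp_all add: Z_closed)
  show "zz (((\<lambda>w. r \<odot>\<^bsub>C (Suc (Suc 0))\<^esub> w) ^^ n) z) j k = to_fract (\<rho> r ^ n) * zz z j k"
    using 1 r by (induction n) (simp_all add: zz_smult Z_iff)
  show "((\<lambda>U. r \<odot>\<^bsub>H (Suc (Suc 0))\<^esub> U) ^^ n) (coset (Suc (Suc 0)) z)
      = coset (Suc (Suc 0)) (((\<lambda>w. r \<odot>\<^bsub>C (Suc (Suc 0))\<^esub> w) ^^ n) z)"
    using 1 r by (induction n) (simp_all add: H_smult Z_iff)
  show 2: "(Fr (Suc (Suc 0)) ^^ n) z \<in> Z (Suc (Suc 0))" for n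
    using z by (induction n) (simp_all add: Z_closed)
  show "zz ((Fr (Suc (Suc 0)) ^^ n) z) j k = zz z j k ^ (2 ^ n)"
    using 2 by (induction n) (simp_all add: zz_frobenius Z_iff power_mult[symmetric] mult.commute)
  show "(FrH (Suc (Suc 0)) ^^ n) (coset (Suc (Suc 0)) z) = coset (Suc (Suc 0)) ((Fr (Suc (Suc 0)) ^^ n) z)"
    using 2 by (induction n) (simp_all add: H_frobenius Z_iff)
qed

lemma exists_invariant_1: "\<exists>z\<in>Z (Suc (Suc 0)). has_invariant z 1"
proof -
  obtain z where inv: "invariant z 1" and rl: "\<And>j k. j \<in> J \<Longrightarrow> k \<in> J \<Longrightarrow> rloc (X j * X k) (z j k)"
    and cocycle: "\<And>j k l. j \<in> J \<Longrightarrow> k \<in> J \<Longrightarrow> l \<in> J \<Longrightarrow> z j k + z l k = z j l"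
    using invariant_nontrivial[OF X_ev0] by blast
  have diag: "z j j = 0" if "j \<in> J" for j using cocycle[OF that that that] by simp
  have sym: "z j k = z k j" if "j \<in> J" "k \<in> J" for j k
    using cocycle[OF that(2) that(2) that(1)] diag[OF that(2)] by simp
  \<comment> \<open>\<open>Min\<close> and \<open>Max\<close> read an ordered pair off a two-element
    set; symmetry makes the order irrelevant.\<close>
  have mm: "z (Min {j, k}) (Max {j, k}) = z j k" if "j \<in> J" "k \<in> J" for j k
    using sym[OF that] by (cases "j \<le> k") (auto simp: min_def max_def)
  have ex: "\<exists>U\<in>carrier (L (Mon I)). (I \<subseteq> J \<longrightarrow> cval (Mon I) U = z (Min I) (Max I))"
    if I: "I \<in> idx (Suc (Suc 0))" for I
  proof (cases "I \<subseteq> J")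
    case True
    obtain j k where jk: "I = {j, k}" "j \<noteq> k"
      using idxD(3)[OF I] by (auto simp: card_2_iff simp flip: numeral_2_eq_2)
    have "rloc (\<Prod>j\<in>I. X j) (z (Min I) (Max I))"
      using rl[of j k] mm[of j k] True jk by simp
    then show ?thesis using rloc_cochain[OF I True] by blast
  next
    case False
    then show ?thesis using loc_zero[OF loc[OF I]] by blast
  qed
  then obtain U where U: "\<And>I. I \<in> idx (Suc (Suc 0)) \<Longrightarrow> U I \<in> carrier (L (Mon I))"
    "\<And>I. I \<in> idx (Suc (Suc 0)) \<Longrightarrow> I \<subseteq> J \<Longrightarrow> cval (Mon I) (U I) = z (Min I) (Max I)" by metis
  define c where "c = (\<lambda>I\<in>idx (Suc (Suc 0)). U I)"
  have c: "c \<in> carrier (C (Suc (Suc 0)))" using U by (auto simp: c_def C_simps)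
  have zz_c: "zz c j k = z j k" if "j \<in> J" "k \<in> J" for j k
  proof (cases "j = k")
    case False
    then show ?thesis using U(2)[OF pair_idx[OF that False]] pair_idx[OF that False] mm[OF that] that
      by (simp add: zz_def \<Phi>_def c_def)
  qed (simp add: zz_def diag that)
  have "\<delta> (Suc (Suc 0)) c = \<zero>\<^bsub>C (Suc (Suc (Suc 0)))\<^esub>"
  proof (rule \<Phi>_eqI[where i = "Suc (Suc (Suc 0))"])
    show "\<delta> (Suc (Suc 0)) c \<in> carrier (C (Suc (Suc (Suc 0))))" by (rule diff_simps(1)[OF c])
    fix I assume I: "I \<in> idx (Suc (Suc (Suc 0)))"
    show "\<Phi> (Suc (Suc (Suc 0))) (\<delta> (Suc (Suc 0)) c) I = \<Phi> (Suc (Suc (Suc 0))) \<zero>\<^bsub>C (Suc (Suc (Suc 0)))\<^esub> I"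
    proof (cases "\<zero> \<in> Mon I")
      case False
      then have IJ: "I \<subseteq> J" using idxD(1)[OF I] zero_in_Mon[OF idxD(1)[OF I]] by (auto simp: J_def)
      obtain j k l where jkl: "I = {j, k, l}" "distinct [j, k, l]"
        using idxD(3)[OF I] by (auto simp: card_3_iff simp flip: numeral_3_eq_3)
      have "\<Phi> (Suc (Suc (Suc 0))) (\<delta> (Suc (Suc 0)) c) I = z k l + z j l + z j k"
        using diff_triple[OF c _ _ _ jkl(2)] IJ by (simp add: jkl(1) zz_c)
      also have "\<dots> = (z j k + z l k) + z j l"
        using IJ sym[of k l] by (simp add: jkl(1) ac_simps)
      also have "\<dots> = 0" using IJ cocycle[of j k l] by (simp add: jkl(1))
      finally show ?thesis by (simp add: CG.\<Phi>_zero)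
    qed (simp add: diff_simps[OF c] CG.\<Phi>_zero)
  qed simp
  then have cZ: "c \<in> Z (Suc (Suc 0))" using c by (simp add: Z_iff)
  obtain t where t: "has_invariant c t" using has_invariant_exists[OF cZ] by blast
  \<comment> \<open>\<open>zz c\<close> equals \<open>z\<close> only on \<open>J\<close>, so the
    value is transferred by uniqueness of the invariant.\<close>
  have "t = 1 + 0"
    by (rule invariant_add[OF inv invariant_0 t, of "\<lambda>_. 0"])
      (auto simp: zz_c rloc_def intro: R0_closed exI[of _ 0] bexI[of _ 0])
  then show ?thesis using cZ t by auto
qed

section \<open>Frobenius-stable secondary submodules\<close>

lemma stable_secondary_invariant:
  assumes sec: "secondary R (H (Suc (Suc 0))\<lparr>carrier := N\<rparr>)" and NH: "N \<subseteq> carrier (H (Suc (Suc 0)))"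
    and F: "FrH (Suc (Suc 0)) ` N \<subseteq> N"
    and z: "z \<in> Z (Suc (Suc 0))" "coset (Suc (Suc 0)) z \<in> N" and t: "has_invariant z t"
  shows "t = 0"
proof -
  have zC: "z \<in> carrier (C (Suc (Suc 0)))" using z by (simp add: Z_iff)
  obtain r where r: "r \<in> carrier R" "\<rho> r = va\<^sup>2" using \<rho>_surj[OF R0_square_vars(1)] by blast
  have "(\<lambda>v. r \<odot>\<^bsub>H (Suc (Suc 0))\<^esub> v) ` N = N \<or>
      (\<exists>k. \<forall>v\<in>N. ((\<lambda>v. r \<odot>\<^bsub>H (Suc (Suc 0))\<^esub> v) ^^ k) v = \<zero>\<^bsub>H (Suc (Suc 0))\<^esub>)"
    using sec r(1) by (simp add: secondary_def)
  then show ?thesis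
  proof
    assume "(\<lambda>v. r \<odot>\<^bsub>H (Suc (Suc 0))\<^esub> v) ` N = N"
    then obtain v where v: "v \<in> N" "coset (Suc (Suc 0)) z = r \<odot>\<^bsub>H (Suc (Suc 0))\<^esub> v" using z(2) by blast
    obtain w where w: "w \<in> Z (Suc (Suc 0))" "w \<in> carrier (C (Suc (Suc 0)))" "v = coset (Suc (Suc 0)) w"
      by (rule H_cases[OF subsetD[OF NH v(1)]])
    have "coset (Suc (Suc 0)) z = coset (Suc (Suc 0)) (r \<odot>\<^bsub>C (Suc (Suc 0))\<^esub> w)"
      unfolding v(2) w(3) by (rule H_smult[OF w(2) r(1)])
    then obtain y where y: "y \<in> carrier (C (Suc 0))"
        "z = \<delta> (Suc 0) y \<oplus>\<^bsub>C (Suc (Suc 0))\<^esub> (r \<odot>\<^bsub>C (Suc (Suc 0))\<^esub> w)"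
      using coset_eqD[OF _ zC] by blast
    obtain s where s: "has_invariant w s" using has_invariant_exists[OF w(1)] by blast
    have "zz (r \<odot>\<^bsub>C (Suc (Suc 0))\<^esub> w) = (\<lambda>j k. to_fract (va\<^sup>2) * zz w j k)"
      using zz_smult[OF w(2) r(1)] r(2) by (simp add: fun_eq_iff)
    then have "has_invariant (r \<odot>\<^bsub>C (Suc (Suc 0))\<^esub> w) 0" using invariant_times_va[OF s] by simp
    from has_invariant_cong[OF this t Z_closed(3)[OF w(1) r(1)] y] show ?thesis .
  next
    assume "\<exists>n. \<forall>v\<in>N. ((\<lambda>v. r \<odot>\<^bsub>H (Suc (Suc 0))\<^esub> v) ^^ n) v = \<zero>\<^bsub>H (Suc (Suc 0))\<^esub>"
    then obtain n where n: "\<And>v. v \<in> N \<Longrightarrow> ((\<lambda>v. r \<odot>\<^bsub>H (Suc (Suc 0))\<^esub> v) ^^ n) v = \<zero>\<^bsub>H (Suc (Suc 0))\<^esub>"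
      by blast
    \<comment> \<open>All Frobenius iterates of the class stay in \<open>N\<close>, so the same
      \<open>n\<close> serves every \<open>m\<close>; this uniformity is what bounds the
      poles.\<close>
    have "\<exists>y\<in>carrier (C (Suc 0)). \<forall>j\<in>J. \<forall>k\<in>J.
        to_fract (va ^ (2 * n)) * zz z j k ^ (2 ^ m) = \<Phi> (Suc 0) y {j} + \<Phi> (Suc 0) y {k}" for m
    proof -
      define w where "w = (Fr (Suc (Suc 0)) ^^ m) z"
      define u where "u = ((\<lambda>w. r \<odot>\<^bsub>C (Suc (Suc 0))\<^esub> w) ^^ n) w"
      have w: "w \<in> Z (Suc (Suc 0))" unfolding w_def by (rule zz_iterated(4)[OF z(1) r(1)])
      have u: "u \<in> Z (Suc (Suc 0))" unfolding u_def by (rule zz_iterated(1)[OF w r(1)])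
      have "(FrH (Suc (Suc 0)) ^^ m) (coset (Suc (Suc 0)) z) \<in> N" using F z(2) by (induction m) auto
      then have "coset (Suc (Suc 0)) w \<in> N" unfolding w_def by (simp only: zz_iterated(6)[OF z(1) r(1)])
      from n[OF this] have "coset (Suc (Suc 0)) u = coset (Suc (Suc 0)) \<zero>\<^bsub>C (Suc (Suc 0))\<^esub>"
        unfolding u_def by (simp only: zz_iterated(3)[OF w r(1)] H_zero)
      then obtain y where y: "y \<in> carrier (C (Suc 0))"
          "u = \<delta> (Suc 0) y \<oplus>\<^bsub>C (Suc (Suc 0))\<^esub> \<zero>\<^bsub>C (Suc (Suc 0))\<^esub>"
        using coset_eqD[of "Suc 0" u] u by (auto simp: Z_iff)
      then have "u = \<delta> (Suc 0) y" by (simp add: diff_simps)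
      moreover have "zz u j k = to_fract (va ^ (2 * n)) * zz z j k ^ (2 ^ m)" for j k
        unfolding u_def w_def zz_iterated(2)[OF w[unfolded w_def] r(1)] zz_iterated(5)[OF z(1) r(1)]
        by (simp add: r(2) power_mult)
      ultimately show ?thesis using zz_diff[OF y(1)] y(1) by metis
    qed
    then obtain y where y: "\<And>m. y m \<in> carrier (C (Suc 0))"
      "\<And>m j k. j \<in> J \<Longrightarrow> k \<in> J \<Longrightarrow>
        to_fract (va ^ (2 * n)) * zz z j k ^ (2 ^ m) = \<Phi> (Suc 0) (y m) {j} + \<Phi> (Suc 0) (y m) {k}"
      by metis
    show ?thesis
      by (rule invariant_bounded_poles[OF t rloc_one_cochain[OF y(1)] y(2)])
  qed
qed

theorem no_F_stable_secondary_representation: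
  "\<not> F_stable_secondary_representation R (H (Suc (Suc 0))) (FrH (Suc (Suc 0))) n N"
proof
  assume "F_stable_secondary_representation R (H (Suc (Suc 0))) (FrH (Suc (Suc 0))) n N"
  then have sub: "\<And>j. j < n \<Longrightarrow> submodule (N j) R (H (Suc (Suc 0)))"
    and sec: "\<And>j. j < n \<Longrightarrow> secondary R (H (Suc (Suc 0))\<lparr>carrier := N j\<rparr>)"
    and sums: "carrier (H (Suc (Suc 0))) = {(\<Oplus>\<^bsub>H (Suc (Suc 0))\<^esub>j\<in>{..<n}. v j) | v. \<forall>j<n. v j \<in> N j}"
    and F: "\<And>j. j < n \<Longrightarrow> FrH (Suc (Suc 0)) ` N j \<subseteq> N j"
    by (auto simp: F_stable_secondary_representation_def secondary_representation_def)
  have NH: "N j \<subseteq> carrier (H (Suc (Suc 0)))" if "j < n" for j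
    using subgroup.subset[OF submodule.axioms(1)[OF sub[OF that]]] by simp
  obtain e where e: "e \<in> Z (Suc (Suc 0))" "has_invariant e 1" using exists_invariant_1 by blast
  have "coset (Suc (Suc 0)) e \<in> carrier (H (Suc (Suc 0)))" using e(1) by (simp add: H_carrier)
  then obtain v where v: "coset (Suc (Suc 0)) e = (\<Oplus>\<^bsub>H (Suc (Suc 0))\<^esub>j\<in>{..<n}. v j)"
      "\<And>j. j < n \<Longrightarrow> v j \<in> N j"
    unfolding sums by blast
  have "\<exists>z. z \<in> Z (Suc (Suc 0)) \<and> v j = coset (Suc (Suc 0)) z" if j: "j < n" for j
    by (rule H_cases[OF subsetD[OF NH[OF j] v(2)[OF j]]]) blast
  then obtain z where z: "\<And>j. j < n \<Longrightarrow> z j \<in> Z (Suc (Suc 0))" "\<And>j. j < n \<Longrightarrow> v j = coset (Suc (Suc 0)) (z j)"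
    by metis
  have inv: "has_invariant (z j) 0" if j: "j < n" for j
  proof -
    obtain t where t: "has_invariant (z j) t" using has_invariant_exists[OF z(1)[OF j]] by blast
    then have "t = 0"
      using v(2)[OF j] z(2)[OF j] by (intro stable_secondary_invariant[OF sec[OF j] NH[OF j] F[OF j] z(1)[OF j]]) auto
    then show ?thesis using t by simp
  qed
  define f where "f = finsum (C (Suc (Suc 0))) z {..<n}"
  have f: "f \<in> Z (Suc (Suc 0))" "has_invariant f 0"
    unfolding f_def using z(1) inv by (auto intro!: Z_finsum has_invariant_finsum)
  have "coset (Suc (Suc 0)) e = coset (Suc (Suc 0)) f"
    unfolding v(1) f_def using z by (intro H_finsum) auto
  then obtain y where y: "y \<in> carrier (C (Suc 0))" "e = \<delta> (Suc 0) y \<oplus>\<^bsub>C (Suc (Suc 0))\<^esub> f"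
    using coset_eqD[of "Suc 0" e f] e(1) by (auto simp: Z_iff)
  have "1 = (0 :: gf4)" by (rule has_invariant_cong[OF f(2) e(2) f(1) y])
  then show False by simp
qed

end


section \<open>Encoding by sets of natural numbers\<close>

text \<open>The graph of the coefficient function, coded by natural numbers. As \<open>R0\<close> is
  uncountable, its elements become sets of naturals and not naturals.\<close>

definition enc :: "pow \<Rightarrow> nat set"
  where "enc f = range (\<lambda>(i, j, k). to_nat (i, j, k, f $ i $ j $ k))"

lemma inj_enc: "inj enc"
proof (rule injI)
  fix f g assume "enc f = enc g"
  then have "to_nat (i, j, k, f $ i $ j $ k) \<in> enc g" for i j k
    unfolding enc_def by (metis (no_types, lifting) case_prod_conv rangeI)
  then have "f $ i $ j $ k = g $ i $ j $ k" for i j k by (fastforce simp: enc_def)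
  then show "f = g" by (simp add: fps_eq_iff)
qed

definition dec :: "nat set \<Rightarrow> pow" where "dec = the_inv enc"

lemma dec_enc [simp]: "dec (enc f) = f"
  by (simp add: dec_def the_inv_f_f inj_enc)

definition R0_encoded :: "nat set ring"
  where "R0_encoded = \<lparr>carrier = enc ` R0, monoid.mult = (\<lambda>x y. enc (dec x * dec y)), one = enc 1,
    zero = enc 0, add = (\<lambda>x y. enc (dec x + dec y))\<rparr>"

lemma R0_model_encoded: "R0_model R0_encoded dec"
proof -
  have "abelian_group R0_encoded"
    by (rule abelian_groupI)
      (auto simp: R0_encoded_def R0_closed algebra_simps, metis add_self)
  moreover have "Group.comm_monoid R0_encoded"
    by (rule comm_monoidI) (auto simp: R0_encoded_def R0_closed algebra_simps intro!: imageI)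
  ultimately have "cring R0_encoded"
    by (rule cringI) (auto simp: R0_encoded_def algebra_simps)
  then show ?thesis
    unfolding R0_model_def R0_model_axioms_def
    by (auto simp: R0_encoded_def inj_on_def image_image)
qed

theorem corollary1p2:
  shows "\<exists>(R :: nat set ring) (\<mm> :: nat set set) (p :: nat) (i :: nat).
    domain R \<and> noetherian_ring R \<and> local_ring R \<mm> \<and>
    prime p \<and> has_characteristic R p \<and> F_finite R p \<and>
    (\<forall>xs. set xs \<subseteq> carrier R \<and> genideal R (set xs) = \<mm> \<longrightarrow>
      \<not> (\<exists>n N. F_stable_secondary_representation R (local_cohomology R xs i)
                 (local_cohomology_frobenius R p xs i) n N))"
proof -
  interpret R0_model R0_encoded dec by (rule R0_model_encoded)
  have "\<not> F_stable_secondary_representation R0_encoded (local_cohomology R0_encoded xs (Suc (Suc 0)))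
      (local_cohomology_frobenius R0_encoded 2 xs (Suc (Suc 0))) n N"
    if "set xs \<subseteq> carrier R0_encoded \<and> genideal R0_encoded (set xs) = max_ideal" for xs n N
  proof -
    interpret R0_model_cech R0_encoded dec xs by unfold_locales (use that in auto)
    show ?thesis by (rule no_F_stable_secondary_representation)
  qed
  then show ?thesis
    using is_domain is_noetherian is_local is_char_2 is_F_finite two_is_prime_nat by blast
qed

end
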